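(* Let $\{X_i\}$ be i.i.d. with arbitrary law $\mu$. Then $\mathcal X_M=\overline{\mathcal X_B}\cap\{f:f(0)=1\}$ (closure in $(\mathcal X_M',\tau_{AW})$), and $\{M_n\}$ satisfies the large deviation principle in $(\mathcal X_M,\tau_{AW})$ with good rate function $$I_M(f)=-\inf_{G\ni f}\limsup_{n\to\infty}\frac1n\log P(M_n\in G)=-\inf_{G\ni f}\liminf_{n\to\infty}\frac1n\log P(M_n\in G),$$ the infima being over $\tau_{AW}$-open $G$ containing $f$.
   Context: Let $\{X_i\}_{i\ge1}$ be i.i.d. real-valued random variables with common law $\mu$, $M_n(\theta)=\frac1n\sum_{i=1}^ne^{\theta X_i}$. For a probability measure $\nu$ let $f_\nu(\theta)=\int e^{\theta x}\nu(dx)\in(0,\infty]$. $\mathcal X_B=\{f_\nu:\nu$ compactly supported probability on $\mathbb R\}$. For $f:\mathbb R\to[-\infty,\infty]$, $\mathrm{epi}(f)=\{(\theta,b):b\ge f(\theta)\}$. On $\mathbb R^2$ use the box metric $d$, $d(x,A)=\inf_{y\in A}d(x,y)$, $\overline B_k=\{x:d(0,x)\le k\}$. The Attouch–Wets topology $\tau_{AW}$ has local base at $f$ given by $V_k(f)=\{g:\sup_{x\in\overline B_k}|d(x,\mathrm{epi}(g))-d(x,\mathrm{epi}(f))|<1/k\}$. $\mathcal X_M'$ = lower semicontinuous convex $f:\mathbb R\to[0,\infty]$ with $f(0)<\infty$; $\mathcal X_M$ = those $f\in\mathcal X_M'$ with values in $(0,\infty]$ for which some probability $\nu$ satisfies $f(\theta)=f_\nu(\theta)$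 whenever $f(\theta)<\infty$. A good rate function is lower semicontinuous with compact level sets. *)

theory Defs
  imports "HOL-Probability.Probability"
begin

definition epi :: "(real \<Rightarrow> ereal) \<Rightarrow> (real \<times> real) set" where
  "epi f = {(\<theta>, b). ereal b \<ge> f \<theta>}"

definition box_dist :: "real \<times> real \<Rightarrow> real \<times> real \<Rightarrow> real" where
  "box_dist x y = max \<bar>fst x - fst y\<bar> \<bar>snd x - snd y\<bar>"

definition box_setdist :: "real \<times> real \<Rightarrow> (real \<times> real) set \<Rightarrow> real" where
  "box_setdist x A = Inf (box_dist x ` A)"

definition box_ball :: "real \<Rightarrow> (real \<times> real) set" where
  "box_ball k = {x. box_dist (0, 0) x \<le> k}"

definition lsc_fun :: "(real \<Rightarrow> ereal) \<Rightarrow> bool" where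
  "lsc_fun f \<longleftrightarrow> (\<forall>x. f x \<le> Liminf (at x) f)"

definition convex_efun :: "(real \<Rightarrow> ereal) \<Rightarrow> bool" where
  "convex_efun f \<longleftrightarrow> (\<forall>x y t. 0 \<le> t \<and> t \<le> 1 \<longrightarrow>
      f (t * x + (1 - t) * y) \<le> ereal t * f x + ereal (1 - t) * f y)"

definition XMp :: "(real \<Rightarrow> ereal) set" where
  "XMp = {f. lsc_fun f \<and> convex_efun f \<and> (\<forall>\<theta>. 0 \<le> f \<theta>) \<and> f 0 < \<infinity>}"

definition mgf :: "real measure \<Rightarrow> real \<Rightarrow> ereal" where
  "mgf \<nu> \<theta> = enn2ereal (\<integral>\<^sup>+ x. ennreal (exp (\<theta> * x)) \<partial>\<nu>)"

definition real_prob :: "real measure \<Rightarrow> bool" where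
  "real_prob \<nu> \<longleftrightarrow> prob_space \<nu> \<and> sets \<nu> = sets borel"

definition compact_supp :: "real measure \<Rightarrow> bool" where
  "compact_supp \<nu> \<longleftrightarrow> (\<exists>K. compact K \<and> K \<in> sets \<nu> \<and> emeasure \<nu> K = 1)"

definition XB :: "(real \<Rightarrow> ereal) set" where
  "XB = {mgf \<nu> | \<nu>. real_prob \<nu> \<and> compact_supp \<nu>}"

definition XM :: "(real \<Rightarrow> ereal) set" where
  "XM = {f \<in> XMp. (\<forall>\<theta>. 0 < f \<theta>) \<and>
          (\<exists>\<nu>. real_prob \<nu> \<and> (\<forall>\<theta>. f \<theta> < \<infinity> \<longrightarrow> f \<theta> = mgf \<nu> \<theta>))}"

definition AW_nbhd :: "nat \<Rightarrow> (real \<Rightarrow> ereal) \<Rightarrow> (real \<Rightarrow> ereal) set" where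
  "AW_nbhd k f = {g. \<forall>x \<in> box_ball (real k).
      \<bar>box_setdist x (epi g) - box_setdist x (epi f)\<bar> < 1 / real k}"

text \<open>The topology on X_M' for which the sets V_k(f), k >= 1, form a local base at f.\<close>
definition AW :: "(real \<Rightarrow> ereal) topology" where
  "AW = topology (\<lambda>U. U \<subseteq> XMp \<and> (\<forall>f \<in> U. \<exists>k \<ge> 1. AW_nbhd k f \<inter> XMp \<subseteq> U))"

definition AW_M :: "(real \<Rightarrow> ereal) topology" where
  "AW_M = subtopology AW XM"

definition eln :: "real \<Rightarrow> ereal" where
  "eln p = (if 0 < p then ereal (ln p) else - \<infinity>)"

definition good_rate_function :: "'b topology \<Rightarrow> ('b \<Rightarrow> ereal) \<Rightarrow> bool" where
  "good_rate_function T I \<longleftrightarrow> (\<forall>x \<in> topspace T. 0 \<le> I x) \<and>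
     (\<forall>a::real. closedin T {x \<in> topspace T. I x \<le> ereal a}) \<and>
     (\<forall>a::real. compactin T {x \<in> topspace T. I x \<le> ereal a})"

definition LDP :: "'a measure \<Rightarrow> 'b topology \<Rightarrow> (nat \<Rightarrow> 'a \<Rightarrow> 'b) \<Rightarrow> ('b \<Rightarrow> ereal) \<Rightarrow> bool" where
  "LDP P T Z I \<longleftrightarrow>
     (\<forall>F. closedin T F \<longrightarrow>
        limsup (\<lambda>n. eln (measure P {\<omega> \<in> space P. Z n \<omega> \<in> F}) / ereal (real n))
          \<le> - (INF x\<in>F. I x)) \<and>
     (\<forall>G. openin T G \<longrightarrow>
        liminf (\<lambda>n. eln (measure P {\<omega> \<in> space P. Z n \<omega> \<in> G}) / ereal (real n))
          \<ge> - (INF x\<in>G. I x))"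

definition Mn :: "(nat \<Rightarrow> 'a \<Rightarrow> real) \<Rightarrow> nat \<Rightarrow> 'a \<Rightarrow> real \<Rightarrow> ereal" where
  "Mn X n \<omega> \<theta> = ereal ((1 / real n) * (\<Sum>i<n. exp (\<theta> * X i \<omega>)))"

definition I_limsup :: "'a measure \<Rightarrow> (nat \<Rightarrow> 'a \<Rightarrow> real) \<Rightarrow> (real \<Rightarrow> ereal) \<Rightarrow> ereal" where
  "I_limsup P X f = - (INF G \<in> {G. openin AW_M G \<and> f \<in> G}.
      limsup (\<lambda>n. eln (measure P {\<omega> \<in> space P. Mn X n \<omega> \<in> G}) / ereal (real n)))"

definition I_liminf :: "'a measure \<Rightarrow> (nat \<Rightarrow> 'a \<Rightarrow> real) \<Rightarrow> (real \<Rightarrow> ereal) \<Rightarrow> ereal" where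
  "I_liminf P X f = - (INF G \<in> {G. openin AW_M G \<and> f \<in> G}.
      liminf (\<lambda>n. eln (measure P {\<omega> \<in> space P. Mn X n \<omega> \<in> G}) / ereal (real n)))"

end

theory Submission
  imports Defs
begin

text \<open>An \<open>f\<close> in \<open>XMp\<close> is encoded by the distance function of its epigraph. Distance functions are
  1-Lipschitz, so the Attouch--Wets topology is the topology of pointwise convergence of distance
  functions, and by Tychonoff \<open>{f. f 0 \<le> 1}\<close> is compact. A limit of moment generating functions with
  value \<open>1\<close> at \<open>0\<close> loses no mass: near \<open>0\<close> inside its domain this forces tightness, Helly's theorem
  gives a limit law, and uniform integrability identifies the limit inside the domain. Conversely,
  truncate the law and add tiny masses far out, which blow up exactly off the domain.

  For the large deviations, every \<open>f\<close> in \<open>XM\<close> has arbitrarily small convex neighbourhoods (not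
  necessarily open). Since \<open>M\<^sub>n\<^sub>+\<^sub>m\<close> is a convex combination of independent copies of \<open>M\<^sub>n\<close> and
  \<open>M\<^sub>m\<close>, the probability of such a set is supermultiplicative in \<open>n\<close>, so upper and lower local rates
  agree. An exponential moment of a slowly growing function of \<open>\<bar>X\<bar>\<close> gives exponential tightness
  for an arbitrary law, and the compact sets obtained stay inside \<open>XM\<close>.\<close>

text \<open>Compactness of \<open>{f \<in> XMp. f 0 \<le> 1}\<close> alone does not give the LDP,
  because \<open>XM\<close> is not closed in it: as y tends to infinity, the transforms of (1 - w)
  delta_0 + w delta_y, with 0 < w < 1, converge to the function equal to 1 - w on (-inf, 0] and
  infinite on (0, inf). Lost mass shows as a drop of the value at 0, so every compact set used later
  must control tails uniformly. The second obstacle is that upper bounds on point values are not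
  open conditions: an approximant may be infinite at a boundary point of the domain of f. Upper
  bounds are therefore moved to nearby points, or obtained by convexity between two points that
  satisfy them. The third is that supermultiplicativity gives rates only along multiples of a block
  length m; a slack e in all conditions absorbs the incomplete last block, whose entries are bounded
  with probability at least 1/2.\<close>

section \<open>The box metric and distance functions of epigraphs\<close>

lemma box_dist_nonneg: "0 \<le> box_dist p q"
  by (simp add: box_dist_def)

lemma box_dist_commute: "box_dist p q = box_dist q p"
  by (simp add: box_dist_def abs_minus_commute)

lemma box_dist_triangle: "box_dist p r \<le> box_dist p q + box_dist q r"
  by (auto simp: box_dist_def)

lemma box_dist_self [simp]: "box_dist p p = 0"
  by (simp add: box_dist_def)

lemma box_dist_le_dist: "box_dist p q \<le> dist p q"
  using dist_fst_le[of p q] dist_snd_le[of p q] by (simp add: box_dist_def dist_real_def)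

definition epi_dist :: "(real \<Rightarrow> ereal) \<Rightarrow> real \<times> real \<Rightarrow> real" where
  "epi_dist f p = box_setdist p (epi f)"

lemma XMp_lsc: "f \<in> XMp \<Longrightarrow> ereal c < f x \<Longrightarrow> eventually (\<lambda>y. ereal c < f y) (at x)"
proof -
  assume "f \<in> XMp" and c: "ereal c < f x"
  then have "f x \<le> Liminf (at x) f"
    by (simp add: XMp_def lsc_fun_def)
  then show ?thesis using c by (auto simp: le_Liminf_iff)
qed

lemma XMp_lsc_nhds: "f \<in> XMp \<Longrightarrow> ereal c < f x \<Longrightarrow> eventually (\<lambda>y. ereal c < f y) (nhds x)"
  using XMp_lsc[of f c x] by (auto simp: eventually_at_filter elim: eventually_mono)

lemma XMp_convex: "f \<in> XMp \<Longrightarrow> 0 \<le> t \<Longrightarrow> t \<le> 1 \<Longrightarrow>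
    f (t * x + (1 - t) * y) \<le> ereal t * f x + ereal (1 - t) * f y"
  by (simp add: XMp_def convex_efun_def)

lemma XMp_nonneg: "f \<in> XMp \<Longrightarrow> 0 \<le> f x"
  and XMp_zero_finite: "f \<in> XMp \<Longrightarrow> f 0 < \<infinity>"
  by (simp_all add: XMp_def)

lemma XMp_between_less:
  assumes f: "f \<in> XMp" and "f x < ereal c" "f y < ereal c" "x < z" "z < y"
  shows "f z < ereal c"
proof -
  define t where "t = (y - z) / (y - x)"
  have t: "0 \<le> t" "t \<le> 1" using assms by (auto simp: t_def field_simps)
  have "t * (y - x) = y - z" using assms by (simp add: t_def)
  then have z: "z = t * x + (1 - t) * y" by (simp add: algebra_simps)
  obtain a where a: "f x = ereal a" using XMp_nonneg[OF f, of x] assms(2) by (cases "f x") auto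
  obtain b where b: "f y = ereal b" using XMp_nonneg[OF f, of y] assms(3) by (cases "f y") auto
  have "f z \<le> ereal (t * a + (1 - t) * b)"
    using XMp_convex[OF f t, of x y] unfolding z a b by simp
  also have "t * a + (1 - t) * b < c"
    using convex_bound_lt[of a c b t "1 - t"] t a b assms by simp
  finally show ?thesis by simp
qed

lemma epi_nonempty: "f 0 < \<infinity> \<Longrightarrow> epi f \<noteq> {}"
proof -
  assume "f 0 < \<infinity>"
  then obtain b where "f 0 \<le> ereal b" by (cases "f 0") auto
  then show ?thesis by (auto simp: epi_def)
qed

lemma epi_dist_bdd: "bdd_below (box_dist p ` A)"
  by (rule bdd_belowI[of _ 0]) (auto simp: box_dist_nonneg)

lemma epi_dist_nonneg: "f 0 < \<infinity> \<Longrightarrow> 0 \<le> epi_dist f p"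
  unfolding epi_dist_def box_setdist_def
  by (rule cINF_greatest) (auto simp: box_dist_nonneg epi_nonempty)

text \<open>The epigraph is closed upwards, so the box of radius \<open>r\<close> around
  \<open>p\<close> meets it exactly when \<open>f\<close> drops below the top edge of the box over
  its base. Most later arguments about distances go through this description.\<close>

lemma epi_dist_less_iff:
  assumes f: "f 0 < \<infinity>"
  shows "epi_dist f p < r \<longleftrightarrow> (\<exists>t. \<bar>t - fst p\<bar> < r \<and> f t < ereal (snd p + r))"
proof -
  have "epi_dist f p < r \<longleftrightarrow> (\<exists>q\<in>epi f. box_dist p q < r)"
    unfolding epi_dist_def box_setdist_def
    using cInf_less_iff[of "box_dist p ` epi f" r] epi_nonempty[of f, OF f] epi_dist_bdd by auto
  also have "\<dots> \<longleftrightarrow> (\<exists>t. \<bar>t - fst p\<bar> < r \<and> f t < ereal (snd p + r))"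
  proof (intro iffI)
    assume "\<exists>q\<in>epi f. box_dist p q < r"
    then obtain t b where "f t \<le> ereal b" "\<bar>fst p - t\<bar> < r" "\<bar>snd p - b\<bar> < r"
      by (auto simp: epi_def box_dist_def)
    moreover from this have "ereal b < ereal (snd p + r)" by simp
    ultimately show "\<exists>t. \<bar>t - fst p\<bar> < r \<and> f t < ereal (snd p + r)"
      by (intro exI[of _ t]) (auto intro: le_less_trans)
  next
    assume "\<exists>t. \<bar>t - fst p\<bar> < r \<and> f t < ereal (snd p + r)"
    then obtain t where t: "\<bar>t - fst p\<bar> < r" "f t < ereal (snd p + r)" by auto
    \<comment> \<open>The maximum with \<open>snd p - r\<close> keeps the chosen height above the
      bottom edge of the box too.\<close>
    then have "max (f t) (ereal (snd p - r)) < ereal (snd p + r)" by auto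
    then obtain b where "max (f t) (ereal (snd p - r)) < ereal b" "ereal b < ereal (snd p + r)"
      using ereal_dense2 by blast
    then show "\<exists>q\<in>epi f. box_dist p q < r"
      using t by (intro bexI[of _ "(t, b)"]) (auto simp: epi_def box_dist_def)
  qed
  finally show ?thesis .
qed

lemma epi_dist_lipschitz:
  assumes f: "f 0 < \<infinity>"
  shows "\<bar>epi_dist f p - epi_dist f q\<bar> \<le> box_dist p q"
proof -
  have *: "epi_dist f p \<le> epi_dist f q + box_dist p q" for p q
  proof -
    have "epi_dist f p - box_dist p q \<le> box_dist q r" if "r \<in> epi f" for r
    proof -
      have "epi_dist f p \<le> box_dist p r"
        unfolding epi_dist_def box_setdist_def using that by (intro cINF_lower epi_dist_bdd)
      then show ?thesis using box_dist_triangle[of p r q] by simp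
    qed
    then have "epi_dist f p - box_dist p q \<le> epi_dist f q"
      unfolding epi_dist_def[of f q] box_setdist_def
      using epi_nonempty[of f, OF f] by (intro cINF_greatest) auto
    then show ?thesis by simp
  qed
  show ?thesis using *[of p q] *[of q p] by (simp add: box_dist_commute)
qed

text \<open>Lower semicontinuity makes the epigraph closed, so the distance vanishes on the epigraph
  only, and \<open>f\<close> can be recovered from \<open>epi_dist f\<close>.\<close>

lemma epi_dist_eq_0_iff:
  assumes f: "f \<in> XMp"
  shows "epi_dist f (t, b) = 0 \<longleftrightarrow> f t \<le> ereal b"
proof
  assume le: "f t \<le> ereal b"
  have "epi_dist f (t, b) < r" if "r > 0" for r
    unfolding epi_dist_less_iff[of f, OF XMp_zero_finite[OF f]] using le that
    by (intro exI[of _ t]) (auto intro: le_less_trans)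
  then have "epi_dist f (t, b) \<le> 0" by (meson not_le less_irrefl)
  then show "epi_dist f (t, b) = 0" using epi_dist_nonneg[of f] XMp_zero_finite[OF f] by (simp add: order_antisym)
next
  assume 0: "epi_dist f (t, b) = 0"
  show "f t \<le> ereal b"
  proof (rule ccontr)
    assume "\<not> f t \<le> ereal b"
    then obtain c where c: "ereal b < ereal c" "ereal c < f t"
      using ereal_dense2[of "ereal b" "f t"] by (auto simp: not_le)
    obtain d where d: "d > 0" "\<And>s. dist s t < d \<Longrightarrow> ereal c < f s"
      using XMp_lsc_nhds[OF f c(2)] unfolding eventually_nhds_metric by auto
    have "epi_dist f (t, b) < min d (c - b)" using 0 d c by simp
    then obtain s where s: "\<bar>s - t\<bar> < min d (c - b)" "f s < ereal (b + min d (c - b))"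
      unfolding epi_dist_less_iff[of f, OF XMp_zero_finite[OF f]] fst_conv snd_conv by blast
    then have "ereal c < f s" using d(2)[of s] by (auto simp: dist_real_def)
    from less_trans[OF this s(2)] show False by simp
  qed
qed

text \<open>The point (0, 1) lies in every such epigraph, which bounds all distance functions at
  \<open>p\<close> simultaneously.\<close>

lemma epi_dist_le_anchor:
  assumes f: "f \<in> XMp" and "f 0 \<le> 1"
  shows "epi_dist f p \<le> box_dist p (0, 1)"
proof -
  have "epi_dist f (0, 1) = 0" using assms by (subst epi_dist_eq_0_iff) (auto simp: one_ereal_def)
  then show ?thesis using epi_dist_lipschitz[of f p "(0,1)"] XMp_zero_finite[OF f] by auto
qed

text \<open>This is convergence of epigraphs: an upper bound at one point keeps a box meeting the
  epigraphs, while keeping a box free of them needs lower bounds that are uniform over its base.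
  Compactness of the base turns local uniformity into uniformity.\<close>

lemma epi_dist_tendsto:
  assumes fin: "\<And>k. g k 0 < \<infinity>" "f 0 < \<infinity>"
    and up: "\<And>t c. f t < ereal c \<Longrightarrow> eventually (\<lambda>k. g k t < ereal c) F"
    and low: "\<And>t c. ereal c < f t \<Longrightarrow>
      \<exists>d>0. eventually (\<lambda>k. \<forall>s. \<bar>s - t\<bar> < d \<longrightarrow> ereal c < g k s) F"
  shows "((\<lambda>k. epi_dist (g k) p) \<longlongrightarrow> epi_dist f p) F"
proof (rule order_tendstoI)
  fix r assume "epi_dist f p < r"
  then obtain t where t: "\<bar>t - fst p\<bar> < r" "f t < ereal (snd p + r)"
    using epi_dist_less_iff[of f, OF fin(2)] by auto
  from up[OF t(2)] show "eventually (\<lambda>k. epi_dist (g k) p < r) F"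
    by eventually_elim (use t epi_dist_less_iff[of "g k" for k, OF fin(1)] in auto)
next
  fix r assume r: "r < epi_dist f p"
  show "eventually (\<lambda>k. r < epi_dist (g k) p) F"
  proof (cases "r < 0")
    case True
    then have "r < epi_dist (g k) p" for k
      using epi_dist_nonneg[of "g k" p, OF fin(1)] by linarith
    then show ?thesis by simp
  next
    case False
    \<comment> \<open>The closed box of the smaller radius \<open>r'\<close> still misses the
      epigraph of \<open>f\<close>, and its base is compact.\<close>
    define r' where "r' = (r + epi_dist f p) / 2"
    have r': "r < r'" "r' < epi_dist f p" "0 < r'" using r False by (auto simp: r'_def)
    have "ereal (snd p + r') < f t" if "t \<in> {fst p - r' .. fst p + r'}" for t
    proof (rule ccontr)
      assume "\<not> ereal (snd p + r') < f t"
      then have le: "f t \<le> ereal (snd p + r')" by simp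
      have "\<bar>t - fst p\<bar> \<le> r'" using that by (auto simp: abs_le_iff)
      moreover have "f t < ereal (snd p + epi_dist f p)" using le r' by (auto intro: le_less_trans)
      ultimately have "epi_dist f p < epi_dist f p"
        using r' epi_dist_less_iff[of f p, OF fin(2), of "epi_dist f p"] by auto
      then show False by simp
    qed
    then have ex: "\<forall>t\<in>{fst p - r' .. fst p + r'}. \<exists>d>0.
        eventually (\<lambda>k. \<forall>s. \<bar>s - t\<bar> < d \<longrightarrow> ereal (snd p + r') < g k s) F"
      using low by blast
    from bchoice[OF ex] obtain d where d: "\<And>t. t \<in> {fst p - r' .. fst p + r'} \<Longrightarrow> d t > 0"
      "\<And>t. t \<in> {fst p - r' .. fst p + r'} \<Longrightarrow>
        eventually (\<lambda>k. \<forall>s. \<bar>s - t\<bar> < d t \<longrightarrow> ereal (snd p + r') < g k s) F"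
      by blast
    have "compact {fst p - r' .. fst p + r'}" by simp
    then obtain D where D: "D \<subseteq> {fst p - r' .. fst p + r'}" "finite D"
      "{fst p - r' .. fst p + r'} \<subseteq> (\<Union>t\<in>D. ball t (d t))"
    proof (rule compactE_image[where C = "{fst p - r' .. fst p + r'}" and f = "\<lambda>t. ball t (d t)"])
      show "{fst p - r' .. fst p + r'} \<subseteq> (\<Union>t\<in>{fst p - r' .. fst p + r'}. ball t (d t))"
        using d(1) centre_in_ball by blast
    qed auto
    have "eventually (\<lambda>k. \<forall>t\<in>D. \<forall>s. \<bar>s - t\<bar> < d t \<longrightarrow> ereal (snd p + r') < g k s) F"
      using D d(2) by (intro eventually_ball_finite) auto
    then show ?thesis
    proof eventually_elim
      case (elim k)
      have "\<not> epi_dist (g k) p < r'"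
      proof
        assume "epi_dist (g k) p < r'"
        then obtain t where t: "\<bar>t - fst p\<bar> < r'" "g k t < ereal (snd p + r')"
          using epi_dist_less_iff[of "g k" for k, OF fin(1)] by auto
        then have "t \<in> {fst p - r' .. fst p + r'}" by (auto simp: abs_less_iff)
        then obtain u where "u \<in> D" "\<bar>t - u\<bar> < d u" using D(3) by (auto simp: dist_real_def abs_minus_commute)
        then have "ereal (snd p + r') < g k t" using elim by auto
        then show False using t by simp
      qed
      then show ?case using r' by simp
    qed
  qed
qed

text \<open>Lower semicontinuity bounds the limit from below and convexity from above. As
  \<open>f x\<close> may be infinite, identities along a segment pass to its end point whether or
  not that point is in the domain.\<close>

lemma XMp_tendsto_at_right:
  assumes f: "f \<in> XMp" and y: "f y < \<infinity>"
  shows "((\<lambda>s. f ((1 - s) * x + s * y)) \<longlongrightarrow> f x) (at_right 0)"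
proof (rule order_tendstoI)
  fix a assume a: "a < f x"
  have lim: "((\<lambda>s::real. (1 - s) * x + s * y) \<longlongrightarrow> x) (at_right 0)"
    by (auto intro!: tendsto_eq_intros)
  have "\<exists>c. a \<le> ereal c \<and> ereal c < f x"
  proof (cases a)
    case MInf
    then show ?thesis using a ereal_dense2[of a "f x"] by auto
  qed (use a in auto)
  then obtain c where c: "a \<le> ereal c" "ereal c < f x" by auto
  from lim XMp_lsc_nhds[OF f c(2)] have "eventually (\<lambda>s. ereal c < f ((1 - s) * x + s * y)) (at_right 0)"
    by (auto simp: filterlim_iff)
  then show "eventually (\<lambda>s. a < f ((1 - s) * x + s * y)) (at_right 0)"
    by eventually_elim (use c in \<open>auto intro: le_less_trans\<close>)
next
  fix a assume a: "f x < a"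
  obtain u where u: "f x = ereal u" using XMp_nonneg[OF f, of x] a by (cases "f x") auto
  obtain v where v: "f y = ereal v" using XMp_nonneg[OF f, of y] y by (cases "f y") auto
  have "((\<lambda>s. (1 - s) * u + s * v) \<longlongrightarrow> u) (at_right 0)"
    by (auto intro!: tendsto_eq_intros)
  then have "((\<lambda>s. ereal ((1 - s) * u + s * v)) \<longlongrightarrow> ereal u) (at_right 0)"
    by (rule tendsto_ereal)
  from order_tendstoD(2)[OF this] have "eventually (\<lambda>s. ereal ((1 - s) * u + s * v) < a) (at_right 0)"
    using a u by simp
  moreover have "eventually (\<lambda>s::real. s \<in> {0<..<1}) (at_right 0)"
    by (rule eventually_at_right_real) simp
  ultimately show "eventually (\<lambda>s. f ((1 - s) * x + s * y) < a) (at_right 0)"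
  proof eventually_elim
    case (elim s)
    have "f ((1 - s) * x + s * y) \<le> ereal ((1 - s) * u + s * v)"
      using XMp_convex[OF f, of "1 - s" x y] elim u v by simp
    then show ?case using elim by (auto intro: le_less_trans)
  qed
qed

subsection \<open>The Attouch--Wets topology\<close>

text \<open>The family in the definition of \<open>AW\<close> is a topology because
  \<open>AW_nbhd\<close> shrinks as its index grows, which handles intersections.\<close>

lemma openin_AW:
  "openin AW U \<longleftrightarrow> U \<subseteq> XMp \<and> (\<forall>f \<in> U. \<exists>k \<ge> 1. AW_nbhd k f \<inter> XMp \<subseteq> U)"
proof -
  have mono: "AW_nbhd l f \<subseteq> AW_nbhd k f" if "1 \<le> k" "k \<le> l" for k l f
  proof -
    have "box_ball (real k) \<subseteq> box_ball (real l)" using that by (auto simp: box_ball_def)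
    moreover have "1 / real l \<le> 1 / real k" using that by (auto simp: field_simps)
    ultimately show ?thesis unfolding AW_nbhd_def by (force intro: less_le_trans)
  qed
  have "istopology (\<lambda>U. U \<subseteq> XMp \<and> (\<forall>f \<in> U. \<exists>k \<ge> 1. AW_nbhd k f \<inter> XMp \<subseteq> U))"
    unfolding istopology_def
  proof (intro conjI allI impI)
    fix S T
    assume S: "S \<subseteq> XMp \<and> (\<forall>f \<in> S. \<exists>k \<ge> 1. AW_nbhd k f \<inter> XMp \<subseteq> S)"
      and T: "T \<subseteq> XMp \<and> (\<forall>f \<in> T. \<exists>k \<ge> 1. AW_nbhd k f \<inter> XMp \<subseteq> T)"
    show "\<forall>f \<in> S \<inter> T. \<exists>k \<ge> 1. AW_nbhd k f \<inter> XMp \<subseteq> S \<inter> T"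
    proof
      fix f assume "f \<in> S \<inter> T"
      then obtain k l where "k \<ge> 1" "l \<ge> 1" "AW_nbhd k f \<inter> XMp \<subseteq> S" "AW_nbhd l f \<inter> XMp \<subseteq> T"
        using S T by blast
      then show "\<exists>k \<ge> 1. AW_nbhd k f \<inter> XMp \<subseteq> S \<inter> T"
        using mono[of k "max k l" f] mono[of l "max k l" f] by (intro exI[of _ "max k l"]) auto
    qed
  next
    fix K assume "\<forall>S\<in>K. S \<subseteq> XMp \<and> (\<forall>f \<in> S. \<exists>k \<ge> 1. AW_nbhd k f \<inter> XMp \<subseteq> S)"
    then show "\<Union>K \<subseteq> XMp" "\<forall>f \<in> \<Union>K. \<exists>k \<ge> 1. AW_nbhd k f \<inter> XMp \<subseteq> \<Union>K"
      by (blast, meson Union_iff Sup_upper subset_trans)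
  qed blast
  then show ?thesis by (simp add: AW_def topology_inverse')
qed

lemma AW_nbhd_epi_dist:
  "g \<in> AW_nbhd k f \<longleftrightarrow> (\<forall>p \<in> box_ball (real k). \<bar>epi_dist g p - epi_dist f p\<bar> < 1 / real k)"
  by (simp add: AW_nbhd_def epi_dist_def)

lemma topspace_AW [simp]: "topspace AW = XMp"
proof -
  have "openin AW XMp" unfolding openin_AW by (auto intro!: exI[of _ 1])
  then show ?thesis using openin_AW by (auto simp: topspace_def)
qed

lemma continuous_map_epi_dist: "continuous_map AW euclideanreal (\<lambda>f. epi_dist f p)"
proof (subst continuous_map_def, intro conjI allI impI)
  fix U assume "openin euclideanreal U"
  then have U: "open U" by simp
  show "openin AW {f \<in> topspace AW. epi_dist f p \<in> U}"
    unfolding openin_AW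
  proof (intro conjI ballI)
    fix f assume f: "f \<in> {f \<in> topspace AW. epi_dist f p \<in> U}"
    then obtain e where e: "e > 0" "\<And>y. \<bar>y - epi_dist f p\<bar> < e \<Longrightarrow> y \<in> U"
      using U unfolding open_dist dist_real_def by blast
    obtain k :: nat where k: "real k > max (box_dist (0,0) p) (max 1 (1 / e))"
      using reals_Archimedean2 by blast
    then have "p \<in> box_ball (real k)" "1 / real k < e" "k \<ge> 1"
      using e by (auto simp: box_ball_def field_simps)
    then show "\<exists>k\<ge>1. AW_nbhd k f \<inter> XMp \<subseteq> {f \<in> topspace AW. epi_dist f p \<in> U}"
      using e by (intro exI[of _ k]) (force simp: AW_nbhd_epi_dist)
  qed auto
qed auto

lemma openin_AW_epi_dist_less: "openin AW {g \<in> XMp. epi_dist g p < r}"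
  and openin_AW_epi_dist_greater: "openin AW {g \<in> XMp. r < epi_dist g p}"
  using openin_continuous_map_preimage[OF continuous_map_epi_dist[of p], of "{..<r}"]
    openin_continuous_map_preimage[OF continuous_map_epi_dist[of p], of "{r<..}"] by auto

lemma openin_AW_ball:
  assumes "finite A" shows "openin AW {g \<in> XMp. \<forall>p\<in>A. \<bar>epi_dist g p - c p\<bar> < r}"
  using assms
proof (induction A)
  case empty
  have "openin AW XMp" using openin_topspace[of AW] by simp
  then show ?case by simp
next
  case (insert a A)
  have "{g \<in> XMp. \<forall>p\<in>insert a A. \<bar>epi_dist g p - c p\<bar> < r} =
    {g \<in> XMp. epi_dist g a < c a + r} \<inter> {g \<in> XMp. c a - r < epi_dist g a}
      \<inter> {g \<in> XMp. \<forall>p\<in>A. \<bar>epi_dist g p - c p\<bar> < r}"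
    by (auto simp: abs_less_iff)
  then show ?case using insert.IH
    by (auto intro!: openin_Int openin_AW_epi_dist_less openin_AW_epi_dist_greater)
qed

lemma box_ball_finite_net:
  assumes "e > 0"
  obtains A where "finite A" "\<And>p. p \<in> box_ball r \<Longrightarrow> \<exists>q\<in>A. box_dist p q < e"
proof -
  have sub: "box_ball r \<subseteq> cbox (-r, -r) (r, r)"
    by (auto simp: box_ball_def box_dist_def cbox_Pair_eq abs_le_iff)
  obtain A where A: "finite A" "cbox (-r, -r) (r, r) \<subseteq> (\<Union>x\<in>A. ball x e)"
    using compact_cbox[of "(-r,-r)" "(r,r)"] assms unfolding compact_eq_totally_bounded by blast
  have "\<exists>q\<in>A. box_dist p q < e" if p: "p \<in> box_ball r" for p
  proof -
    have "p \<in> (\<Union>x\<in>A. ball x e)" using sub A(2) p by blast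
    then obtain q where "q \<in> A" "dist q p < e" by auto
    then show ?thesis using box_dist_le_dist[of p q] by (auto simp: dist_commute intro: le_less_trans)
  qed
  then show ?thesis using that A by blast
qed

text \<open>Distance functions are 1-Lipschitz, so closeness on a finite net forces closeness on the
  whole ball: uniform neighbourhoods contain pointwise ones.\<close>

lemma openin_AW_finite_nbhd:
  assumes "openin AW U" "f \<in> U"
  obtains A e where "finite A" "e > 0" "{g \<in> XMp. \<forall>p\<in>A. \<bar>epi_dist g p - epi_dist f p\<bar> < e} \<subseteq> U"
proof -
  obtain k where k: "k \<ge> 1" "AW_nbhd k f \<inter> XMp \<subseteq> U" using assms openin_AW by blast
  \<comment> \<open>Two Lipschitz steps of length below \<open>e\<close> and the difference at a net
    point add up to less than \<open>3 * e\<close>.\<close>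
  define e where "e = 1 / (3 * real k)"
  have e: "e > 0" "3 * e = 1 / real k" using k by (auto simp: e_def)
  obtain A where A: "finite A" "\<And>p. p \<in> box_ball (real k) \<Longrightarrow> \<exists>q\<in>A. box_dist p q < e"
    using box_ball_finite_net[OF e(1)] by blast
  have fin: "f 0 < \<infinity>" using assms openin_AW XMp_zero_finite by blast
  have "{g \<in> XMp. \<forall>p\<in>A. \<bar>epi_dist g p - epi_dist f p\<bar> < e} \<subseteq> U"
  proof
    fix g assume g: "g \<in> {g \<in> XMp. \<forall>p\<in>A. \<bar>epi_dist g p - epi_dist f p\<bar> < e}"
    have "\<bar>epi_dist g p - epi_dist f p\<bar> < 3 * e" if p: "p \<in> box_ball (real k)" for p
    proof -
      obtain q where q: "q \<in> A" "box_dist p q < e" using A(2)[OF p] by auto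
      have "\<bar>epi_dist g p - epi_dist g q\<bar> \<le> box_dist p q" "\<bar>epi_dist f p - epi_dist f q\<bar> \<le> box_dist p q"
        using g fin by (auto intro!: epi_dist_lipschitz simp: XMp_zero_finite[simplified])
      moreover have "\<bar>epi_dist g q - epi_dist f q\<bar> < e" using g q by auto
      ultimately show ?thesis using q(2) by arith
    qed
    then have "g \<in> AW_nbhd k f" unfolding AW_nbhd_epi_dist e(2) by blast
    then show "g \<in> U" using k g by auto
  qed
  then show ?thesis using that A e by blast
qed


section \<open>Compactness of the functions with value at most 1 at the origin\<close>

lemma XMp_combo_less:
  assumes f: "f \<in> XMp" and "f s < ereal c" "f t < ereal d" "0 \<le> u" "u \<le> 1"
  shows "f (u * s + (1 - u) * t) < ereal (u * c + (1 - u) * d)"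
proof -
  obtain a where a: "f s = ereal a" using XMp_nonneg[OF f, of s] assms(2) by (cases "f s") auto
  obtain b where b: "f t = ereal b" using XMp_nonneg[OF f, of t] assms(3) by (cases "f t") auto
  have "f (u * s + (1 - u) * t) \<le> ereal (u * a + (1 - u) * b)"
    using XMp_convex[OF f assms(4,5), of s t] unfolding a b by simp
  also have "u * a + (1 - u) * b < u * c + (1 - u) * d"
  proof (cases "u = 0")
    case False
    then have "u * a < u * c" using assms a by simp
    moreover have "(1 - u) * b \<le> (1 - u) * d" using assms b by (intro mult_left_mono) auto
    ultimately show ?thesis by simp
  qed (use assms b in simp)
  finally show ?thesis by simp
qed

text \<open>Points of the two boxes where \<open>f\<close> is low combine to such a point of the
  combined box. Quasiconvexity is enough to make the zero set convex, and it survives pointwise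
  limits.\<close>

lemma epi_dist_quasiconvex:
  assumes f: "f \<in> XMp" and u: "0 \<le> u" "u \<le> 1"
  shows "epi_dist f (u *\<^sub>R p + (1 - u) *\<^sub>R q) \<le> max (epi_dist f p) (epi_dist f q)"
proof (rule ccontr)
  note less_iff = epi_dist_less_iff[of f, OF XMp_zero_finite[OF f]]
  let ?r = "epi_dist f (u *\<^sub>R p + (1 - u) *\<^sub>R q)"
  assume "\<not> ?r \<le> max (epi_dist f p) (epi_dist f q)"
  then have "epi_dist f p < ?r" "epi_dist f q < ?r" by auto
  then obtain s t where s: "\<bar>s - fst p\<bar> < ?r" "f s < ereal (snd p + ?r)"
    and t: "\<bar>t - fst q\<bar> < ?r" "f t < ereal (snd q + ?r)"
    unfolding less_iff by blast
  have "f (u * s + (1 - u) * t) < ereal (u * (snd p + ?r) + (1 - u) * (snd q + ?r))"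
    by (rule XMp_combo_less[OF f s(2) t(2) u])
  also have "u * (snd p + ?r) + (1 - u) * (snd q + ?r) = snd (u *\<^sub>R p + (1 - u) *\<^sub>R q) + ?r"
    by (simp add: algebra_simps)
  finally have "f (u * s + (1 - u) * t) < ereal (snd (u *\<^sub>R p + (1 - u) *\<^sub>R q) + ?r)" .
  moreover have "\<bar>(u * s + (1 - u) * t) - fst (u *\<^sub>R p + (1 - u) *\<^sub>R q)\<bar> < ?r"
  proof -
    have "(u * s + (1 - u) * t) - fst (u *\<^sub>R p + (1 - u) *\<^sub>R q) = u * (s - fst p) + (1 - u) * (t - fst q)"
      by (simp add: algebra_simps)
    moreover have "u * (s - fst p) + (1 - u) * (t - fst q) < ?r"
      using s(1) t(1) u by (intro convex_bound_lt) auto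
    moreover have "u * - (s - fst p) + (1 - u) * - (t - fst q) < ?r"
      using s(1) t(1) u by (intro convex_bound_lt) auto
    ultimately show ?thesis unfolding abs_less_iff by (simp add: algebra_simps)
  qed
  ultimately have "?r < ?r" unfolding less_iff by blast
  then show False by simp
qed

text \<open>The last condition says that every box of radius \<open>\<phi> p\<close> around \<open>p\<close> meets the zero set of \<open>\<phi>\<close>,
  in a form that is visibly closed under pointwise convergence: \<open>N r e\<close> stands for a finite \<open>e\<close>-net.\<close>

definition epi_dist_like :: "(real \<Rightarrow> real \<Rightarrow> (real \<times> real) set) \<Rightarrow> (real \<times> real \<Rightarrow> real) \<Rightarrow> bool" where
  "epi_dist_like N \<phi> \<longleftrightarrow>
     (\<forall>p q. \<bar>\<phi> p - \<phi> q\<bar> \<le> box_dist p q) \<and> (\<forall>p. 0 \<le> \<phi> p) \<and> \<phi> (0, 1) = 0 \<and>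
     (\<forall>p q. \<forall>u\<in>{0..1}. \<phi> (u *\<^sub>R p + (1 - u) *\<^sub>R q) \<le> max (\<phi> p) (\<phi> q)) \<and>
     (\<forall>t b. \<forall>s\<in>{0..}. \<phi> (t, b + s) \<le> \<phi> (t, b)) \<and> (\<forall>t b. - b \<le> \<phi> (t, b)) \<and>
     (\<forall>p. \<forall>e\<in>{0<..1}. \<exists>q\<in>N (box_dist (0, 0) p + box_dist p (0, 1) + 2) e.
         box_dist p q \<le> \<phi> p + 2 * e \<and> \<phi> q \<le> e)"

lemma epi_dist_like_epi_dist:
  assumes N: "\<And>r e p. 0 < e \<Longrightarrow> p \<in> box_ball r \<Longrightarrow> \<exists>q\<in>N r e. box_dist p q < e"
    and f: "f \<in> XMp" "f 0 \<le> 1"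
  shows "epi_dist_like N (epi_dist f)"
  unfolding epi_dist_like_def
proof (intro conjI allI ballI)
  note fin = XMp_zero_finite[OF f(1)]
  note less_iff = epi_dist_less_iff[of f, OF fin]
  show "\<bar>epi_dist f p - epi_dist f q\<bar> \<le> box_dist p q" for p q by (rule epi_dist_lipschitz[of f, OF fin])
  show "0 \<le> epi_dist f p" for p by (rule epi_dist_nonneg[of f, OF fin])
  show "epi_dist f (0, 1) = 0" using f by (simp add: epi_dist_eq_0_iff one_ereal_def)
  show "epi_dist f (u *\<^sub>R p + (1 - u) *\<^sub>R q) \<le> max (epi_dist f p) (epi_dist f q)" if "u \<in> {0..1}" for p q u
    using that by (intro epi_dist_quasiconvex f) auto
  show "epi_dist f (t, b + s) \<le> epi_dist f (t, b)" if s: "s \<in> {0..}" for t b s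
  proof (rule dense_ge)
    fix r assume "epi_dist f (t, b) < r"
    then obtain t' where t': "\<bar>t' - t\<bar> < r" "f t' < ereal (b + r)" unfolding less_iff by auto
    have "ereal (b + r) \<le> ereal (b + s + r)" using s by simp
    from less_le_trans[OF t'(2) this] have "epi_dist f (t, b + s) < r"
      unfolding less_iff using t'(1) by auto
    then show "epi_dist f (t, b + s) \<le> r" by simp
  qed
  show "- b \<le> epi_dist f (t, b)" for t b
  proof (rule dense_ge)
    fix r assume "epi_dist f (t, b) < r"
    then obtain t' where t': "f t' < ereal (b + r)" unfolding less_iff by auto
    from le_less_trans[OF XMp_nonneg[OF f(1), of t'] t'] show "- b \<le> r" by simp
  qed
  fix p and e :: real assume e: "e \<in> {0<..1}"
  then have "epi_dist f p < epi_dist f p + e" by simp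
  then obtain t where t: "\<bar>t - fst p\<bar> < epi_dist f p + e" "f t < ereal (snd p + (epi_dist f p + e))"
    unfolding less_iff by blast
  \<comment> \<open>The nearly optimal \<open>t\<close>, raised to the top edge of the box so that
    the point lies in the epigraph.\<close>
  let ?q = "(t, snd p + (epi_dist f p + e))"
  have q: "box_dist p ?q \<le> epi_dist f p + e"
    using t(1) e epi_dist_nonneg[of f p, OF fin] by (auto simp: box_dist_def abs_minus_commute)
  have q0: "epi_dist f ?q = 0" using t(2) by (simp add: epi_dist_eq_0_iff f)
  \<comment> \<open>The anchor (0, 1) bounds \<open>epi_dist f p\<close>, so this radius is
    independent of \<open>f\<close> and one net serves the whole family.\<close>
  have "?q \<in> box_ball (box_dist (0, 0) p + box_dist p (0, 1) + 2)"
    using q box_dist_triangle[of "(0,0)" ?q p] epi_dist_le_anchor[OF f, of p] e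
    by (auto simp: box_ball_def)
  then obtain r where r: "r \<in> N (box_dist (0, 0) p + box_dist p (0, 1) + 2) e" "box_dist ?q r < e"
    using N[of e] e by (metis greaterThanAtMost_iff)
  have "box_dist p r \<le> epi_dist f p + 2 * e"
    using box_dist_triangle[of p r ?q] q r by simp
  moreover have "epi_dist f r \<le> e"
    using epi_dist_lipschitz[of f ?q r, OF fin] q0 r by simp
  ultimately show "\<exists>q\<in>N (box_dist (0, 0) p + box_dist p (0, 1) + 2) e.
      box_dist p q \<le> epi_dist f p + 2 * e \<and> epi_dist f q \<le> e" using r by blast
qed

text \<open>The lowest zero over \<open>t\<close>. An empty set of zeros gives infinity, the value
  off the domain.\<close>

definition fun_of_dist :: "(real \<times> real \<Rightarrow> real) \<Rightarrow> real \<Rightarrow> ereal" where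
  "fun_of_dist \<phi> t = (INF b\<in>{b. \<phi> (t, b) = 0}. ereal b)"

lemma fun_of_dist_epi_dist:
  assumes f: "f \<in> XMp"
  shows "fun_of_dist (epi_dist f) = f"
proof
  fix t
  show "fun_of_dist (epi_dist f) t = f t"
  proof (cases "f t")
    case (real a)
    then show ?thesis unfolding fun_of_dist_def epi_dist_eq_0_iff[OF f]
      by (intro antisym INF_lower2[of a] INF_greatest) auto
  qed (use XMp_nonneg[OF f, of t] in \<open>auto simp: fun_of_dist_def epi_dist_eq_0_iff[OF f] top_ereal_def\<close>)
qed

lemma continuous_on_box_dist: "continuous_on UNIV (\<lambda>q. box_dist p q)"
  unfolding box_dist_def by (intro continuous_intros)

text \<open>The defining condition yields only approximate zeros at approximately the right
  distance. Minimising the continuous \<open>\<psi>\<close> over a compact box makes both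
  exact.\<close>

lemma epi_dist_like_zero_near:
  assumes \<phi>: "epi_dist_like N \<phi>"
  shows "\<exists>q. \<phi> q = 0 \<and> box_dist p q \<le> \<phi> p"
proof -
  have lip: "\<bar>\<phi> p - \<phi> q\<bar> \<le> box_dist p q" and nonneg: "0 \<le> \<phi> p" for p q
    using \<phi> unfolding epi_dist_like_def by blast+
  have cont: "continuous_on UNIV \<phi>"
  proof (rule continuous_onI)
    fix x e assume "e > (0::real)"
    moreover have "dist (\<phi> x') (\<phi> x) \<le> dist x' x" for x'
      using order_trans[OF lip[of x' x] box_dist_le_dist[of x' x]] by (simp add: dist_real_def)
    ultimately show "\<exists>d>0. \<forall>x'\<in>UNIV. dist x' x < d \<longrightarrow> dist (\<phi> x') (\<phi> x) \<le> e"
      by (meson less_imp_le order_trans)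
  qed
  \<comment> \<open>Approximate zeros for errors up to 1 lie within \<open>\<phi> p + 2\<close> of
    \<open>p\<close>, so the box contains them.\<close>
  define R where "R = \<phi> p + 2"
  define K where "K = cbox (fst p - R, snd p - R) (fst p + R, snd p + R)"
  have K: "q \<in> K \<longleftrightarrow> box_dist p q \<le> R" for q
    unfolding K_def by (cases q) (auto simp: cbox_Pair_eq box_dist_def abs_le_iff)
  define \<psi> where "\<psi> q = max (\<phi> q) (box_dist p q - \<phi> p)" for q
  have "continuous_on K \<psi>" unfolding \<psi>_def
    by (intro continuous_intros continuous_on_subset[OF cont] continuous_on_subset[OF continuous_on_box_dist]) auto
  moreover have "K \<noteq> {}" using K[of p] nonneg[of p] by (auto simp: R_def)
  ultimately obtain q where q: "q \<in> K" "\<And>y. y \<in> K \<Longrightarrow> \<psi> q \<le> \<psi> y"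
    using continuous_attains_inf[of K \<psi>] by (auto simp: K_def)
  have "\<psi> q \<le> e" if "e > 0" for e
  proof -
    have "min (e / 2) 1 \<in> {0<..1}" using that by auto
    then obtain y where y: "box_dist p y \<le> \<phi> p + 2 * min (e / 2) 1" "\<phi> y \<le> min (e / 2) 1"
      using \<phi> unfolding epi_dist_like_def by blast
    then have yK: "y \<in> K" unfolding K R_def by auto
    have "\<psi> y \<le> e" using y that unfolding \<psi>_def by auto
    then show ?thesis using q(2)[OF yK] by simp
  qed
  then have "\<psi> q \<le> 0" by (meson dense_ge)
  then show ?thesis using nonneg[of q] by (intro exI[of _ q]) (auto simp: \<psi>_def)
qed

text \<open>The zero set is closed, convex, closed upwards and contained in the upper half plane,
  hence the epigraph of a member of \<open>XMp\<close>. The Lipschitz bound gives one inequality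
  between \<open>\<phi>\<close> and the distance to it, exact nearby zeros the other.\<close>

lemma epi_dist_like_fun_of_dist:
  assumes \<phi>: "epi_dist_like N \<phi>"
  shows "fun_of_dist \<phi> \<in> XMp" "fun_of_dist \<phi> 0 \<le> 1" "epi_dist (fun_of_dist \<phi>) = \<phi>"
proof -
  let ?f = "fun_of_dist \<phi>"
  have lip: "\<bar>\<phi> p - \<phi> q\<bar> \<le> box_dist p q" and nonneg: "0 \<le> \<phi> p" for p q
    using \<phi> unfolding epi_dist_like_def by blast+
  have anchor: "\<phi> (0, 1) = 0"
    and quasi: "\<phi> (u *\<^sub>R p + (1 - u) *\<^sub>R q) \<le> max (\<phi> p) (\<phi> q)" if "0 \<le> u" "u \<le> 1" for u p q
    using \<phi> that unfolding epi_dist_like_def atLeastAtMost_iff Ball_def by blast+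
  have up: "\<phi> (t, b + s) \<le> \<phi> (t, b)" if "s \<ge> 0" for t b s
    using \<phi> that unfolding epi_dist_like_def by auto
  have low: "- b \<le> \<phi> (t, b)" for t b
    using \<phi> unfolding epi_dist_like_def by blast
  have zero: "?f t \<le> ereal b \<longleftrightarrow> \<phi> (t, b) = 0" for t b
  proof
    assume "\<phi> (t, b) = 0"
    then show "?f t \<le> ereal b" unfolding fun_of_dist_def by (intro INF_lower) auto
  next
    assume le: "?f t \<le> ereal b"
    have "\<phi> (t, b) \<le> e" if e: "e > 0" for e
    proof -
      have "?f t < ereal (b + e)" using le e by (auto intro: le_less_trans)
      then obtain b' where b': "\<phi> (t, b') = 0" "b' < b + e"
        unfolding fun_of_dist_def INF_less_iff by auto
      have "\<phi> (t, b + e) = 0" using up[of "b + e - b'" t b'] b' nonneg[of "(t, b + e)"] by simp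
      then show ?thesis using lip[of "(t, b)" "(t, b + e)"] e by (simp add: box_dist_def)
    qed
    then show "\<phi> (t, b) = 0" using nonneg[of "(t, b)"] by (meson dense_ge order_antisym)
  qed
  have pos: "0 \<le> ?f t" for t
    unfolding fun_of_dist_def
  proof (intro INF_greatest)
    fix b assume "b \<in> {b. \<phi> (t, b) = 0}"
    then show "0 \<le> ereal b" using low[of b t] by simp
  qed
  show f0: "?f 0 \<le> 1" using zero[of 0 1] anchor[of 0] by (simp add: one_ereal_def)
  have "lsc_fun ?f"
    unfolding lsc_fun_def le_Liminf_iff
  proof (intro allI impI)
    fix x y assume "y < ?f x"
    then obtain c where c: "y < ereal c" "ereal c < ?f x" using ereal_dense2 by blast
    then have "\<phi> (x, c) > 0" using zero[of x c] nonneg[of "(x, c)"] by (auto simp: less_le)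
    then have "eventually (\<lambda>z. dist z x < \<phi> (x, c)) (at x)"
      by (auto simp: eventually_at)
    then show "eventually (\<lambda>z. y < ?f z) (at x)"
    proof eventually_elim
      case (elim z)
      have "\<phi> (z, c) \<noteq> 0" using lip[of "(x, c)" "(z, c)"] elim
        by (auto simp: box_dist_def dist_real_def abs_minus_commute)
      then have "ereal c < ?f z" using zero[of z c] by auto
      then show ?case using c by (auto intro: less_trans)
    qed
  qed
  moreover have "convex_efun ?f"
    unfolding convex_efun_def
  proof (intro allI impI)
    fix x y t :: real assume t: "0 \<le> t \<and> t \<le> 1"
    show "?f (t * x + (1 - t) * y) \<le> ereal t * ?f x + ereal (1 - t) * ?f y"
    proof (cases "t = 0 \<or> t = 1")
      case True
      then show ?thesis by (auto simp flip: zero_ereal_def one_ereal_def)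
    next
      case t01: False
      show ?thesis
      proof (cases "?f x = \<infinity> \<or> ?f y = \<infinity>")
        case True
        then show ?thesis using t t01 pos[of x] pos[of y] by auto
      next
        case False
        then obtain a b where ab: "?f x = ereal a" "?f y = ereal b"
          using pos[of x] pos[of y] by (cases "?f x"; cases "?f y") auto
        then have "\<phi> (x, a) = 0" "\<phi> (y, b) = 0" using zero[of x a] zero[of y b] by auto
        then have "\<phi> (t *\<^sub>R (x, a) + (1 - t) *\<^sub>R (y, b)) = 0"
          using quasi[of t "(x, a)" "(y, b)"] t nonneg by (metis max.idem order_antisym)
        then show ?thesis using zero[of "t * x + (1 - t) * y"] ab by simp
      qed
    qed
  qed
  ultimately show f: "?f \<in> XMp" using pos f0 by (auto simp: XMp_def intro: le_less_trans)
  show "epi_dist ?f = \<phi>"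
  proof
    fix p
    obtain q where q: "\<phi> q = 0" "box_dist p q \<le> \<phi> p" using epi_dist_like_zero_near[OF \<phi>] by blast
    have *: "q \<in> epi ?f \<longleftrightarrow> \<phi> q = 0" for q using zero by (cases q) (auto simp: epi_def)
    show "epi_dist ?f p = \<phi> p" unfolding epi_dist_def box_setdist_def
    proof (rule antisym)
      show "(INF q\<in>epi ?f. box_dist p q) \<le> \<phi> p"
        using q * by (intro cINF_lower2[where x = q]) (auto intro: epi_dist_bdd)
      show "\<phi> p \<le> (INF q\<in>epi ?f. box_dist p q)"
      proof (rule cINF_greatest)
        show "epi ?f \<noteq> {}" using q(1) *[of q] by blast
        fix r assume "r \<in> epi ?f"
        then show "\<phi> p \<le> box_dist p r" using * lip[of p r] by simp
      qed
    qed
  qed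
qed

text \<open>Each value lies between 0 and the distance to the anchor (0, 1), so Tychonoff applies
  once the conditions are known to be closed.\<close>

lemma compact_epi_dist_like:
  assumes N: "\<And>r e. 0 < e \<Longrightarrow> finite (N r e)"
  shows "compact {\<phi>. epi_dist_like N \<phi>}"
proof -
  have [continuous_intros]: "continuous_on UNIV (\<lambda>\<phi> :: real \<times> real \<Rightarrow> real. \<phi> p)" for p
    by (rule continuous_on_product_coordinates)
  \<comment> \<open>Finiteness of the net turns the existential quantifier into a finite union of
    closed sets.\<close>
  have fin: "closed {\<phi>. \<exists>q\<in>N r e. box_dist p q \<le> \<phi> p + 2 * e \<and> \<phi> q \<le> e}" if "e \<in> {0<..1}" for r e p
  proof -
    have "{\<phi>. \<exists>q\<in>N r e. box_dist p q \<le> \<phi> p + 2 * e \<and> \<phi> q \<le> e} =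
        (\<Union>q\<in>N r e. {\<phi>. box_dist p q \<le> \<phi> p + 2 * e \<and> \<phi> q \<le> e})" by auto
    also have "closed \<dots>"
      using that N by (intro closed_UN ballI closed_Collect_conj closed_Collect_le continuous_intros) auto
    finally show ?thesis .
  qed
  have ball: "closed {\<phi>. \<forall>u\<in>A. Q u \<phi>}" if "\<And>u. u \<in> A \<Longrightarrow> closed {\<phi> :: real \<times> real \<Rightarrow> real. Q u \<phi>}"
    for A :: "real set" and Q
  proof -
    have "{\<phi>. \<forall>u\<in>A. Q u \<phi>} = (\<Inter>u\<in>A. {\<phi>. Q u \<phi>})" by auto
    then show ?thesis using that by auto
  qed
  have clos: "closed {\<phi>. epi_dist_like N \<phi>}"
    unfolding epi_dist_like_def
    by (intro closed_Collect_conj closed_Collect_all ball fin closed_Collect_le closed_Collect_eq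
        continuous_intros)
  have "compactin (product_topology (\<lambda>_. euclidean) UNIV)
      (PiE UNIV (\<lambda>p. {0..box_dist p (0, 1)}))"
    by (subst compactin_PiE) auto
  then have "compact (PiE UNIV (\<lambda>p. {0..box_dist p (0, 1)}))"
    by (simp add: euclidean_product_topology)
  moreover have "{\<phi>. epi_dist_like N \<phi>} \<subseteq> PiE UNIV (\<lambda>p. {0..box_dist p (0, 1)})"
  proof
    fix \<phi> assume "\<phi> \<in> {\<phi>. epi_dist_like N \<phi>}"
    then have "0 \<le> \<phi> p" "\<bar>\<phi> p - \<phi> (0, 1)\<bar> \<le> box_dist p (0, 1)" "\<phi> (0, 1) = 0" for p
      unfolding epi_dist_like_def by blast+
    then show "\<phi> \<in> PiE UNIV (\<lambda>p. {0..box_dist p (0, 1)})" by auto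
  qed
  ultimately show ?thesis using compact_Int_closed[OF _ clos] by (metis inf.absorb2)
qed

text \<open>The set is the image of a compact set of distance functions under
  \<open>fun_of_dist\<close>, which is continuous because a neighbourhood in \<open>AW\<close> is
  secured by controlling finitely many distances.\<close>

theorem compactin_AW_le_one: "compactin AW {f \<in> XMp. f 0 \<le> 1}"
proof -
  have "\<forall>(r::real) (e::real). \<exists>A. 0 < e \<longrightarrow> finite A \<and> (\<forall>p \<in> box_ball r. \<exists>q\<in>A. box_dist p q < e)"
    using box_ball_finite_net by metis
  then obtain N :: "real \<Rightarrow> real \<Rightarrow> (real \<times> real) set" where N: "\<And>r e. 0 < e \<Longrightarrow> finite (N r e)"
    "\<And>r e p. 0 < e \<Longrightarrow> p \<in> box_ball r \<Longrightarrow> \<exists>q\<in>N r e. box_dist p q < e"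
    by metis
  let ?Z = "{\<phi>. epi_dist_like N \<phi>}"
  have "continuous_map (subtopology euclidean ?Z) AW fun_of_dist"
    unfolding continuous_map_def
  proof (intro conjI allI impI)
    show "fun_of_dist \<in> topspace (subtopology euclidean ?Z) \<rightarrow> topspace AW"
      using epi_dist_like_fun_of_dist(1) by auto
    fix U assume U: "openin AW U"
    show "openin (subtopology euclidean ?Z) {\<phi> \<in> topspace (subtopology euclidean ?Z). fun_of_dist \<phi> \<in> U}"
    proof (subst openin_subopen, intro ballI)
      fix \<phi> assume \<phi>: "\<phi> \<in> {\<phi> \<in> topspace (subtopology euclidean ?Z). fun_of_dist \<phi> \<in> U}"
      then have Z: "epi_dist_like N \<phi>" "fun_of_dist \<phi> \<in> U" by auto
      obtain A e where A: "finite A" "e > 0"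
        "{g \<in> XMp. \<forall>p\<in>A. \<bar>epi_dist g p - epi_dist (fun_of_dist \<phi>) p\<bar> < e} \<subseteq> U"
        using openin_AW_finite_nbhd[OF U Z(2)] by blast
      let ?T = "{\<psi>. \<forall>p\<in>A. \<bar>\<psi> p - \<phi> p\<bar> < e}"
      have "?T = (\<Inter>p\<in>A. {\<psi>. \<bar>\<psi> p - \<phi> p\<bar> < e})" by auto
      also have "open \<dots>"
        using A(1) by (intro open_INT ballI open_Collect_less continuous_intros continuous_on_product_coordinates) auto
      finally have "openin (subtopology euclidean ?Z) (?Z \<inter> ?T)" by (simp add: openin_open_Int)
      moreover have "\<phi> \<in> ?Z \<inter> ?T" using Z A by auto
      moreover have "?Z \<inter> ?T \<subseteq> {\<phi> \<in> topspace (subtopology euclidean ?Z). fun_of_dist \<phi> \<in> U}"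
      proof
        fix \<psi> assume \<psi>: "\<psi> \<in> ?Z \<inter> ?T"
        then have "fun_of_dist \<psi> \<in> {g \<in> XMp. \<forall>p\<in>A. \<bar>epi_dist g p - epi_dist (fun_of_dist \<phi>) p\<bar> < e}"
          using epi_dist_like_fun_of_dist[of N \<psi>] epi_dist_like_fun_of_dist[of N \<phi>] Z by auto
        then show "\<psi> \<in> {\<phi> \<in> topspace (subtopology euclidean ?Z). fun_of_dist \<phi> \<in> U}" using A \<psi> by auto
      qed
      ultimately show "\<exists>T. openin (subtopology euclidean ?Z) T \<and> \<phi> \<in> T \<and>
          T \<subseteq> {\<phi> \<in> topspace (subtopology euclidean ?Z). fun_of_dist \<phi> \<in> U}" by blast
    qed
  qed
  moreover have "compactin (subtopology euclidean ?Z) ?Z"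
    using compact_epi_dist_like[OF N(1)] by (simp add: compactin_subtopology)
  ultimately have "compactin AW (fun_of_dist ` ?Z)" using image_compactin by blast
  also have "fun_of_dist ` ?Z = {f \<in> XMp. f 0 \<le> 1}"
  proof (intro equalityI subsetI)
    fix f assume "f \<in> {f \<in> XMp. f 0 \<le> 1}"
    then show "f \<in> fun_of_dist ` ?Z"
      using epi_dist_like_epi_dist[where f = f, OF N(2)] fun_of_dist_epi_dist[of f]
      by (intro image_eqI[of _ _ "epi_dist f"]) auto
  qed (use epi_dist_like_fun_of_dist in auto)
  finally show ?thesis .
qed

lemma closedin_AW_le_one: "closedin AW {f \<in> XMp. f 0 \<le> 1}"
proof -
  have "closedin AW {f \<in> topspace AW. epi_dist f (0, 1) \<in> {0}}"
    by (rule closedin_continuous_map_preimage[OF continuous_map_epi_dist]) simp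
  also have "{f \<in> topspace AW. epi_dist f (0, 1) \<in> {0}} = {f \<in> XMp. f 0 \<le> 1}"
    by (auto simp: epi_dist_eq_0_iff one_ereal_def)
  finally show ?thesis .
qed


section \<open>Moment generating functions as members of the function space\<close>

lemma enn2ereal_less_ereal: "enn2ereal x < ereal c \<longleftrightarrow> x < ennreal c"
proof (cases x)
  case (real r)
  then show ?thesis by (cases "0 \<le> c") (auto simp: ennreal_less_iff ennreal_neg)
qed (auto)

lemma ereal_less_enn2ereal: "ereal c < enn2ereal x \<longleftrightarrow> c < 0 \<or> ennreal c < x"
proof (cases x)
  case (real r)
  then show ?thesis by (cases "0 \<le> c") (auto simp: ennreal_less_iff ennreal_neg)
qed (auto)

lemma enn2ereal_le_ereal: "0 \<le> c \<Longrightarrow> enn2ereal x \<le> ereal c \<longleftrightarrow> x \<le> ennreal c"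
  using ereal_less_enn2ereal[of c x] by (auto simp flip: not_less)

lemma real_probD:
  assumes "real_prob \<nu>" shows "prob_space \<nu>" "sets \<nu> = sets borel" "space \<nu> = UNIV"
  using assms sets_eq_imp_space_eq[of \<nu> borel] by (auto simp: real_prob_def)

lemma mgf_zero: "real_prob \<nu> \<Longrightarrow> mgf \<nu> 0 = 1"
  using prob_space.emeasure_space_1[of \<nu>] by (simp add: mgf_def real_prob_def one_ennreal.rep_eq)

lemma mgf_pos:
  assumes "real_prob \<nu>" shows "0 < mgf \<nu> t"
proof -
  interpret prob_space \<nu> using real_probD(1)[OF assms] .
  have [measurable_cong]: "sets \<nu> = sets borel" using real_probD(2)[OF assms] .
  have "(\<integral>\<^sup>+ x. ennreal (exp (t * x)) \<partial>\<nu>) \<noteq> 0"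
    by (subst nn_integral_0_iff_AE) (auto simp: not_less[symmetric])
  then have "0 < (\<integral>\<^sup>+ x. ennreal (exp (t * x)) \<partial>\<nu>)" by (simp add: zero_less_iff_neq_zero)
  then show ?thesis unfolding mgf_def by (metis less_ennreal.rep_eq zero_ennreal.rep_eq)
qed

text \<open>The truncated law is not normalised, so the values increase with \<open>m\<close> to the
  full transform.\<close>

definition trunc_mgf :: "nat \<Rightarrow> real measure \<Rightarrow> real \<Rightarrow> ennreal" where
  "trunc_mgf m \<nu> t = (\<integral>\<^sup>+ x. ennreal (exp (t * x)) * indicator {- real m..real m} x \<partial>\<nu>)"

lemma trunc_mgf_le:
  assumes "sets \<nu> = sets borel"
  shows "enn2ereal (trunc_mgf m \<nu> t) \<le> mgf \<nu> t"
  unfolding mgf_def trunc_mgf_def less_eq_ennreal.rep_eq[symmetric]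
  by (intro nn_integral_mono) (auto split: split_indicator)

lemma trunc_mgf_mono: "m \<le> n \<Longrightarrow> trunc_mgf m \<nu> t \<le> trunc_mgf n \<nu> t"
  unfolding trunc_mgf_def by (intro nn_integral_mono) (auto split: split_indicator)

lemma mgf_eq_SUP_trunc:
  assumes [measurable_cong]: "sets \<nu> = sets borel"
  shows "(\<integral>\<^sup>+ x. ennreal (exp (t * x)) \<partial>\<nu>) = (SUP m. trunc_mgf m \<nu> t)"
  unfolding trunc_mgf_def
proof (subst nn_integral_monotone_convergence_SUP[symmetric])
  show "incseq (\<lambda>m x. ennreal (exp (t * x)) * indicator {- real m..real m} x)"
    by (auto simp: incseq_def le_fun_def split: split_indicator)
  have "(SUP m. ennreal (exp (t * x)) * indicator {- real m..real m} x) = ennreal (exp (t * x))" for x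
  proof (rule antisym)
    obtain m where "\<bar>x\<bar> \<le> real m" using real_arch_simple by blast
    then have "ennreal (exp (t * x)) = ennreal (exp (t * x)) * indicator {- real m..real m} x"
      by (auto simp: abs_le_iff)
    also have "\<dots> \<le> (SUP m. ennreal (exp (t * x)) * indicator {- real m..real m} x)"
      by (rule SUP_upper) simp
    finally show "ennreal (exp (t * x)) \<le> (SUP m. ennreal (exp (t * x)) * indicator {- real m..real m} x)" .
  qed (auto intro!: SUP_least split: split_indicator)
  then show "(\<integral>\<^sup>+ x. ennreal (exp (t * x)) \<partial>\<nu>)
      = (\<integral>\<^sup>+ x. (SUP m. ennreal (exp (t * x)) * indicator {- real m..real m} x) \<partial>\<nu>)" by simp
qed measurable

text \<open>On [-m, m], replacing t by s with |s - t| < d costs at most the factor exp(-d m), so a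
  lower bound at t persists nearby and for all later truncations. This gives lower semicontinuity of
  \<open>mgf\<close> and the locally uniform bounds demanded by
  \<open>epi_dist_tendsto\<close>.\<close>

lemma trunc_mgf_eventually_greater:
  assumes \<nu>: "real_prob \<nu>" and c: "ereal c < mgf \<nu> t"
  obtains m d where "d > 0" "\<And>s n. \<bar>s - t\<bar> < d \<Longrightarrow> m \<le> n \<Longrightarrow> ereal c < enn2ereal (trunc_mgf n \<nu> s)"
proof (cases "c < 0")
  case True
  then show ?thesis by (intro that[of 1 0]) (auto simp: ereal_less_enn2ereal)
next
  case False
  note \<nu> = real_probD[OF \<nu>]
  interpret prob_space \<nu> using \<nu>(1) .
  have [measurable_cong]: "sets \<nu> = sets borel" using \<nu>(2) .
  have "ennreal c < (SUP m. trunc_mgf m \<nu> t)"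
    using c False unfolding mgf_def ereal_less_enn2ereal mgf_eq_SUP_trunc[OF \<nu>(2)] by auto
  then obtain m where m: "ennreal c < trunc_mgf m \<nu> t" unfolding less_SUP_iff by auto
  obtain a where a: "ennreal c < a" "a < trunc_mgf m \<nu> t" using dense[OF m] by blast
  then obtain a' where a': "a = ennreal a'" "0 \<le> a'" by (cases a) auto
  have ca: "c < a'" "0 < a'" using a(1) a' False by (auto simp: ennreal_less_iff)
  have "((\<lambda>d. exp (- d * real m) * a') \<longlongrightarrow> exp (- 0 * real m) * a') (at_right 0)"
    by (intro tendsto_intros)
  then have "eventually (\<lambda>d. c < exp (- d * real m) * a') (at_right 0)"
    using ca by (intro order_tendstoD(1)) auto
  moreover have "eventually (\<lambda>d::real. d > 0) (at_right 0)" by (simp add: eventually_at_filter)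
  ultimately have "eventually (\<lambda>d. c < exp (- d * real m) * a' \<and> d > 0) (at_right 0)"
    by eventually_elim auto
  then obtain d where d: "c < exp (- d * real m) * a'" "d > 0"
    using eventually_happens'[of "at_right (0::real)"] by (auto simp: trivial_limit_at_right_real)
  have "ereal c < enn2ereal (trunc_mgf n \<nu> s)" if s: "\<bar>s - t\<bar> < d" and n: "m \<le> n" for s n
  proof -
    have "ennreal c < ennreal (exp (- d * real m) * a')" using d ca False by (simp add: ennreal_less_iff)
    also have "\<dots> = ennreal (exp (- d * real m)) * ennreal a'" using a' by (simp add: ennreal_mult)
    also have "\<dots> \<le> ennreal (exp (- d * real m)) * trunc_mgf m \<nu> t"
      using a a' by (intro mult_left_mono) auto
    also have "\<dots> = (\<integral>\<^sup>+ x. ennreal (exp (- d * real m)) *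
        (ennreal (exp (t * x)) * indicator {- real m..real m} x) \<partial>\<nu>)"
      unfolding trunc_mgf_def by (rule nn_integral_cmult[symmetric]) measurable
    also have "\<dots> \<le> trunc_mgf m \<nu> s"
      unfolding trunc_mgf_def
    proof (intro nn_integral_mono)
      fix x
      have "exp (- d * real m) * exp (t * x) \<le> exp (s * x)" if "\<bar>x\<bar> \<le> real m"
      proof -
        have "\<bar>t - s\<bar> * \<bar>x\<bar> \<le> d * real m" using s that d by (intro mult_mono) auto
        then have "(t - s) * x \<le> d * real m" by (metis abs_le_D1 abs_mult)
        then show ?thesis by (simp add: exp_add[symmetric] algebra_simps)
      qed
      then show "ennreal (exp (- d * real m)) * (ennreal (exp (t * x)) * indicator {- real m..real m} x)
          \<le> ennreal (exp (s * x)) * indicator {- real m..real m} x"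
        by (auto simp: abs_le_iff ennreal_mult[symmetric] split: split_indicator)
    qed
    also have "\<dots> \<le> trunc_mgf n \<nu> s" by (rule trunc_mgf_mono[OF n])
    finally show ?thesis by (simp add: ereal_less_enn2ereal)
  qed
  then show ?thesis using that d by blast
qed

lemma mgf_in_XMp:
  assumes \<nu>: "real_prob \<nu>" shows "mgf \<nu> \<in> XMp"
proof -
  have [measurable_cong]: "sets \<nu> = sets borel" using real_probD(2)[OF \<nu>] .
  have "lsc_fun (mgf \<nu>)"
    unfolding lsc_fun_def le_Liminf_iff
  proof (intro allI impI)
    fix t y assume "y < mgf \<nu> t"
    then obtain c where c: "y < ereal c" "ereal c < mgf \<nu> t" using ereal_dense2 by blast
    obtain m d where d: "d > 0" "\<And>s n. \<bar>s - t\<bar> < d \<Longrightarrow> m \<le> n \<Longrightarrow> ereal c < enn2ereal (trunc_mgf n \<nu> s)"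
      using trunc_mgf_eventually_greater[OF \<nu> c(2)] by metis
    then have "eventually (\<lambda>s. dist s t < d) (at t)" by (auto simp: eventually_at)
    then show "eventually (\<lambda>s. y < mgf \<nu> s) (at t)"
    proof eventually_elim
      case (elim s)
      note c(1)
      also have "ereal c < enn2ereal (trunc_mgf m \<nu> s)" using d(2)[of s m] elim by (simp add: dist_real_def)
      also have "\<dots> \<le> mgf \<nu> s" by (rule trunc_mgf_le[OF real_probD(2)[OF \<nu>]])
      finally show ?case .
    qed
  qed
  moreover have "convex_efun (mgf \<nu>)"
    unfolding convex_efun_def
  proof (intro allI impI)
    fix x y t :: real assume t: "0 \<le> t \<and> t \<le> 1"
    have "(\<integral>\<^sup>+ z. ennreal (exp ((t * x + (1 - t) * y) * z)) \<partial>\<nu>) \<le>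
        (\<integral>\<^sup>+ z. ennreal t * ennreal (exp (x * z)) + ennreal (1 - t) * ennreal (exp (y * z)) \<partial>\<nu>)"
    proof (intro nn_integral_mono)
      fix z
      have "exp (t *\<^sub>R (x * z) + (1 - t) *\<^sub>R (y * z)) \<le> t * exp (x * z) + (1 - t) * exp (y * z)"
        using convex_onD[OF exp_convex, of "1 - t" "x * z" "y * z"] t by simp
      then show "ennreal (exp ((t * x + (1 - t) * y) * z)) \<le>
          ennreal t * ennreal (exp (x * z)) + ennreal (1 - t) * ennreal (exp (y * z))"
        using t by (auto simp: ennreal_mult[symmetric] ennreal_plus[symmetric] algebra_simps
            simp del: ennreal_plus intro!: ennreal_leI)
    qed
    also have "\<dots> = ennreal t * (\<integral>\<^sup>+ z. ennreal (exp (x * z)) \<partial>\<nu>) + ennreal (1 - t) * (\<integral>\<^sup>+ z. ennreal (exp (y * z)) \<partial>\<nu>)"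
      by (subst nn_integral_add) (auto simp: nn_integral_cmult)
    finally show "mgf \<nu> (t * x + (1 - t) * y) \<le> ereal t * mgf \<nu> x + ereal (1 - t) * mgf \<nu> y"
      using t unfolding mgf_def less_eq_ennreal.rep_eq by (simp add: plus_ennreal.rep_eq times_ennreal.rep_eq)
  qed
  ultimately show ?thesis using mgf_zero[OF \<nu>] mgf_pos[OF \<nu>] by (auto simp: XMp_def less_imp_le one_ereal_def)
qed

lemma mgf_in_XM: "real_prob \<nu> \<Longrightarrow> mgf \<nu> \<in> XM"
  using mgf_in_XMp mgf_pos by (auto simp: XM_def)

lemma XM_subset_XMp: "XM \<subseteq> XMp" and XB_subset_XM: "XB \<subseteq> XM"
  using mgf_in_XM by (auto simp: XM_def XB_def)

lemma XM_zero: "f \<in> XM \<Longrightarrow> f 0 = 1"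
  using mgf_zero by (auto simp: XM_def XMp_def)

lemma topspace_AW_M [simp]: "topspace AW_M = XM"
  using XM_subset_XMp by (auto simp: AW_M_def)

lemma openin_AW_M_Int: "openin AW U \<Longrightarrow> openin AW_M (U \<inter> XM)"
  by (auto simp: AW_M_def openin_subtopology)

subsection \<open>Convergence in the Attouch--Wets topology\<close>

lemma limitin_AW_I:
  assumes f: "f \<in> XMp" and g: "eventually (\<lambda>k. g k \<in> XMp) F"
    and lim: "\<And>p. ((\<lambda>k. epi_dist (g k) p) \<longlongrightarrow> epi_dist f p) F"
  shows "limitin AW g f F"
  unfolding limitin_def
proof (intro conjI allI impI)
  fix U assume "openin AW U \<and> f \<in> U"
  then obtain A e where A: "finite A" "e > 0" "{g \<in> XMp. \<forall>p\<in>A. \<bar>epi_dist g p - epi_dist f p\<bar> < e} \<subseteq> U"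
    using openin_AW_finite_nbhd by blast
  have "eventually (\<lambda>k. \<forall>p\<in>A. \<bar>epi_dist (g k) p - epi_dist f p\<bar> < e) F"
    using A lim by (intro eventually_ball_finite) (auto simp: tendsto_iff dist_real_def)
  with g show "eventually (\<lambda>k. g k \<in> U) F"
    by eventually_elim (use A(3) in auto)
qed (use f in simp)

text \<open>A net of mesh 1 / (k + 1) in the ball of radius k selects the k-th member, so closure
  points are reached by sequences, the form in which Helly's theorem is applied.\<close>

lemma AW_closure_limit:
  assumes "f \<in> AW closure_of S" "S \<subseteq> XMp"
  obtains g :: "nat \<Rightarrow> real \<Rightarrow> ereal" where "\<And>k. g k \<in> S" "limitin AW g f sequentially"
proof -
  have f: "f \<in> XMp" using assms(1) by (simp add: in_closure_of)
  have "\<exists>g\<in>S. \<forall>p\<in>box_ball (real k). \<bar>epi_dist g p - epi_dist f p\<bar> < 3 / real (Suc k)" for k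
  proof -
    have e: "0 < 1 / real (Suc k)" by simp
    obtain A where A: "finite A" "\<And>p. p \<in> box_ball (real k) \<Longrightarrow> \<exists>q\<in>A. box_dist p q < 1 / real (Suc k)"
      using box_ball_finite_net[OF e, of "real k"] by metis
    let ?T = "{g \<in> XMp. \<forall>p\<in>A. \<bar>epi_dist g p - epi_dist f p\<bar> < 1 / real (Suc k)}"
    have "openin AW ?T" by (rule openin_AW_ball[OF A(1)])
    moreover have "f \<in> ?T" using f by simp
    ultimately obtain g where "g \<in> S" "g \<in> ?T" using assms(1) unfolding in_closure_of by meson
    then have g: "g \<in> S" "\<And>p. p \<in> A \<Longrightarrow> \<bar>epi_dist g p - epi_dist f p\<bar> < 1 / real (Suc k)"
      by simp_all
    have "\<bar>epi_dist g p - epi_dist f p\<bar> < 3 / real (Suc k)" if p: "p \<in> box_ball (real k)" for p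
    proof -
      obtain q where q: "q \<in> A" "box_dist p q < 1 / real (Suc k)" using A(2)[OF p] by auto
      have "\<bar>epi_dist g p - epi_dist g q\<bar> \<le> box_dist p q" "\<bar>epi_dist f p - epi_dist f q\<bar> \<le> box_dist p q"
        using g(1) f assms(2) by (auto intro!: epi_dist_lipschitz simp: XMp_zero_finite[simplified] subset_iff)
      then have "\<bar>epi_dist g p - epi_dist f p\<bar> < 3 * (1 / real (Suc k))"
        using g(2)[OF q(1)] q(2) by linarith
      then show ?thesis by simp
    qed
    then show ?thesis using g(1) by blast
  qed
  then obtain g where g: "\<And>k. g k \<in> S"
    "\<And>k p. p \<in> box_ball (real k) \<Longrightarrow> \<bar>epi_dist (g k) p - epi_dist f p\<bar> < 3 / real (Suc k)"
    by metis
  have "limitin AW g f sequentially"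
  proof (rule limitin_AW_I[OF f])
    show "eventually (\<lambda>k. g k \<in> XMp) sequentially" using g(1) assms(2) by (auto intro!: always_eventually)
    fix p
    have "((\<lambda>k. epi_dist (g k) p - epi_dist f p) \<longlongrightarrow> 0) sequentially"
    proof (rule Lim_null_comparison)
      show "eventually (\<lambda>k. norm (epi_dist (g k) p - epi_dist f p) \<le> 3 / real (Suc k)) sequentially"
        using eventually_ge_at_top[of "nat \<lceil>box_dist (0,0) p\<rceil>"]
        by eventually_elim (use g(2) in \<open>auto simp: box_ball_def less_imp_le nat_ceiling_le_eq\<close>)
      show "(\<lambda>k. 3 / real (Suc k)) \<longlonglongrightarrow> 0"
        using tendsto_mult[OF tendsto_const[of 3] LIMSEQ_inverse_real_of_nat] by (simp add: field_simps)
    qed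
    then show "((\<lambda>k. epi_dist (g k) p) \<longlongrightarrow> epi_dist f p) sequentially" by (simp add: LIM_zero_iff)
  qed
  then show ?thesis using that g by blast
qed

text \<open>Lying below the epigraph means positive distance to it, hence is open. The reverse
  inequality at a point is not open in general.\<close>

lemma openin_AW_greater: "openin AW {g \<in> XMp. ereal c < g t}"
proof -
  have "{g \<in> XMp. ereal c < g t} = {g \<in> XMp. 0 < epi_dist g (t, c)}"
    using epi_dist_eq_0_iff epi_dist_nonneg XMp_zero_finite by (force simp: less_le)
  then show ?thesis using openin_AW_epi_dist_greater by simp
qed

text \<open>A small distance yields the bound only at some point near the centre of the box. With
  such points on both sides of \<open>t\<close>, convexity gives the bound at \<open>t\<close>
  itself.\<close>

lemma AW_nbhd_less_between:
  assumes f: "f \<in> XMp" and less: "f x < ereal c" "f y < ereal c"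
    and t: "x < t \<and> t < y \<or> y < t \<and> t < x"
  obtains U where "openin AW U" "f \<in> U" "\<And>g. g \<in> U \<Longrightarrow> g t < ereal c"
proof -
  have *: "\<exists>U. openin AW U \<and> f \<in> U \<and> (\<forall>g\<in>U. g t < ereal c)"
    if "f x < ereal c" "f y < ereal c" "x < t" "t < y" for x y
  proof -
    define r where "r = min (t - x) (y - t)"
    have r: "r > 0" using that by (simp add: r_def)
    \<comment> \<open>The centre is lowered by \<open>r\<close> so that the top edge of the box is
      at height \<open>c\<close>.\<close>
    let ?U = "\<lambda>x. {g \<in> XMp. epi_dist g (x, c - r) < r}"
    have U: "g \<in> ?U x \<longleftrightarrow> g \<in> XMp \<and> (\<exists>s. \<bar>s - x\<bar> < r \<and> g s < ereal c)" for g x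
      using epi_dist_less_iff[of g "(x, c - r)" r] XMp_zero_finite[of g] by auto
    have "f \<in> ?U x \<inter> ?U y" unfolding Int_iff U
      by (intro conjI f exI[of _ x] exI[of _ y]) (use that r in auto)
    moreover have "g t < ereal c" if g: "g \<in> ?U x \<inter> ?U y" for g
    proof -
      obtain s u where "\<bar>s - x\<bar> < r" "g s < ereal c" "\<bar>u - y\<bar> < r" "g u < ereal c" "g \<in> XMp"
        using g unfolding Int_iff U by blast
      then show ?thesis by (intro XMp_between_less[of g s c u t]) (auto simp: r_def)
    qed
    ultimately show ?thesis using openin_AW_epi_dist_less by (intro exI[of _ "?U x \<inter> ?U y"]) blast
  qed
  from t have "\<exists>U. openin AW U \<and> f \<in> U \<and> (\<forall>g\<in>U. g t < ereal c)"
    using *[of x y] *[of y x] less by blast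
  then show ?thesis using that by blast
qed

text \<open>Points strictly between 0 and a point of the domain have room on both sides: radial
  continuity towards \<open>t\<close> and towards 0 supplies the two neighbours.\<close>

lemma AW_nbhd_less_radial:
  assumes f: "f \<in> XMp" and fin: "f t < \<infinity>" and "t \<noteq> 0" and s: "0 < s" "s < 1"
    and less: "f (s * t) < ereal c"
  obtains U where "openin AW U" "f \<in> U" "\<And>g. g \<in> U \<Longrightarrow> g (s * t) < ereal c"
proof -
  have "eventually (\<lambda>u. f ((1 - u) * (s * t) + u * t) < ereal c) (at_right 0)"
    "eventually (\<lambda>u. f ((1 - u) * (s * t) + u * 0) < ereal c) (at_right 0)"
    using order_tendstoD(2)[OF XMp_tendsto_at_right[OF f fin] less]
      order_tendstoD(2)[OF XMp_tendsto_at_right[OF f XMp_zero_finite[OF f]] less] .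
  moreover have "eventually (\<lambda>u::real. u \<in> {0<..<1}) (at_right 0)"
    by (rule eventually_at_right_real) simp
  ultimately have "eventually (\<lambda>u. f ((1 - u) * (s * t) + u * t) < ereal c \<and>
      f ((1 - u) * (s * t) + u * 0) < ereal c \<and> u \<in> {0<..<1}) (at_right 0)"
    by eventually_elim auto
  then obtain u where u: "f ((1 - u) * (s * t) + u * t) < ereal c"
      "f ((1 - u) * (s * t) + u * 0) < ereal c" "0 < u"
    using eventually_happens'[of "at_right (0::real)"] by (auto simp: trivial_limit_at_right_real)
  have 1: "(1 - u) * (s * t) + u * t - s * t = u * (1 - s) * t"
    and 2: "s * t - ((1 - u) * (s * t) + u * 0) = u * s * t" by (simp_all add: algebra_simps)
  have sgn: "0 < t \<Longrightarrow> 0 < u * (1 - s) * t \<and> 0 < u * s * t"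
    "t < 0 \<Longrightarrow> u * (1 - s) * t < 0 \<and> u * s * t < 0"
    using u s by (auto simp: mult_less_0_iff)
  have "(1 - u) * (s * t) + u * 0 < s * t \<and> s * t < (1 - u) * (s * t) + u * t \<or>
     (1 - u) * (s * t) + u * t < s * t \<and> s * t < (1 - u) * (s * t) + u * 0"
    using \<open>t \<noteq> 0\<close>
  proof (cases "t < 0")
    case True
    then show ?thesis using sgn(2) unfolding 1[symmetric] 2[symmetric] by simp
  next
    case False
    then show ?thesis using sgn(1) \<open>t \<noteq> 0\<close> unfolding 1[symmetric] 2[symmetric] by simp
  qed
  then show ?thesis using AW_nbhd_less_between[OF f u(2,1)] that by blast
qed


subsection \<open>Limits of moment generating functions\<close>

text \<open>By Young's inequality \<open>e\<^bsup>su\<^esup> \<le> (1 - s) + s e\<^bsup>u\<^esup>\<close>, so mass of \<open>\<nu>\<close> far out on the side where \<open>e\<^bsup>tx\<^esup>\<close> is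
  small pushes \<open>mgf \<nu> (s t)\<close> below \<open>1\<close>.\<close>

lemma mgf_lower_tail:
  assumes \<nu>: "real_prob \<nu>" and s: "0 < s" "s < 1" and C: "mgf \<nu> t < ereal C"
    and c: "ereal c < mgf \<nu> (s * t)" and R: "exp (- (s * R)) \<le> 1 / 2"
  shows "measure \<nu> {x. t * x < - R} \<le> 2 * (1 + s * C - c)"
proof -
  interpret prob_space \<nu> using real_probD(1)[OF \<nu>] .
  have [measurable_cong]: "sets \<nu> = sets borel" using real_probD(2)[OF \<nu>] .
  define A where "A = {x. t * x < - R}"
  have A[measurable]: "A \<in> sets borel" unfolding A_def by measurable
  let ?N = "\<lambda>t. \<integral>\<^sup>+ x. ennreal (exp (t * x)) \<partial>\<nu>"
  define h :: real where h: "h = 1 / 2"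
  \<comment> \<open>Off \<open>A\<close> Young's inequality is used. On \<open>A\<close> the
    exponential is at most 1/2, so the indicator on the left is paid for by 1 + \<open>h\<close>,
    and half the mass of \<open>A\<close> survives the cancellation.\<close>
  have "?N (s * t) + emeasure \<nu> A = (\<integral>\<^sup>+ x. ennreal (exp (s * t * x)) + indicator A x \<partial>\<nu>)"
    by (subst nn_integral_add) auto
  also have "\<dots> \<le> (\<integral>\<^sup>+ x. (1 + ennreal s * ennreal (exp (t * x))) + ennreal h * indicator A x \<partial>\<nu>)"
  proof (intro nn_integral_mono)
    fix x
    show "ennreal (exp (s * t * x)) + indicator A x
        \<le> 1 + ennreal s * ennreal (exp (t * x)) + ennreal h * indicator A x"
    proof (cases "x \<in> A")
      case True
      then have "s * (t * x) \<le> s * - R" using s unfolding A_def by (intro mult_left_mono) auto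
      then have "exp (s * t * x) \<le> exp (- (s * R))" by (simp add: mult.assoc)
      then have "exp (s * t * x) + 1 \<le> 1 + s * exp (t * x) + h"
        unfolding h using R s mult_nonneg_nonneg[of s "exp (t * x)"] exp_ge_zero[of "t * x"] by linarith
      then show ?thesis using True s h
        by (simp add: ennreal_mult[symmetric] ennreal_1[symmetric] ennreal_plus[symmetric] del: ennreal_plus ennreal_1)
    next
      case False
      have "exp (s * t * x) \<le> (1 - s) * exp 0 + s * exp (t * x)"
        using convex_onD[OF exp_convex, of s 0 "t * x"] s by (simp add: mult.assoc)
      then have "exp (s * t * x) \<le> 1 + s * exp (t * x)" using s by simp
      then show ?thesis using False s
        by (simp add: ennreal_mult[symmetric] ennreal_1[symmetric] ennreal_plus[symmetric] del: ennreal_plus ennreal_1)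
    qed
  qed
  also have "\<dots> = 1 + ennreal s * ?N t + ennreal h * emeasure \<nu> A"
    by (simp add: nn_integral_add nn_integral_cmult emeasure_space_1)
  finally have le: "?N (s * t) + emeasure \<nu> A \<le> 1 + ennreal s * ?N t + ennreal h * emeasure \<nu> A" .
  obtain a where a: "?N t = ennreal a" "0 \<le> a" "a < C"
    using C unfolding mgf_def enn2ereal_less_ereal by (cases "?N t") (auto simp: ennreal_less_iff)
  have fin: "1 + ennreal s * ?N t + ennreal h * emeasure \<nu> A = ennreal (1 + s * a + h * prob A)"
    using a s h by (simp add: emeasure_eq_measure ennreal_mult[symmetric] ennreal_1[symmetric]
        ennreal_plus[symmetric] del: ennreal_plus ennreal_1)
  have "?N (s * t) \<noteq> \<infinity>" using le unfolding fin by (auto simp: top_unique)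
  then obtain b where b: "?N (s * t) = ennreal b" "0 \<le> b" by (cases "?N (s * t)") auto
  then have "c < b" using c unfolding mgf_def by simp
  have "b + prob A \<le> 1 + s * a + h * prob A"
  proof -
    have "ennreal (b + prob A) = ?N (s * t) + emeasure \<nu> A"
      using b by (simp add: emeasure_eq_measure)
    also have "\<dots> \<le> ennreal (1 + s * a + h * prob A)" using le fin by simp
    finally have "ennreal (b + prob A) \<le> ennreal (1 + s * a + h * prob A)" .
    moreover have "0 \<le> 1 + s * a + h * prob A" using a s h by simp
    ultimately show ?thesis by (simp only: ennreal_le_iff)
  qed
  moreover have "s * a \<le> s * C" using a s by (intro mult_left_mono) auto
  ultimately show ?thesis using \<open>c < b\<close> unfolding A_def[symmetric] by (simp add: h)
qed

text \<open>Markov's inequality for exp(t x).\<close>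

lemma mgf_upper_tail:
  assumes \<nu>: "real_prob \<nu>" and C: "mgf \<nu> t < ereal C"
  shows "measure \<nu> {x. R < t * x} \<le> C * exp (- R)"
proof -
  interpret prob_space \<nu> using real_probD(1)[OF \<nu>] .
  have [measurable_cong]: "sets \<nu> = sets borel" using real_probD(2)[OF \<nu>] .
  let ?N = "\<integral>\<^sup>+ x. ennreal (exp (t * x)) \<partial>\<nu>"
  obtain a where a: "?N = ennreal a" "0 \<le> a" "a < C"
    using C unfolding mgf_def enn2ereal_less_ereal by (cases ?N) (auto simp: ennreal_less_iff)
  have "emeasure \<nu> {x. R < t * x} = (\<integral>\<^sup>+ x. indicator {x. R < t * x} x \<partial>\<nu>)" by simp
  also have "\<dots> \<le> (\<integral>\<^sup>+ x. ennreal (exp (- R)) * ennreal (exp (t * x)) \<partial>\<nu>)"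
    by (intro nn_integral_mono) (auto simp: ennreal_mult[symmetric] exp_add[symmetric] split: split_indicator)
  also have "\<dots> = ennreal (exp (- R) * a)"
    using a by (simp add: nn_integral_cmult ennreal_mult)
  finally have "prob {x. R < t * x} \<le> exp (- R) * a"
    using a by (simp add: emeasure_eq_measure ennreal_le_iff)
  also have "\<dots> \<le> exp (- R) * C" using a by (intro mult_left_mono) auto
  finally show ?thesis by (simp add: mult.commute)
qed

lemma real_prob_real_distribution: "real_prob \<nu> \<longleftrightarrow> real_distribution \<nu>"
  by (auto simp: real_prob_def real_distribution_def real_distribution_axioms_def)

lemma real_prob_tight:
  assumes "real_prob \<nu>" "e > 0"
  shows "eventually (\<lambda>R. measure \<nu> {x. R < \<bar>x\<bar>} < e) at_top"
proof -
  interpret real_distribution \<nu> using assms real_prob_real_distribution by blast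

  have "((\<lambda>R. cdf \<nu> R) \<longlongrightarrow> 1) at_top" by (rule cdf_lim_at_top_prob)
  then have 1: "eventually (\<lambda>R. 1 - e / 2 < cdf \<nu> R) at_top"
    using assms(2) by (auto dest!: order_tendstoD(1))
  have "((\<lambda>R. cdf \<nu> R) \<longlongrightarrow> 0) at_bot" by (rule cdf_lim_at_bot)
  then have "eventually (\<lambda>R. cdf \<nu> R < e / 2) at_bot"
    using assms(2) by (intro order_tendstoD(2)) auto
  then have 2: "eventually (\<lambda>R. cdf \<nu> (- R) < e / 2) at_top"
    by (simp add: at_bot_mirror eventually_filtermap)
  from 1 2 show ?thesis
  proof eventually_elim
    case (elim R)
    have "prob {x. R < \<bar>x\<bar>} \<le> prob ({..- R} \<union> (space \<nu> - {..R}))"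
      by (intro finite_measure_mono) auto
    also have "\<dots> \<le> prob {..- R} + prob (space \<nu> - {..R})"
      by (intro measure_Un_le) auto
    also have "\<dots> = cdf \<nu> (- R) + (1 - cdf \<nu> R)" by (subst prob_compl) (auto simp: cdf_def)
    finally show ?case using elim by simp
  qed
qed

text \<open>On the side where exp(t x) is large, Markov's inequality works. On the other side mass
  can only escape by pulling the transforms below 1 near 0, which \<open>f 0 = 1\<close> and lower
  semicontinuity of \<open>f\<close> exclude.\<close>

lemma AW_limit_mgf_tight:
  fixes \<nu> :: "nat \<Rightarrow> real measure"
  assumes \<nu>: "\<And>k. real_prob (\<nu> k)" and lim: "limitin AW (\<lambda>k. mgf (\<nu> k)) f sequentially"
    and f0: "f 0 = 1" and t: "t \<noteq> 0" "f t < \<infinity>"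
  shows "tight \<nu>"
proof -
  have f: "f \<in> XMp" using lim by (simp add: limitin_def)
  \<comment> \<open>Halving gives a point strictly between 0 and \<open>t\<close>, where upper
    bounds are stable under limits in \<open>AW\<close>.\<close>
  define t' where "t' = (1 / 2) * t"
  have "t' \<noteq> 0" using t by (simp add: t'_def)
  have "f t' \<le> ereal (1/2) * f t + ereal (1/2) * f 0"
    using XMp_convex[OF f, of "1/2" t 0] unfolding t'_def by simp
  also have "\<dots> < \<infinity>" using t(2) XMp_nonneg[OF f, of t] f0 by (cases "f t") (auto simp: one_ereal_def)
  finally obtain v where v: "f t' = ereal v" using XMp_nonneg[OF f, of t'] by (cases "f t'") auto
  then have v0: "0 \<le> v" using XMp_nonneg[OF f, of t'] by simp
  have "\<exists>R. \<forall>k. measure (\<nu> k) {x. R < \<bar>x\<bar>} < e" if e: "e > 0" for e :: real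
  proof -
    have "((\<lambda>s. f (s * t')) \<longlongrightarrow> 1) (at_right 0)"
      using XMp_tendsto_at_right[OF f, of t' 0] v f0 by simp
    then have 1: "eventually (\<lambda>s. ereal (1 - e / 16) < f (s * t')) (at_right 0)"
      using e by (intro order_tendstoD(1)) auto
    have "((\<lambda>s. s * (v + 1)) \<longlongrightarrow> 0 * (v + 1)) (at_right 0)" by (intro tendsto_intros)
    then have 2: "eventually (\<lambda>s. s * (v + 1) < e / 16) (at_right 0)"
      using e by (intro order_tendstoD(2)) auto
    have 3: "eventually (\<lambda>s::real. s \<in> {0<..<1}) (at_right 0)"
      by (rule eventually_at_right_real) simp
    from 1 2 3 have "eventually (\<lambda>s. ereal (1 - e / 16) < f (s * t') \<and> s * (v + 1) < e / 16 \<and> s \<in> {0<..<1}) (at_right 0)"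
      by eventually_elim auto
    then obtain s where s: "ereal (1 - e / 16) < f (s * t')" "s * (v + 1) < e / 16" "0 < s" "s < 1"
      using eventually_happens'[of "at_right (0::real)"] by (auto simp: trivial_limit_at_right_real)
    have "f ((1 / 2) * t) < ereal (v + 1)" using v by (simp add: t'_def)
    then obtain U where U: "openin AW U" "f \<in> U" "\<And>g. g \<in> U \<Longrightarrow> g t' < ereal (v + 1)"
      unfolding t'_def by (rule AW_nbhd_less_radial[OF f t(2,1), of "1/2", rotated 2]) auto
    have ev: "eventually (\<lambda>k. mgf (\<nu> k) t' < ereal (v + 1)) sequentially"
      using limitinD[OF lim U(1,2)] by eventually_elim (rule U(3))
    have ev': "eventually (\<lambda>k. mgf (\<nu> k) \<in> {g \<in> XMp. ereal (1 - e / 16) < g (s * t')}) sequentially"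
      using s f by (intro limitinD[OF lim openin_AW_greater]) auto
    \<comment> \<open>The first entry makes exp(- s R) at most 1/2, the second makes the Markov
      bound at most e/4.\<close>
    define R where "R = max (max (ln 2 / s) (ln (4 * (v + 1) / e))) 1"
    have R1: "exp (- (s * R)) \<le> 1 / 2"
    proof -
      have "ln 2 / s \<le> R" by (simp add: R_def)
      then have "ln 2 \<le> s * R" using s by (simp add: field_simps)
      then have "exp (- (s * R)) \<le> exp (- ln 2)" by simp
      then show ?thesis by (simp add: exp_minus)
    qed
    have R2: "(v + 1) * exp (- R) \<le> e / 4"
    proof -
      have "ln (4 * (v + 1) / e) \<le> R" by (auto simp: R_def le_max_iff_disj)
      then have "exp (ln (4 * (v + 1) / e)) \<le> exp R" by simp
      then have "4 * (v + 1) / e \<le> exp R" using v0 e by (subst (asm) exp_ln) auto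
      then show ?thesis using e by (simp add: exp_minus field_simps)
    qed
    from ev ev' have "eventually (\<lambda>k. measure (\<nu> k) {x. R / \<bar>t'\<bar> < \<bar>x\<bar>} < e) sequentially"
    proof eventually_elim
      case (elim k)
      interpret real_distribution "\<nu> k" using \<nu> real_prob_real_distribution by blast
      have sub: "{x. R / \<bar>t'\<bar> < \<bar>x\<bar>} \<subseteq> {x. t' * x < - R} \<union> {x. R < t' * x}"
      proof
        fix x assume "x \<in> {x. R / \<bar>t'\<bar> < \<bar>x\<bar>}"
        then have "R < \<bar>t' * x\<bar>" using \<open>t' \<noteq> 0\<close> by (simp add: field_simps abs_mult)
        then show "x \<in> {x. t' * x < - R} \<union> {x. R < t' * x}" by (auto simp: abs_if split: if_splits)
      qed
      have "prob {x. R / \<bar>t'\<bar> < \<bar>x\<bar>} \<le> prob ({x. t' * x < - R} \<union> {x. R < t' * x})"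
        by (intro finite_measure_mono sub) auto
      also have "\<dots> \<le> prob {x. t' * x < - R} + prob {x. R < t' * x}"
        by (intro measure_Un_le) auto
      \<comment> \<open>The first summand equals 2 (s (v + 1) + e/16) < e/4, and the second is at
        most e/4.\<close>
      also have "\<dots> \<le> 2 * (1 + s * (v + 1) - (1 - e / 16)) + (v + 1) * exp (- R)"
        using elim s by (intro add_mono mgf_lower_tail[OF \<nu>] mgf_upper_tail[OF \<nu>] R1) auto
      also have "\<dots> < e" using s R2 e by simp
      finally show ?case .
    qed
    then obtain K where K: "\<And>k. k \<ge> K \<Longrightarrow> measure (\<nu> k) {x. R / \<bar>t'\<bar> < \<bar>x\<bar>} < e"
      unfolding eventually_sequentially by blast
    \<comment> \<open>The finitely many laws outside the eventual bound are tight one by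
      one.\<close>
    have "eventually (\<lambda>R'. \<forall>k\<in>{..<K}. measure (\<nu> k) {x. R' < \<bar>x\<bar>} < e) at_top"
      using real_prob_tight[OF \<nu> e] by (intro eventually_ball_finite) auto
    from eventually_happens'[OF _ eventually_conj[OF eventually_ge_at_top[of "R / \<bar>t'\<bar>"] this]]
    obtain R' where R': "R' \<ge> R / \<bar>t'\<bar>" "\<And>k. k < K \<Longrightarrow> measure (\<nu> k) {x. R' < \<bar>x\<bar>} < e"
      by auto
    have "measure (\<nu> k) {x. R' < \<bar>x\<bar>} < e" for k
    proof (cases "k < K")
      case False
      interpret real_distribution "\<nu> k" using \<nu> real_prob_real_distribution by blast
      have "prob {x. R' < \<bar>x\<bar>} \<le> prob {x. R / \<bar>t'\<bar> < \<bar>x\<bar>}"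
        using R' by (intro finite_measure_mono) auto
      then show ?thesis using K[of k] False by simp
    qed (use R' in simp)
    then show ?thesis by blast
  qed
  note R = this
  show ?thesis
    unfolding tight_def
  proof (intro conjI allI impI)
    show "real_distribution (\<nu> k)" for k using \<nu> real_prob_real_distribution by blast
    fix e :: real assume "e > 0"
    then obtain R' where R': "\<And>k. measure (\<nu> k) {x. R' < \<bar>x\<bar>} < e" using R by blast
    have "measure (\<nu> k) {- \<bar>R'\<bar> - 1<..\<bar>R'\<bar> + 1} > 1 - e" for k
    proof -
      interpret real_distribution "\<nu> k" using \<nu> real_prob_real_distribution by blast
      have "1 - prob {- \<bar>R'\<bar> - 1<..\<bar>R'\<bar> + 1} = prob (space (\<nu> k) - {- \<bar>R'\<bar> - 1<..\<bar>R'\<bar> + 1})"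
        by (subst prob_compl) auto
      also have "\<dots> \<le> prob {x. R' < \<bar>x\<bar>}" by (intro finite_measure_mono) auto
      also have "\<dots> < e" by (rule R')
      finally show ?thesis by simp
    qed
    then show "\<exists>a b. a < b \<and> (\<forall>k. 1 - e < measure (\<nu> k) {a<..b})"
      by (intro exI[of _ "- \<bar>R'\<bar> - 1"] exI[of _ "\<bar>R'\<bar> + 1"]) auto
  qed
qed

text \<open>Cutting the height of the integrand instead of the range of x keeps it bounded and
  continuous, so weak convergence of laws applies.\<close>

definition capped_mgf :: "real \<Rightarrow> real measure \<Rightarrow> real \<Rightarrow> real" where
  "capped_mgf B \<nu> t = (\<integral>x. min (exp (t * x)) B \<partial>\<nu>)"

lemma capped_mgf_nn_integral:
  assumes \<nu>: "real_prob \<nu>" and "0 \<le> B"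
  shows "ennreal (capped_mgf B \<nu> t) = (\<integral>\<^sup>+ x. ennreal (min (exp (t * x)) B) \<partial>\<nu>)"
proof -
  interpret prob_space \<nu> using real_probD(1)[OF \<nu>] .
  have [measurable_cong]: "sets \<nu> = sets borel" using real_probD(2)[OF \<nu>] .
  have "integrable \<nu> (\<lambda>x. min (exp (t * x)) B)"
    using assms(2) by (intro integrable_const_bound[of _ B]) auto
  then show ?thesis
    unfolding capped_mgf_def using assms(2) by (intro nn_integral_eq_integral[symmetric]) auto
qed

lemma capped_mgf_nonneg: "0 \<le> B \<Longrightarrow> 0 \<le> capped_mgf B \<nu> t"
  unfolding capped_mgf_def by (intro integral_nonneg_AE) auto

lemma capped_mgf_le:
  assumes "real_prob \<nu>" and "0 \<le> B"
  shows "ereal (capped_mgf B \<nu> t) \<le> mgf \<nu> t"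
proof -
  have "ennreal (capped_mgf B \<nu> t) \<le> (\<integral>\<^sup>+ x. ennreal (exp (t * x)) \<partial>\<nu>)"
    unfolding capped_mgf_nn_integral[OF assms] by (intro nn_integral_mono) (auto intro: ennreal_leI)
  then show ?thesis unfolding mgf_def less_eq_ennreal.rep_eq
    using capped_mgf_nonneg[OF assms(2)] by simp
qed

lemma capped_mgf_greater:
  assumes \<nu>: "real_prob \<nu>" and c: "ereal c < mgf \<nu> t"
  obtains B where "1 \<le> B" "c < capped_mgf B \<nu> t"
proof -
  obtain m d where "d > 0" "\<And>s n. \<bar>s - t\<bar> < d \<Longrightarrow> m \<le> n \<Longrightarrow> ereal c < enn2ereal (trunc_mgf n \<nu> s)"
    using trunc_mgf_eventually_greater[OF \<nu> c] by metis
  then have m: "ereal c < enn2ereal (trunc_mgf m \<nu> t)" by simp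
  define B where "B = exp (\<bar>t\<bar> * real m)"
  have B: "1 \<le> B" by (simp add: B_def)
  have "trunc_mgf m \<nu> t \<le> (\<integral>\<^sup>+ x. ennreal (min (exp (t * x)) B) \<partial>\<nu>)"
    unfolding trunc_mgf_def
  proof (intro nn_integral_mono)
    fix x
    have "t * x \<le> \<bar>t\<bar> * real m" if "\<bar>x\<bar> \<le> real m"
      using that mult_left_mono[of "\<bar>x\<bar>" "real m" "\<bar>t\<bar>"] by (simp add: abs_mult[symmetric])
    then show "ennreal (exp (t * x)) * indicator {- real m..real m} x \<le> ennreal (min (exp (t * x)) B)"
      by (auto simp: B_def abs_le_iff split: split_indicator)
  qed
  also have "\<dots> = ennreal (capped_mgf B \<nu> t)" using B by (subst capped_mgf_nn_integral[OF \<nu>]) auto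
  finally have "enn2ereal (trunc_mgf m \<nu> t) \<le> ereal (capped_mgf B \<nu> t)"
    using capped_mgf_nonneg[of B \<nu> t] B by (simp add: enn2ereal_le_ereal)
  from less_le_trans[OF m this] show ?thesis using that B by simp
qed

text \<open>Where exp(t x) exceeds B, it is at most B^(-a) exp((1 + a) t x). A moment at a slightly
  larger exponent thus makes the part above the cap uniformly small.\<close>

lemma mgf_le_capped:
  assumes \<nu>: "real_prob \<nu>" and a: "0 < a" and B: "1 \<le> B" and C: "mgf \<nu> ((1 + a) * t) < ereal C"
  shows "mgf \<nu> t \<le> ereal (capped_mgf B \<nu> t + C * B powr (- a))"
proof -
  have [measurable_cong]: "sets \<nu> = sets borel" using real_probD(2)[OF \<nu>] .
  have C': "(\<integral>\<^sup>+ x. ennreal (exp ((1 + a) * t * x)) \<partial>\<nu>) < ennreal C"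
    using C unfolding mgf_def enn2ereal_less_ereal .
  then have C0: "0 \<le> C" by (cases "0 \<le> C") (auto simp: ennreal_neg)
  have "(\<integral>\<^sup>+ x. ennreal (exp (t * x)) \<partial>\<nu>) \<le>
      (\<integral>\<^sup>+ x. ennreal (min (exp (t * x)) B) + ennreal (B powr (- a)) * ennreal (exp ((1 + a) * t * x)) \<partial>\<nu>)"
  proof (intro nn_integral_mono)
    fix x
    have "exp (t * x) \<le> min (exp (t * x)) B + B powr (- a) * exp ((1 + a) * t * x)"
    proof (cases "exp (t * x) \<le> B")
      case False
      have "exp ((1 + a) * t * x) = exp (t * x) * exp (t * x) powr a"
        by (simp add: powr_def exp_add[symmetric] algebra_simps)
      moreover have "B powr a \<le> exp (t * x) powr a" using False B a by (intro powr_mono2) auto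
      ultimately have "exp (t * x) * B powr a \<le> exp ((1 + a) * t * x)"
        by (metis exp_ge_zero mult_left_mono)
      then have "exp (t * x) \<le> B powr (- a) * exp ((1 + a) * t * x)"
        using B by (simp add: powr_minus field_simps)
      then show ?thesis using B False by simp
    qed auto
    then show "ennreal (exp (t * x)) \<le> ennreal (min (exp (t * x)) B) + ennreal (B powr (- a)) * ennreal (exp ((1 + a) * t * x))"
      using B by (auto simp: ennreal_mult[symmetric] ennreal_plus[symmetric] simp del: ennreal_plus intro!: ennreal_leI)
  qed
  also have "\<dots> = ennreal (capped_mgf B \<nu> t) + ennreal (B powr (- a)) * (\<integral>\<^sup>+ x. ennreal (exp ((1 + a) * t * x)) \<partial>\<nu>)"
    using B by (subst nn_integral_add) (auto simp: nn_integral_cmult capped_mgf_nn_integral[OF \<nu>])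
  also have "\<dots> \<le> ennreal (capped_mgf B \<nu> t) + ennreal (B powr (- a)) * ennreal C"
    using C' by (intro add_left_mono mult_left_mono) auto
  also have "\<dots> = ennreal (capped_mgf B \<nu> t + C * B powr (- a))"
    using C0 B capped_mgf_nonneg[of B \<nu> t]
    by (simp add: ennreal_mult[symmetric] ennreal_plus[symmetric] mult.commute del: ennreal_plus)
  finally show ?thesis
    unfolding mgf_def using C0 B capped_mgf_nonneg[of B \<nu> t] by (subst enn2ereal_le_ereal) auto
qed

text \<open>Working strictly between 0 and \<open>t\<close> leaves a larger exponent with bounded
  moments. Uniform integrability then gives f <= mgf M, and the capped integrals alone give the
  reverse.\<close>

lemma mgf_limit_eq:
  assumes \<nu>: "\<And>k. real_prob (\<nu> k)" and M: "real_prob M"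
    and lim: "limitin AW (\<lambda>k. mgf (\<nu> k)) f sequentially"
    and conv: "\<And>B. 0 \<le> B \<Longrightarrow> (\<lambda>k. capped_mgf B (\<nu> k) (s * t)) \<longlonglongrightarrow> capped_mgf B M (s * t)"
    and t: "t \<noteq> 0" "f t < \<infinity>" and s: "0 < s" "s < 1"
  shows "f (s * t) = mgf M (s * t)"
proof (rule antisym)
  have f: "f \<in> XMp" using lim by (simp add: limitin_def)
  have upper: "eventually (\<lambda>k. mgf (\<nu> k) (u * t) < ereal c) sequentially"
    if u: "0 < u" "u < 1" "f (u * t) < ereal c" for u c
  proof -
    obtain U where U: "openin AW U" "f \<in> U" "\<And>g. g \<in> U \<Longrightarrow> g (u * t) < ereal c"
      using AW_nbhd_less_radial[OF f t(2,1) u] by (metis (lifting))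
    show ?thesis using limitinD[OF lim U(1,2)] by eventually_elim (rule U(3))
  qed
  show "f (s * t) \<le> mgf M (s * t)"
  proof (rule ccontr)
    assume "\<not> f (s * t) \<le> mgf M (s * t)"
    then have less: "mgf M (s * t) < f (s * t)" by simp
    then obtain c where c: "mgf M (s * t) < ereal c" "ereal c < f (s * t)" using ereal_dense2 by blast
    obtain c' where c': "mgf M (s * t) < ereal c'" "ereal c' < ereal c" using ereal_dense2[OF c(1)] by blast
    \<comment> \<open>\<open>u\<close> lies halfway between \<open>s\<close> and 1, and
      \<open>a\<close> is chosen so that (1 + a) s = u.\<close>
    define u where "u = (1 + s) / 2"
    define a where "a = u / s - 1"
    have u: "0 < u" "u < 1" "s < u" using s by (auto simp: u_def)
    have a: "0 < a" using u s by (simp add: a_def field_simps)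
    have au: "(1 + a) * (s * t) = u * t" using s by (simp add: a_def)
    have "f (u * t) \<le> ereal u * f t + ereal (1 - u) * f 0"
      using XMp_convex[OF f, of u t 0] u by simp
    also have "\<dots> < \<infinity>" using t(2) XMp_nonneg[OF f, of t] XMp_nonneg[OF f, of 0] XMp_zero_finite[OF f]
      by (cases "f t"; cases "f 0") auto
    finally obtain C where C: "f (u * t) < ereal C" using ereal_dense2 by blast
    have "((\<lambda>B. C * B powr (- a)) \<longlongrightarrow> C * 0) at_top"
      using a by (intro tendsto_intros tendsto_neg_powr filterlim_ident) auto
    then have "eventually (\<lambda>B. C * B powr (- a) < c - c') at_top"
      using c' by (intro order_tendstoD(2)) auto
    then obtain B where B: "1 \<le> B" "C * B powr (- a) < c - c'"
      using eventually_happens'[OF _ eventually_conj[OF eventually_ge_at_top[of 1]]] by force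
    have "ereal (capped_mgf B M (s * t)) < ereal c'"
      by (rule le_less_trans[OF capped_mgf_le[OF M] c'(1)]) (use B in simp)
    then have "eventually (\<lambda>k. capped_mgf B (\<nu> k) (s * t) < c') sequentially"
      using conv[of B] B by (intro order_tendstoD(2)) auto
    moreover note upper[OF u(1,2) C]
    moreover have "eventually (\<lambda>k. mgf (\<nu> k) \<in> {g \<in> XMp. ereal c < g (s * t)}) sequentially"
      using c f by (intro limitinD[OF lim openin_AW_greater]) auto
    ultimately have "eventually (\<lambda>k. False) sequentially"
    proof eventually_elim
      case (elim k)
      have "mgf (\<nu> k) (s * t) \<le> ereal (capped_mgf B (\<nu> k) (s * t) + C * B powr (- a))"
        using elim by (intro mgf_le_capped[OF \<nu> a B(1)]) (simp add: au)
      also have "\<dots> < ereal c" using elim B by simp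
      finally show ?case using elim less_asym by blast
    qed
    then show False by simp
  qed
  show "mgf M (s * t) \<le> f (s * t)"
  proof (rule ccontr)
    assume "\<not> mgf M (s * t) \<le> f (s * t)"
    then have less: "f (s * t) < mgf M (s * t)" by simp
    then obtain c where c: "f (s * t) < ereal c" "ereal c < mgf M (s * t)" using ereal_dense2 by blast
    obtain B where B: "1 \<le> B" "c < capped_mgf B M (s * t)" using capped_mgf_greater[OF M c(2)] by metis
    have "eventually (\<lambda>k. c < capped_mgf B (\<nu> k) (s * t)) sequentially"
      using conv[of B] B by (intro order_tendstoD(1)) auto
    moreover note upper[OF s c(1)]
    ultimately have "eventually (\<lambda>k. False) sequentially"
    proof eventually_elim
      case (elim k)
      have "ereal c < ereal (capped_mgf B (\<nu> k) (s * t))" using elim by simp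
      also have "\<dots> \<le> mgf (\<nu> k) (s * t)" using B by (intro capped_mgf_le[OF \<nu>]) auto
      finally show ?case using elim by simp
    qed
    then show False by simp
  qed
qed

lemma closure_XB_subset_XM:
  assumes f: "f \<in> AW closure_of XB" and f0: "f 0 = 1"
  shows "f \<in> XM"
proof -
  have fX: "f \<in> XMp" using f by (simp add: in_closure_of)
  have "\<exists>\<nu>. real_prob \<nu> \<and> (\<forall>t. f t < \<infinity> \<longrightarrow> f t = mgf \<nu> t)"
  proof (cases "\<exists>t. t \<noteq> 0 \<and> f t < \<infinity>")
    case False
    \<comment> \<open>When the domain is reduced to 0, every law has the right transform there, so a
      point mass will do.\<close>
    have "real_prob (return borel 0)" by (auto simp: real_prob_def prob_space_return)
    then show ?thesis using False f0 mgf_zero by (intro exI[of _ "return borel 0"]) metis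
  next
    case True
    obtain g where g: "\<And>k. g k \<in> XB" "limitin AW g f sequentially"
      using AW_closure_limit[OF f] XB_subset_XM XM_subset_XMp by blast
    then have "\<exists>\<nu>. real_prob \<nu> \<and> g k = mgf \<nu>" for k by (force simp: XB_def)
    then obtain \<nu> where \<nu>: "\<And>k. real_prob (\<nu> k)" "\<And>k. g k = mgf (\<nu> k)" by metis
    have lim: "limitin AW (\<lambda>k. mgf (\<nu> k)) f sequentially" using g(2) \<nu>(2) by (metis (no_types, lifting) ext)
    have "tight \<nu>" using AW_limit_mgf_tight[OF \<nu>(1) lim f0] True by blast
    then obtain r M where r: "strict_mono (r :: nat \<Rightarrow> nat)" "real_distribution M" "weak_conv_m (\<nu> \<circ> id \<circ> r) M"
      using tight_imp_convergent_subsubsequence[of \<nu> id] strict_mono_id by blast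
    have M: "real_prob M" using r(2) real_prob_real_distribution by blast
    have lim': "limitin AW (\<lambda>k. mgf (\<nu> (r k))) f sequentially"
      using limitin_subsequence[OF r(1) lim] by (simp add: o_def)
    have conv: "(\<lambda>k. capped_mgf B (\<nu> (r k)) t) \<longlonglongrightarrow> capped_mgf B M t" if "0 \<le> B" for B t
      unfolding capped_mgf_def
    proof (rule weak_conv_imp_integral_bdd_continuous_conv[where B = B])
      show "real_distribution (\<nu> (r n))" for n using \<nu>(1) real_prob_real_distribution by blast
      show "weak_conv_m (\<lambda>k. \<nu> (r k)) M" using r(3) by (simp add: o_def)
      show "isCont (\<lambda>x. min (exp (t * x)) B) x" for x by (intro continuous_intros)
    qed (use that r in auto)
    have "f t = mgf M t" if t: "f t < \<infinity>" for t
    proof (cases "t = 0")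
      case True
      then show ?thesis using f0 mgf_zero[OF M] by simp
    next
      case False
      have eq: "f (s * t) = mgf M (s * t)" if "0 < s" "s < 1" for s
        using mgf_limit_eq[OF \<nu>(1) M lim' conv False t that] by blast
      \<comment> \<open>Radial continuity of both functions extends the identity from the open
        segment to its end \<open>t\<close>.\<close>
      have "((\<lambda>s. f ((1 - s) * t)) \<longlongrightarrow> f t) (at_right 0)"
        using XMp_tendsto_at_right[OF fX XMp_zero_finite[OF fX], of t] by simp
      moreover have "((\<lambda>s. mgf M ((1 - s) * t)) \<longlongrightarrow> mgf M t) (at_right 0)"
        using XMp_tendsto_at_right[OF mgf_in_XMp[OF M] XMp_zero_finite[OF mgf_in_XMp[OF M]], of t] by simp
      moreover have ev: "eventually (\<lambda>s. f ((1 - s) * t) = mgf M ((1 - s) * t)) (at_right 0)"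
        using eventually_at_right_real[of 0 "1::real", simplified]
        by eventually_elim (auto intro!: eq)
      ultimately have "((\<lambda>s. mgf M ((1 - s) * t)) \<longlongrightarrow> f t) (at_right 0)"
        "((\<lambda>s. mgf M ((1 - s) * t)) \<longlongrightarrow> mgf M t) (at_right 0)"
        using tendsto_cong[OF ev] by auto
      then show ?thesis by (rule tendsto_unique[OF trivial_limit_at_right_real])
    qed
    then show ?thesis using M by blast
  qed
  then obtain \<nu> where \<nu>: "real_prob \<nu>" "\<And>t. f t < \<infinity> \<Longrightarrow> f t = mgf \<nu> t" by blast
  have "0 < f t" for t
    using \<nu>(2)[of t] mgf_pos[OF \<nu>(1), of t] by (cases "f t") auto
  then show ?thesis using fX \<nu> by (auto simp: XM_def)
qed


subsection \<open>Approximation by moment generating functions of compactly supported laws\<close>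

lemma XB_I:
  assumes "real_prob \<nu>" "compact K" "AE x in \<nu>. x \<in> K"
  shows "mgf \<nu> \<in> XB"
proof -
  interpret prob_space \<nu> using real_probD(1)[OF assms(1)] .
  have K: "K \<in> sets \<nu>" using assms real_probD(2) by (auto intro: borel_compact)
  then have "emeasure \<nu> K = 1" using assms(3) by (simp add: AE_in_set_eq_1 emeasure_eq_measure)
  then show ?thesis using assms K by (auto simp: XB_def compact_supp_def)
qed

lemma XB_E:
  assumes "g \<in> XB"
  obtains \<nu> R where "real_prob \<nu>" "g = mgf \<nu>" "0 \<le> R" "AE x in \<nu>. \<bar>x\<bar> \<le> R"
proof -
  obtain \<nu> K where \<nu>: "g = mgf \<nu>" "real_prob \<nu>" "compact K" "K \<in> sets \<nu>" "emeasure \<nu> K = 1"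
    using assms by (auto simp: XB_def compact_supp_def)
  interpret prob_space \<nu> using real_probD(1)[OF \<nu>(2)] .
  have "AE x in \<nu>. x \<in> K" using \<nu> by (simp add: AE_in_set_eq_1 emeasure_eq_measure)
  moreover obtain R where R: "\<And>x. x \<in> K \<Longrightarrow> \<bar>x\<bar> \<le> R" 
    using compact_imp_bounded[OF \<nu>(3)] by (auto simp: bounded_iff)
  ultimately have "AE x in \<nu>. \<bar>x\<bar> \<le> max R 0" by (auto elim!: eventually_mono simp: le_max_iff_disj)
  then show ?thesis using that[of \<nu> "max R 0"] \<nu> by simp
qed

lemma XB_real:
  assumes "g \<in> XB" shows "\<exists>h. g = (\<lambda>t. ereal (h t))"
proof -
  obtain \<nu> R where \<nu>: "real_prob \<nu>" "g = mgf \<nu>" "0 \<le> R" "AE x in \<nu>. \<bar>x\<bar> \<le> R"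
    using XB_E[OF assms] by metis
  interpret prob_space \<nu> using real_probD(1)[OF \<nu>(1)] .
  have "g t = ereal (real_of_ereal (g t))" for t
  proof -
    have "(\<integral>\<^sup>+ x. ennreal (exp (t * x)) \<partial>\<nu>) \<le> (\<integral>\<^sup>+ x. ennreal (exp (\<bar>t\<bar> * R)) \<partial>\<nu>)"
    proof (intro nn_integral_mono_AE)
      show "AE x in \<nu>. ennreal (exp (t * x)) \<le> ennreal (exp (\<bar>t\<bar> * R))"
        using \<nu>(4)
      proof eventually_elim
        case (elim x)
        then have "\<bar>t * x\<bar> \<le> \<bar>t\<bar> * R" by (simp add: abs_mult mult_left_mono)
        then show ?case by (intro ennreal_leI) auto
      qed
    qed
    also have "\<dots> = ennreal (exp (\<bar>t\<bar> * R))" by (simp add: emeasure_space_1)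
    finally have "mgf \<nu> t \<le> ereal (exp (\<bar>t\<bar> * R))" unfolding mgf_def by (simp add: enn2ereal_le_ereal)
    moreover have "0 < mgf \<nu> t" by (rule mgf_pos[OF \<nu>(1)])
    ultimately show ?thesis unfolding \<nu>(2) by (cases "mgf \<nu> t") auto
  qed
  then show ?thesis by (intro exI[of _ "\<lambda>t. real_of_ereal (g t)"]) (rule ext)
qed

lemma XB_return: "(\<lambda>t. ereal (exp (t * y))) \<in> XB"
proof -
  have "real_prob (return borel y)" by (auto simp: real_prob_def prob_space_return)
  moreover have "AE x in return borel y. x \<in> {y}" by (subst AE_return) auto
  ultimately have "mgf (return borel y) \<in> XB" by (intro XB_I[of _ "{y}"]) auto
  moreover have "mgf (return borel y) = (\<lambda>t. ereal (exp (t * y)))"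
    by (auto simp: mgf_def nn_integral_return fun_eq_iff)
  ultimately show ?thesis by simp
qed

lemma XB_convex:
  assumes "(\<lambda>t. ereal (h1 t)) \<in> XB" "(\<lambda>t. ereal (h2 t)) \<in> XB" and w: "0 \<le> w" "w \<le> 1"
  shows "(\<lambda>t. ereal ((1 - w) * h1 t + w * h2 t)) \<in> XB"
proof -
  obtain \<nu>1 R1 where \<nu>1: "real_prob \<nu>1" "(\<lambda>t. ereal (h1 t)) = mgf \<nu>1" "0 \<le> R1" "AE x in \<nu>1. \<bar>x\<bar> \<le> R1"
    using XB_E[OF assms(1)] by metis
  obtain \<nu>2 R2 where \<nu>2: "real_prob \<nu>2" "(\<lambda>t. ereal (h2 t)) = mgf \<nu>2" "0 \<le> R2" "AE x in \<nu>2. \<bar>x\<bar> \<le> R2"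
    using XB_E[OF assms(2)] by metis
  define \<kappa> where "\<kappa> b = (if b then \<nu>2 else \<nu>1)" for b
  \<comment> \<open>The mixture draws from \<open>\<nu>2\<close> with probability \<open>w\<close>
    and from \<open>\<nu>1\<close> otherwise.\<close>
  define \<nu> where "\<nu> = measure_pmf (bernoulli_pmf w) \<bind> \<kappa>"
  have prob: "\<kappa> b \<in> space (prob_algebra borel)" for b
    using real_probD[OF \<nu>1(1)] real_probD[OF \<nu>2(1)] by (auto simp: \<kappa>_def space_prob_algebra)
  have meas: "\<kappa> \<in> measure_pmf (bernoulli_pmf w) \<rightarrow>\<^sub>M prob_algebra borel"
    using prob by (auto simp: measurable_def)
  have pmf: "measure_pmf (bernoulli_pmf w) \<in> space (prob_algebra (count_space UNIV))"
    by (auto simp: space_prob_algebra prob_space_measure_pmf)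
  have meas': "\<kappa> \<in> count_space UNIV \<rightarrow>\<^sub>M prob_algebra borel" using prob by (auto simp: measurable_def)
  have \<nu>: "real_prob \<nu>"
    unfolding real_prob_def \<nu>_def using prob_space_bind'[OF pmf meas'] sets_bind'[OF pmf meas'] by auto
  have int: "(\<integral>\<^sup>+ x. F x \<partial>\<nu>) = (\<integral>\<^sup>+ x. F x \<partial>\<nu>2) * ennreal w + (\<integral>\<^sup>+ x. F x \<partial>\<nu>1) * ennreal (1 - w)"
    if [measurable]: "F \<in> borel_measurable borel" for F
    unfolding \<nu>_def
    by (subst nn_integral_bind[OF that measurable_prob_algebraD[OF meas]])
       (use w in \<open>auto simp: \<kappa>_def\<close>)
  have "AE x in \<nu>. x \<in> {- max R1 R2..max R1 R2}"
  proof -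
    have z1: "(\<integral>\<^sup>+ x. indicator (- {- max R1 R2..max R1 R2}) x \<partial>\<nu>1) = 0"
      by (subst nn_integral_0_iff_AE)
         (use \<nu>1(4) in \<open>auto elim!: eventually_mono simp: measurable_cong_sets[OF real_probD(2)[OF \<nu>1(1)] refl] split: split_indicator\<close>)
    have z2: "(\<integral>\<^sup>+ x. indicator (- {- max R1 R2..max R1 R2}) x \<partial>\<nu>2) = 0"
      by (subst nn_integral_0_iff_AE)
         (use \<nu>2(4) in \<open>auto elim!: eventually_mono simp: measurable_cong_sets[OF real_probD(2)[OF \<nu>2(1)] refl] split: split_indicator\<close>)
    have "(\<integral>\<^sup>+ x. indicator (- {- max R1 R2..max R1 R2}) x \<partial>\<nu>) = 0"
      by (subst int) (auto simp: z1 z2)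
    then show ?thesis
      by (subst (asm) nn_integral_0_iff_AE)
         (auto simp: measurable_cong_sets[OF real_probD(2)[OF \<nu>] refl] indicator_eq_0_iff)
  qed
  then have "mgf \<nu> \<in> XB" by (intro XB_I[OF \<nu>, of "{- max R1 R2..max R1 R2}"]) auto
  moreover have "mgf \<nu> = (\<lambda>t. ereal ((1 - w) * h1 t + w * h2 t))"
  proof
    fix t
    have "mgf \<nu> t = mgf \<nu>2 t * ereal w + mgf \<nu>1 t * ereal (1 - w)"
      unfolding mgf_def using w by (subst int) (auto simp: plus_ennreal.rep_eq times_ennreal.rep_eq)
    also have "\<dots> = ereal ((1 - w) * h1 t + w * h2 t)"
      unfolding \<nu>1(2)[symmetric] \<nu>2(2)[symmetric] by (simp add: algebra_simps)
    finally show "mgf \<nu> t = ereal ((1 - w) * h1 t + w * h2 t)" .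
  qed
  ultimately show ?thesis by simp
qed

text \<open>Points outside [-m, m] are moved to 0, where the exponential is 1: the law stays a
  probability and the transform grows by at most the tail mass.\<close>

lemma XB_clamp:
  assumes \<nu>: "real_prob \<nu>"
  obtains h where "(\<lambda>t. ereal (h t)) \<in> XB" "\<And>t. enn2ereal (trunc_mgf m \<nu> t) \<le> ereal (h t)"
    "\<And>t. ereal (h t) \<le> mgf \<nu> t + ereal (measure \<nu> {x. real m < \<bar>x\<bar>})"
proof -
  interpret prob_space \<nu> using real_probD(1)[OF \<nu>] .
  have [measurable_cong]: "sets \<nu> = sets borel" using real_probD(2)[OF \<nu>] .
  define r where "r x = (if \<bar>x\<bar> \<le> real m then x else 0)" for x
  have [measurable]: "r \<in> borel_measurable borel" unfolding r_def by measurable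
  let ?\<nu> = "distr \<nu> borel r"
  have p: "real_prob ?\<nu>" by (auto simp: real_prob_def intro!: prob_space_distr)
  have "mgf ?\<nu> \<in> XB"
    by (rule XB_I[OF p, of "{- real m..real m}"]) (auto simp: AE_distr_iff r_def abs_le_iff)
  then obtain h where h: "mgf ?\<nu> = (\<lambda>t. ereal (h t))" using XB_real by blast
  have eq: "mgf ?\<nu> t = enn2ereal (\<integral>\<^sup>+ x. ennreal (exp (t * r x)) \<partial>\<nu>)" for t
    unfolding mgf_def by (subst nn_integral_distr) auto
  have "enn2ereal (trunc_mgf m \<nu> t) \<le> ereal (h t)" for t
    unfolding h[THEN fun_cong, symmetric] eq trunc_mgf_def less_eq_ennreal.rep_eq[symmetric]
    by (intro nn_integral_mono) (auto simp: r_def abs_le_iff split: split_indicator)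
  moreover have "ereal (h t) \<le> mgf \<nu> t + ereal (measure \<nu> {x. real m < \<bar>x\<bar>})" for t
  proof -
    have "(\<integral>\<^sup>+ x. ennreal (exp (t * r x)) \<partial>\<nu>) \<le> (\<integral>\<^sup>+ x. ennreal (exp (t * x)) + indicator {x. real m < \<bar>x\<bar>} x \<partial>\<nu>)"
      by (intro nn_integral_mono) (auto simp: r_def split: split_indicator)
    also have "\<dots> = (\<integral>\<^sup>+ x. ennreal (exp (t * x)) \<partial>\<nu>) + ennreal (measure \<nu> {x. real m < \<bar>x\<bar>})"
      by (subst nn_integral_add) (auto simp: emeasure_eq_measure)
    finally show ?thesis
      unfolding h[THEN fun_cong, symmetric] eq unfolding mgf_def less_eq_ennreal.rep_eq
      by (simp add: plus_ennreal.rep_eq)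
  qed
  ultimately show ?thesis using that \<open>mgf ?\<nu> \<in> XB\<close> h by simp
qed

text \<open>Masses \<open>w k\<close> at the points \<open>y k\<close> that do not contribute on \<open>J\<close> in the limit, but let the
  moment generating function explode to the right of \<open>J\<close>.\<close>

definition escaping_right :: "real set \<Rightarrow> (nat \<Rightarrow> real) \<Rightarrow> (nat \<Rightarrow> real) \<Rightarrow> bool" where
  "escaping_right J w y \<longleftrightarrow> (\<forall>k. 0 \<le> w k) \<and> (\<forall>k. w k \<le> 1 / 2) \<and> w \<longlonglongrightarrow> 0 \<and>
    (\<forall>t. t \<in> J \<longrightarrow> (\<lambda>k. w k * exp (t * y k)) \<longlonglongrightarrow> 0) \<and>
    (\<forall>t u. u < t \<longrightarrow> J \<subseteq> {..u} \<longrightarrow>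
       (\<exists>d>0. \<forall>c. eventually (\<lambda>k. \<forall>s. \<bar>s - t\<bar> < d \<longrightarrow> c < w k * exp (s * y k)) sequentially))"

lemma escaping_mass:
  fixes J :: "real set"
  assumes J: "0 \<in> J"
  shows "\<exists>w y. escaping_right J w y"
proof (cases "bdd_above J")
  case False
  \<comment> \<open>If \<open>J\<close> is unbounded above, nothing lies to its right, and zero
    masses do.\<close>
  then show ?thesis
    by (intro exI[of _ "\<lambda>_. 0"]) (auto simp: escaping_right_def dest: bdd_above_mono[rotated])
next
  case bdd: True
  define b where "b = Sup J"
  have b: "t \<le> b" if "t \<in> J" for t using that bdd by (simp add: b_def cSup_upper)
  have b0: "0 \<le> b" using b[OF J] .
  \<comment> \<open>The exponent of \<open>w k * exp (t * y k)\<close> is (t - b) k^2 - k - 1. The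
    quadratic term separates t > b from t <= b, the linear term forces decay at t = b as well, and
    the final 1 keeps \<open>w k\<close> below 1/2.\<close>
  define w where "w k = exp (- b * real k ^ 2 - real k - 1)" for k :: nat
  define y where "y k = real k ^ 2" for k :: nat
  have wy: "w k * exp (t * y k) = exp ((t - b) * real k ^ 2 - real k - 1)" for k t
    by (simp add: w_def y_def exp_add[symmetric] algebra_simps)
  have le: "w k * exp (t * y k) \<le> inverse (real (Suc k))" if "t \<in> J" for k t
  proof -
    have "w k * exp (t * y k) \<le> exp (- real (Suc k))"
      unfolding wy using b[OF that] by (auto intro!: mult_nonpos_nonneg)
    also have "\<dots> \<le> inverse (real (Suc k))"
      unfolding exp_minus using exp_ge_add_one_self[of "real (Suc k)"] by (intro le_imp_inverse_le) auto
    finally show ?thesis .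
  qed
  have lim: "(\<lambda>k. w k * exp (t * y k)) \<longlonglongrightarrow> 0" if "t \<in> J" for t
  proof (rule tendsto_sandwich[OF _ _ tendsto_const LIMSEQ_inverse_real_of_nat])
    show "eventually (\<lambda>k. w k * exp (t * y k) \<le> inverse (real (Suc k))) sequentially"
      by (intro always_eventually allI le[OF that])
  qed (simp add: w_def)
  show ?thesis
    unfolding escaping_right_def
  proof (rule exI[of _ w], rule exI[of _ y], intro conjI allI impI)
    show "0 \<le> w k" for k by (simp add: w_def)
    show "w k \<le> 1 / 2" for k
    proof -
      have "- b * real k ^ 2 \<le> 0" using b0 by simp
      then have "w k \<le> exp (- 1)" unfolding w_def exp_le_cancel_iff by linarith
      also have "\<dots> \<le> 1 / 2" using exp_ge_add_one_self[of 1] by (simp add: exp_minus field_simps)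
      finally show ?thesis .
    qed
    show "w \<longlonglongrightarrow> 0" using lim[OF J] by simp
    show "(\<lambda>k. w k * exp (t * y k)) \<longlonglongrightarrow> 0" if "t \<in> J" for t by (rule lim[OF that])
  next
    fix t u assume "u < t" "J \<subseteq> {..u}"
    then have "b \<le> u" using J unfolding b_def by (intro cSup_least) auto
    define d where "d = (t - b) / 2"
    have d: "d > 0" using \<open>b \<le> u\<close> \<open>u < t\<close> by (simp add: d_def)
    have "eventually (\<lambda>k. \<forall>s. \<bar>s - t\<bar> < d \<longrightarrow> c < w k * exp (s * y k)) sequentially" for c
    proof -
      have "eventually (\<lambda>k. max (2 / d) c < real k) sequentially"
        using filterlim_real_sequentially unfolding filterlim_at_top_dense by blast
      then show ?thesis
      proof (eventually_elim, intro allI impI)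
        fix k s assume k: "max (2 / d) c < real k" and "\<bar>s - t\<bar> < d"
        then have "t - s < d" by arith
        then have s: "d \<le> s - b" by (simp add: d_def field_simps)
        have "2 \<le> d * real k" using k d by (simp add: field_simps)
        then have "2 * real k \<le> (d * real k) * real k" by (intro mult_right_mono) auto
        also have "\<dots> \<le> (s - b) * real k ^ 2" using s by (simp add: power2_eq_square mult_right_mono mult.assoc)
        finally have "real k - 1 \<le> (s - b) * real k ^ 2 - real k - 1" by simp
        then have "exp (real k - 1) \<le> w k * exp (s * y k)" unfolding wy by simp
        moreover have "real k \<le> exp (real k - 1)" using exp_ge_add_one_self[of "real k - 1"] by simp
        ultimately show "c < w k * exp (s * y k)" using k by simp
      qed
    qed
    then show "\<exists>d>0. \<forall>c. eventually (\<lambda>k. \<forall>s. \<bar>s - t\<bar> < d \<longrightarrow> c < w k * exp (s * y k)) sequentially"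
      using d by blast
  qed
qed

text \<open>The approximants mix a truncation of the representing law with small masses at y k and -
  z k. The masses matter where \<open>f\<close> is infinite although the transform of the law is
  finite; the left one comes from the reflected domain.\<close>

lemma XM_subset_closure_XB:
  assumes f: "f \<in> XM" shows "f \<in> AW closure_of XB"
proof -
  have fX: "f \<in> XMp" using f XM_subset_XMp by blast
  obtain \<nu> where \<nu>: "real_prob \<nu>" "\<And>t. f t < \<infinity> \<Longrightarrow> f t = mgf \<nu> t"
    using f by (auto simp: XM_def)
  define J where "J = {t. f t < \<infinity>}"
  have J0: "0 \<in> J" "0 \<in> uminus ` J" using XMp_zero_finite[OF fX] by (auto simp: J_def image_iff)
  obtain w y :: "nat \<Rightarrow> real" where w: "\<And>k. 0 \<le> w k" "\<And>k. w k \<le> 1 / 2" "w \<longlonglongrightarrow> 0"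
    "\<And>t. t \<in> J \<Longrightarrow> (\<lambda>k. w k * exp (t * y k)) \<longlonglongrightarrow> 0"
    "\<And>t u. u < t \<Longrightarrow> J \<subseteq> {..u} \<Longrightarrow>
       \<exists>d>0. \<forall>c. eventually (\<lambda>k. \<forall>s. \<bar>s - t\<bar> < d \<longrightarrow> c < w k * exp (s * y k)) sequentially"
    using escaping_mass[OF J0(1)] unfolding escaping_right_def by auto
  obtain v z :: "nat \<Rightarrow> real" where v: "\<And>k. 0 \<le> v k" "\<And>k. v k \<le> 1 / 2" "v \<longlonglongrightarrow> 0"
    "\<And>t. t \<in> uminus ` J \<Longrightarrow> (\<lambda>k. v k * exp (t * z k)) \<longlonglongrightarrow> 0"
    "\<And>t u. u < t \<Longrightarrow> uminus ` J \<subseteq> {..u} \<Longrightarrow>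
       \<exists>d>0. \<forall>c. eventually (\<lambda>k. \<forall>s. \<bar>s - t\<bar> < d \<longrightarrow> c < v k * exp (s * z k)) sequentially"
    using escaping_mass[OF J0(2)] unfolding escaping_right_def by auto
  have "\<exists>h. (\<lambda>t. ereal (h t)) \<in> XB \<and> (\<forall>t. enn2ereal (trunc_mgf m \<nu> t) \<le> ereal (h t)) \<and>
      (\<forall>t. ereal (h t) \<le> mgf \<nu> t + ereal (measure \<nu> {x. real m < \<bar>x\<bar>}))" for m
    using XB_clamp[OF \<nu>(1), of m] by metis
  then obtain h where h: "\<And>k. (\<lambda>t. ereal (h k t)) \<in> XB" "\<And>k t. enn2ereal (trunc_mgf k \<nu> t) \<le> ereal (h k t)"
    "\<And>k t. ereal (h k t) \<le> mgf \<nu> t + ereal (measure \<nu> {x. real k < \<bar>x\<bar>})" by metis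
  have h0: "0 \<le> h k t" for k t
    using order_trans[OF enn2ereal_nonneg h(2)[of k t]] by simp
  define g where "g k t = (1 - v k) * ((1 - w k) * h k t + w k * exp (t * y k)) + v k * exp (t * - z k)" for k t
  have g: "(\<lambda>t. ereal (g k t)) \<in> XB" for k
    unfolding g_def using w(1,2)[of k] v(1,2)[of k] by (intro XB_convex XB_return h) auto
  have g_h: "(1 - v k) * (1 - w k) * h k t \<le> g k t"
    and g_w: "w k * exp (t * y k) / 2 \<le> g k t" and g_v: "v k * exp (- t * z k) \<le> g k t" for k t
  proof -
    have p: "0 \<le> (1 - v k) * (1 - w k) * h k t" "0 \<le> (1 - v k) * (w k * exp (t * y k))" "0 \<le> v k * exp (t * - z k)"
      using w(1,2)[of k] v(1,2)[of k] h0 by auto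
    have eq: "g k t = (1 - v k) * (1 - w k) * h k t + (1 - v k) * (w k * exp (t * y k)) + v k * exp (t * - z k)"
      by (simp add: g_def algebra_simps)
    show "(1 - v k) * (1 - w k) * h k t \<le> g k t" "v k * exp (- t * z k) \<le> g k t" using p eq by auto
    have "1 / 2 * (w k * exp (t * y k)) \<le> (1 - v k) * (w k * exp (t * y k))"
      using w(1,2)[of k] v(1,2)[of k] by (intro mult_right_mono) auto
    then show "w k * exp (t * y k) / 2 \<le> g k t" using p eq by simp
  qed
  have "limitin AW (\<lambda>k t. ereal (g k t)) f sequentially"
  proof (rule limitin_AW_I[OF fX])
    show "eventually (\<lambda>k. (\<lambda>t. ereal (g k t)) \<in> XMp) sequentially"
      using g XB_subset_XM XM_subset_XMp by (auto intro!: always_eventually)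
    show "((\<lambda>k. epi_dist (\<lambda>t. ereal (g k t)) p) \<longlongrightarrow> epi_dist f p) sequentially" for p
    proof (rule epi_dist_tendsto)
      show "ereal (g k 0) < \<infinity>" "f 0 < \<infinity>" for k using XMp_zero_finite[OF fX] by auto
      fix t c
      show "eventually (\<lambda>k. ereal (g k t) < ereal c) sequentially" if fc: "f t < ereal c"
      proof -
        have fin: "f t < \<infinity>" using fc by (auto intro: less_trans)
        obtain a where a: "f t = ereal a" using fin XMp_nonneg[OF fX, of t] by (cases "f t") auto
        have m: "mgf \<nu> t = ereal a" using \<nu>(2)[OF fin] a by simp
        define b where "b k = a + measure \<nu> {x. real k < \<bar>x\<bar>} + w k * exp (t * y k) + v k * exp (- t * z k)" for k
        have "g k t \<le> b k" for k
        proof -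
          have "h k t \<le> a + measure \<nu> {x. real k < \<bar>x\<bar>}" using h(3)[of k t] unfolding m by simp
          moreover have "(1 - w k) * h k t \<le> h k t" using w(1,2)[of k] h0 by (intro mult_left_le_one_le) auto
          moreover have "(1 - v k) * ((1 - w k) * h k t + w k * exp (t * y k)) \<le> (1 - w k) * h k t + w k * exp (t * y k)"
            using w(1,2)[of k] v(1,2)[of k] h0 by (intro mult_left_le_one_le) auto
          ultimately show ?thesis unfolding g_def b_def by simp
        qed
        moreover have "b \<longlonglongrightarrow> a + 0 + 0 + 0"
          unfolding b_def
        proof (intro tendsto_add tendsto_const)
          show "(\<lambda>k. measure \<nu> {x. real k < \<bar>x\<bar>}) \<longlonglongrightarrow> 0"
          proof (rule order_tendstoI)
            fix e :: real assume "0 < e"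
            from real_prob_tight[OF \<nu>(1) this] filterlim_real_sequentially
            show "eventually (\<lambda>k. measure \<nu> {x. real k < \<bar>x\<bar>} < e) sequentially"
              by (auto simp: filterlim_iff)
          qed (auto intro!: always_eventually less_le_trans[OF _ measure_nonneg])
          show "(\<lambda>k. w k * exp (t * y k)) \<longlonglongrightarrow> 0" using fin by (intro w(4)) (simp add: J_def)
          show "(\<lambda>k. v k * exp (- t * z k)) \<longlonglongrightarrow> 0" using fin by (intro v(4)) (simp add: J_def)
        qed
        then have "eventually (\<lambda>k. b k < c) sequentially" using fc a by (intro order_tendstoD(2)) auto
        ultimately show ?thesis
          unfolding less_ereal.simps by (metis (mono_tags, lifting) eventually_mono le_less_trans)
      qed
      show "\<exists>d>0. eventually (\<lambda>k. \<forall>s. \<bar>s - t\<bar> < d \<longrightarrow> ereal c < ereal (g k s)) sequentially" if cf: "ereal c < f t"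
      proof (cases "c < 0")
        case True
        have "0 \<le> g k s" for k s using g_v[of k s] v(1)[of k] by (auto intro: order_trans[rotated])
        then have "c < g k s" for k s using True by (auto intro: less_le_trans)
        then show ?thesis by (intro exI[of _ 1]) auto
      next
        case c0: False
        show ?thesis
        proof (cases "ereal c < mgf \<nu> t")
          case True
          then obtain c' where c': "ereal c < ereal c'" "ereal c' < mgf \<nu> t" using ereal_dense2 by blast
          obtain m d where d: "d > 0" "\<And>s n. \<bar>s - t\<bar> < d \<Longrightarrow> m \<le> n \<Longrightarrow> ereal c' < enn2ereal (trunc_mgf n \<nu> s)"
            using trunc_mgf_eventually_greater[OF \<nu>(1) c'(2)] by metis
          have "(\<lambda>k. (1 - v k) * (1 - w k) * c') \<longlonglongrightarrow> (1 - 0) * (1 - 0) * c'"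
            by (intro tendsto_intros w v)
          then have "eventually (\<lambda>k. c < (1 - v k) * (1 - w k) * c') sequentially"
            using c' by (intro order_tendstoD(1)) auto
          with eventually_ge_at_top[of m]
          have "eventually (\<lambda>k. \<forall>s. \<bar>s - t\<bar> < d \<longrightarrow> ereal c < ereal (g k s)) sequentially"
          proof eventually_elim
            case (elim k)
            show ?case
            proof (intro allI impI)
              fix s assume "\<bar>s - t\<bar> < d"
              from less_le_trans[OF d(2)[OF this elim(1)] h(2)] have "c' < h k s" by simp
              then have "(1 - v k) * (1 - w k) * c' \<le> (1 - v k) * (1 - w k) * h k s"
                using w(1,2)[of k] v(1,2)[of k] by (intro mult_left_mono) auto
              then show "ereal c < ereal (g k s)" using elim(2) g_h[of k s] by simp
            qed
          qed
          then show ?thesis using d by blast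
        next
          case False
          then have less: "mgf \<nu> t < f t" using cf by auto
          then have ft: "f t = \<infinity>" using \<nu>(2)[of t] by (cases "f t") auto
          \<comment> \<open>\<open>t\<close> lies beyond the closure of the domain: otherwise
            \<open>f\<close> and the transform would agree on the open segment from 0 to
            \<open>t\<close>, and radial continuity would give equality at \<open>t\<close>.\<close>
          have "\<exists>s. 0 < s \<and> s < 1 \<and> s * t \<notin> J"
          proof (rule ccontr)
            assume neg: "\<not> (\<exists>s. 0 < s \<and> s < 1 \<and> s * t \<notin> J)"
            have "((\<lambda>s. f ((1 - s) * t)) \<longlongrightarrow> f t) (at_right 0)"
              using XMp_tendsto_at_right[OF fX XMp_zero_finite[OF fX], of t] by simp
            moreover have "((\<lambda>s. mgf \<nu> ((1 - s) * t)) \<longlongrightarrow> mgf \<nu> t) (at_right 0)"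
              using XMp_tendsto_at_right[OF mgf_in_XMp[OF \<nu>(1)] XMp_zero_finite[OF mgf_in_XMp[OF \<nu>(1)]], of t] by simp
            moreover have ev: "eventually (\<lambda>s. f ((1 - s) * t) = mgf \<nu> ((1 - s) * t)) (at_right 0)"
              using eventually_at_right_real[of 0 "1::real", simplified]
            proof eventually_elim
              case (elim s)
              then have "(1 - s) * t \<in> J" using neg by auto
              then show ?case using \<nu>(2) by (simp add: J_def)
            qed
            ultimately have "((\<lambda>s. mgf \<nu> ((1 - s) * t)) \<longlongrightarrow> f t) (at_right 0)"
              "((\<lambda>s. mgf \<nu> ((1 - s) * t)) \<longlongrightarrow> mgf \<nu> t) (at_right 0)"
              using tendsto_cong[OF ev] by auto
            then have "f t = mgf \<nu> t" by (rule tendsto_unique[OF trivial_limit_at_right_real])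
            then show False using less by simp
          qed
          then obtain s where s: "0 < s" "s < 1" "s * t \<notin> J" by blast
          have Jconv: "r \<in> J" if "x \<in> J" "0 < r \<and> r < x \<or> x < r \<and> r < 0" for x r
          proof -
            define C where "C = max (real_of_ereal (f x)) (real_of_ereal (f 0)) + 1"
            have "f x < ereal C" "f 0 < ereal C"
              using that XMp_zero_finite[OF fX] XMp_nonneg[OF fX, of x] XMp_nonneg[OF fX, of 0]
              unfolding C_def J_def by (cases "f x"; cases "f 0"; auto)+
            then have "f r < ereal C" using that(2) XMp_between_less[OF fX] by metis
            then show ?thesis unfolding J_def by (auto intro: less_trans)
          qed
          have "t \<noteq> 0" using ft XMp_zero_finite[OF fX] by auto
          then consider "0 < t" | "t < 0" by linarith
          then show ?thesis
          proof cases
            case 1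
            then have st: "0 < s * t" "s * t < t" using s by auto
            have Jsub: "J \<subseteq> {..s * t}"
            proof
              fix x assume "x \<in> J"
              then have "\<not> s * t < x" using Jconv[of x "s * t"] s(3) \<open>0 < s * t\<close> by blast
              then show "x \<in> {..s * t}" by simp
            qed
            from w(5)[OF st(2) Jsub] obtain d where d: "d > 0"
              "\<And>c. eventually (\<lambda>k. \<forall>s. \<bar>s - t\<bar> < d \<longrightarrow> c < w k * exp (s * y k)) sequentially"
              by blast
            \<comment> \<open>The instance \<open>2 * c\<close> compensates for the factor 1/2 in
              \<open>g_w\<close>.\<close>
            have "eventually (\<lambda>k. \<forall>s. \<bar>s - t\<bar> < d \<longrightarrow> ereal c < ereal (g k s)) sequentially"
              using d(2)[of "2 * c"]
            proof eventually_elim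
              case (elim k)
              show ?case
              proof (intro allI impI)
                fix s assume "\<bar>s - t\<bar> < d"
                then have "2 * c < w k * exp (s * y k)" using elim by blast
                then show "ereal c < ereal (g k s)" using g_w[of k s] by simp
              qed
            qed
            then show ?thesis using d by blast
          next
            case 2
            then have st: "s * t < 0" "- (s * t) < - t" using s by (auto simp: mult_less_0_iff)
            have Jsub: "uminus ` J \<subseteq> {..- (s * t)}"
            proof
              fix r assume "r \<in> uminus ` J"
              then obtain x where x: "x \<in> J" "r = - x" by blast
              then have "\<not> x < s * t" using Jconv[of x "s * t"] s(3) \<open>s * t < 0\<close> by blast
              then show "r \<in> {..- (s * t)}" using x by simp
            qed
            from v(5)[OF st(2) Jsub] obtain d where d: "d > 0"
              "\<And>c. eventually (\<lambda>k. \<forall>s. \<bar>s - - t\<bar> < d \<longrightarrow> c < v k * exp (s * z k)) sequentially"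
              by blast
            have "eventually (\<lambda>k. \<forall>s. \<bar>s - t\<bar> < d \<longrightarrow> ereal c < ereal (g k s)) sequentially"
              using d(2)[of c]
            proof eventually_elim
              case (elim k)
              show ?case
              proof (intro allI impI)
                fix s assume "\<bar>s - t\<bar> < d"
                then have "\<bar>- s - - t\<bar> < d" by simp
                then have "c < v k * exp (- s * z k)" using elim by blast
                then show "ereal c < ereal (g k s)" using g_v[of k s] by simp
              qed
            qed
            then show ?thesis using d by blast
          qed
        qed
      qed
    qed
  qed
  note lim = this
  show ?thesis
    unfolding in_closure_of
  proof (intro conjI allI impI)
    fix T assume "f \<in> T \<and> openin AW T"
    then have "eventually (\<lambda>k. (\<lambda>t. ereal (g k t)) \<in> T) sequentially"
      by (intro limitinD[OF lim]) auto
    from eventually_happens'[OF sequentially_bot this] obtain k where "(\<lambda>t. ereal (g k t)) \<in> T" ..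
    with g show "\<exists>h. h \<in> XB \<and> h \<in> T" by (intro exI[of _ "\<lambda>t. ereal (g k t)"] conjI)
  qed (use fX in simp)
qed

theorem XM_eq_closure: "XM = (AW closure_of XB) \<inter> {f. f 0 = 1}"
  using XM_subset_closure_XB closure_XB_subset_XM XM_zero by auto


subsection \<open>Convex neighbourhoods\<close>

text \<open>A strict upper bound at \<open>t\<close> becomes stable after moving to a nearby
  \<open>u\<close> inside the domain. If the domain is a single point, that point is 0, where all
  members of \<open>XM\<close> agree.\<close>

lemma XM_nbhd_less:
  assumes f: "f \<in> XM" and less: "f t < ereal c" and d: "d > 0"
  shows "\<exists>u e U. \<bar>u - t\<bar> < d \<and> e > 0 \<and> openin AW U \<and> f \<in> U \<and> (\<forall>g\<in>U \<inter> XM. g u < ereal (c - e))"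
proof (cases "\<exists>y. y \<noteq> t \<and> f y < \<infinity>")
  case False
  have fX: "f \<in> XMp" using f XM_subset_XMp by blast
  then have t: "t = 0" using False XMp_zero_finite[of f] by metis
  have "1 < c" using less XM_zero[OF f] t by (simp add: one_ereal_def)
  have "\<forall>g\<in>XMp \<inter> XM. g t < ereal (c - (c - 1) / 2)"
  proof
    fix g assume "g \<in> XMp \<inter> XM"
    then have "g t = ereal 1" using XM_zero[of g] t by (simp add: one_ereal_def)
    then show "g t < ereal (c - (c - 1) / 2)" using \<open>1 < c\<close> by (simp add: field_simps)
  qed
  then show ?thesis
    using d \<open>1 < c\<close> fX openin_topspace[of AW] by (intro exI[of _ t] exI[of _ "(c - 1) / 2"] exI[of _ XMp]) auto
next
  case True
  have fX: "f \<in> XMp" using f XM_subset_XMp by blast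
  from True obtain y where y: "y \<noteq> t" "f y < \<infinity>" by blast
  obtain c' where c': "f t < ereal c'" "ereal c' < ereal c" using ereal_dense2[OF less] by blast
  have 1: "eventually (\<lambda>s. f ((1 - s) * t + s * y) < ereal c') (at_right 0)"
    using order_tendstoD(2)[OF XMp_tendsto_at_right[OF fX y(2), of t] c'(1)] .
  have 2: "eventually (\<lambda>s. s \<in> {0<..<d / \<bar>y - t\<bar>}) (at_right 0)"
    by (rule eventually_at_right_real) (use y d in simp)
  obtain s where s: "f ((1 - s) * t + s * y) < ereal c'" "0 < s" "s < d / \<bar>y - t\<bar>"
    using eventually_happens'[OF trivial_limit_at_right_real eventually_conj[OF 1 2]] by auto
  define z where "z = (1 - s) * t + s * y"
  \<comment> \<open>Both \<open>t\<close> and \<open>z\<close> have values below \<open>c'\<close>,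
    so their midpoint is protected from both sides.\<close>
  define u where "u = (t + z) / 2"
  have zt: "z - t = s * (y - t)" by (simp add: z_def algebra_simps)
  have "z \<noteq> t" using zt y s by auto
  then have between: "t < u \<and> u < z \<or> z < u \<and> u < t" by (auto simp: u_def)
  have "\<bar>z - t\<bar> = s * \<bar>y - t\<bar>" using s(2) by (simp add: zt abs_mult)
  also have "\<dots> < d" using s(3) y by (simp add: field_simps)
  finally have "\<bar>z - t\<bar> < d" .
  then have ud: "\<bar>u - t\<bar> < d" by (simp add: u_def field_simps)
  have "\<exists>U. openin AW U \<and> f \<in> U \<and> (\<forall>g\<in>U. g u < ereal c')"
    using AW_nbhd_less_between[OF fX c'(1) s(1)[folded z_def] between] by metis
  then obtain U where "openin AW U" "f \<in> U" "\<forall>g\<in>U. g u < ereal c'" by blast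
  then show ?thesis
    using ud c' by (intro exI[of _ u] exI[of _ "c - c'"] exI[of _ U]) auto
qed

text \<open>The sets \<open>{g. g \<theta> < c}\<close> and \<open>{g. e < g t}\<close> are convex, whereas the sets
  \<open>{g. epi_dist g p < r}\<close> are not. If \<open>f\<close> is finite only at \<open>0\<close>, then \<open>{g. g 0 < c}\<close> still is a
  neighbourhood of \<open>f\<close>, but only because all of \<open>XM\<close> takes the value \<open>1\<close> at \<open>0\<close>.\<close>

lemma XM_convex_nbhd:
  assumes f: "f \<in> XM" and G: "openin AW_M G" "f \<in> G"
  obtains F H :: "(real \<times> real) set" and E e U where
    "finite F" "\<And>t b. (t, b) \<in> H \<Longrightarrow> b \<le> E" "e > 0" "openin AW_M U" "f \<in> U"
    "\<And>g t c. g \<in> U \<Longrightarrow> (t, c) \<in> F \<Longrightarrow> g t \<le> ereal (c - e)"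
    "\<And>g t b. g \<in> U \<Longrightarrow> (t, b) \<in> H \<Longrightarrow> ereal (b + e) \<le> g t"
    "\<And>g. g \<in> XM \<Longrightarrow> \<forall>(t, c)\<in>F. g t < ereal c \<Longrightarrow> \<forall>(t, b)\<in>H. ereal b < g t \<Longrightarrow> g \<in> G"
proof -
  have fX: "f \<in> XMp" using f XM_subset_XMp by blast
  have less_iff: "epi_dist h p < r \<longleftrightarrow> (\<exists>t. \<bar>t - fst p\<bar> < r \<and> h t < ereal (snd p + r))" if "h \<in> XMp" for h p r
    using epi_dist_less_iff[of h] XMp_zero_finite[OF that] by blast
  obtain G0 where G0: "openin AW G0" "G = G0 \<inter> XM"
    using G(1) by (auto simp: AW_M_def openin_subtopology)
  obtain A r where A: "finite A" "r > 0" "{g \<in> XMp. \<forall>p\<in>A. \<bar>epi_dist g p - epi_dist f p\<bar> < r} \<subseteq> G0"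
    using openin_AW_finite_nbhd[OF G0(1)] G(2) G0(2) by blast
  \<comment> \<open>Top edge of the box of radius \<open>epi_dist f p + r\<close>, which the
    epigraphs must meet.\<close>
  let ?c = "\<lambda>p. snd p + (epi_dist f p + r)"
  have "\<exists>u e U. \<bar>u - fst p\<bar> < epi_dist f p + r \<and> e > 0 \<and> openin AW U \<and> f \<in> U \<and>
      (\<forall>g\<in>U \<inter> XM. g u < ereal (?c p - e))" for p
  proof -
    have "epi_dist f p < epi_dist f p + r" using A by simp
    then obtain t where t: "\<bar>t - fst p\<bar> < epi_dist f p + r" "f t < ereal (?c p)"
      unfolding less_iff[OF fX] by blast
    define d where "d = epi_dist f p + r - \<bar>t - fst p\<bar>"
    have "d > 0" using t by (simp add: d_def)
    from XM_nbhd_less[OF f t(2) this] obtain u e U where U: "\<bar>u - t\<bar> < d" "e > 0"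
      "openin AW U" "f \<in> U" "\<forall>g\<in>U \<inter> XM. g u < ereal (?c p - e)" by blast
    have "\<bar>u - fst p\<bar> < epi_dist f p + r" using U(1) unfolding d_def by arith
    then show ?thesis using U by blast
  qed
  then have "\<exists>u e U. \<forall>p. \<bar>u p - fst p\<bar> < epi_dist f p + r \<and> e p > 0 \<and> openin AW (U p) \<and> f \<in> U p \<and>
      (\<forall>g\<in>U p \<inter> XM. g (u p) < ereal (?c p - e p))"
    by metis
  then obtain u e U where U: "\<And>p. \<bar>u p - fst p\<bar> < epi_dist f p + r" "\<And>p. e p > (0::real)"
    "\<And>p. openin AW (U p)" "\<And>p. f \<in> U p" "\<And>p g. g \<in> U p \<Longrightarrow> g \<in> XM \<Longrightarrow> g (u p) < ereal (?c p - e p)"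
    by blast
  define e' where "e' = Min (insert (r / 4) (e ` A))"
  have e': "e' > 0" "e' \<le> r / 4" "\<And>p. p \<in> A \<Longrightarrow> e' \<le> e p"
  proof -
    have fin: "finite (insert (r / 4) (e ` A))" using A by simp
    show "e' > 0" unfolding e'_def using A U(2) by (subst Min_gr_iff) auto
    show "e' \<le> r / 4" "\<And>p. p \<in> A \<Longrightarrow> e' \<le> e p" unfolding e'_def by (rule Min_le[OF fin]; simp)+
  qed
  \<comment> \<open>Top edge of the box of radius \<open>epi_dist f p - r / 2\<close>, which the
    epigraphs must miss. Members of \<open>W\<close> miss even the open box of radius
    \<open>epi_dist f p - r / 4\<close>, and the difference r/4 pays for the slack
    \<open>e'\<close>.\<close>
  let ?b = "\<lambda>p. snd p + (epi_dist f p - r / 2)"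
  define F where "F = (\<lambda>p. (u p, ?c p)) ` A"
  define H where "H = {(t, ?b p) | t p. p \<in> A \<and> \<bar>t - fst p\<bar> \<le> epi_dist f p - r / 2}"
  let ?V = "\<lambda>p. {g \<in> XMp. epi_dist f p - r / 4 < epi_dist g p}"
  define W where "W = (XMp \<inter> \<Inter> ((\<lambda>p. U p \<inter> ?V p) ` A)) \<inter> XM"
  have "openin AW (XMp \<inter> \<Inter> ((\<lambda>p. U p \<inter> ?V p) ` A))"
    using A(1) U(3) openin_topspace[of AW]
    by (cases "A = {}") (auto intro!: openin_Int openin_INT2 openin_AW_epi_dist_greater)
  then have W: "openin AW_M W" unfolding W_def by (rule openin_AW_M_Int)
  show ?thesis
  proof (rule that[of F H "Max (insert 0 (?b ` A))" e' W])
    show "finite F" using A by (simp add: F_def)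
    show "b \<le> Max (insert 0 (?b ` A))" if "(t, b) \<in> H" for t b
    proof (rule Max_ge)
      obtain p where "p \<in> A" "b = ?b p" using \<open>(t, b) \<in> H\<close> by (auto simp: H_def)
      then show "b \<in> insert 0 (?b ` A)" by blast
    qed (use A(1) in simp)
    show "e' > 0" by fact
    show "openin AW_M W" by fact
    show "f \<in> W" using f fX U(4) A(2) by (auto simp: W_def)
    show "g t \<le> ereal (c - e')" if g: "g \<in> W" and tc: "(t, c) \<in> F" for g t c
    proof -
      obtain p where p: "p \<in> A" "t = u p" "c = ?c p" using tc by (auto simp: F_def)
      have "g t < ereal (?c p - e p)" using U(5)[of g p] g p by (auto simp: W_def)
      also have "\<dots> \<le> ereal (c - e')" using e'(3)[OF p(1)] p by simp
      finally show ?thesis by simp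
    qed
    show "ereal (b + e') \<le> g t" if g: "g \<in> W" and tb: "(t, b) \<in> H" for g t b
    proof (rule ccontr)
      obtain p where p: "p \<in> A" "\<bar>t - fst p\<bar> \<le> epi_dist f p - r / 2" "b = ?b p" using tb by (auto simp: H_def)
      assume "\<not> ereal (b + e') \<le> g t"
      then have "g t < ereal (b + e')" by simp
      also have "\<dots> \<le> ereal (snd p + (epi_dist f p - r / 4))" using e'(2) p(3) by simp
      finally have "g t < ereal (snd p + (epi_dist f p - r / 4))" .
      moreover have "\<bar>t - fst p\<bar> < epi_dist f p - r / 4" using p(2) A(2) by simp
      moreover have gX: "g \<in> XMp" using g by (simp add: W_def)
      ultimately have "epi_dist g p < epi_dist f p - r / 4" unfolding less_iff[OF gX] by blast
      then show False using g p(1) by (auto simp: W_def)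
    qed
    show "g \<in> G" if g: "g \<in> XM" "\<forall>(t, c)\<in>F. g t < ereal c" "\<forall>(t, b)\<in>H. ereal b < g t" for g
    proof -
      have gX: "g \<in> XMp" using g(1) XM_subset_XMp by blast
      have "\<bar>epi_dist g p - epi_dist f p\<bar> < r" if p: "p \<in> A" for p
      proof -
        have "g (u p) < ereal (?c p)" using g(2) p by (auto simp: F_def)
        then have "epi_dist g p < epi_dist f p + r" unfolding less_iff[OF gX] using U(1) by blast
        moreover have "\<not> epi_dist g p < epi_dist f p - r / 2"
        proof
          assume "epi_dist g p < epi_dist f p - r / 2"
          then obtain t where t: "\<bar>t - fst p\<bar> < epi_dist f p - r / 2" "g t < ereal (?b p)"
            unfolding less_iff[OF gX] by blast
          then have "(t, ?b p) \<in> H" unfolding H_def using p by (intro CollectI exI[of _ t] exI[of _ p]) auto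
          then have "ereal (?b p) < g t" using g(3) by blast
          then show False using t(2) by (meson less_asym)
        qed
        ultimately show ?thesis using A(2) by (simp add: abs_less_iff)
      qed
      then have "g \<in> G0" using A(3) gX by blast
      then show ?thesis using G0(2) g(1) by simp
    qed
  qed
qed

subsection \<open>Compact sets of moment generating functions\<close>

lemma mgf_ge_tail:
  assumes \<nu>: "real_prob \<nu>"
  shows "ereal (exp (- (\<bar>t\<bar> * R)) * (1 - measure \<nu> {x. R < \<bar>x\<bar>})) \<le> mgf \<nu> t"
proof -
  interpret prob_space \<nu> using real_probD(1)[OF \<nu>] .
  have [measurable_cong]: "sets \<nu> = sets borel" using real_probD(2)[OF \<nu>] .
  have sp: "space \<nu> = UNIV" using real_probD(3)[OF \<nu>] .
  have "1 - prob {x. R < \<bar>x\<bar>} = prob (space \<nu> - {x. R < \<bar>x\<bar>})" by (subst prob_compl) auto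
  also have "space \<nu> - {x. R < \<bar>x\<bar>} = {x. \<bar>x\<bar> \<le> R}" using sp by auto
  finally have "ennreal (exp (- (\<bar>t\<bar> * R)) * (1 - prob {x. R < \<bar>x\<bar>})) =
      (\<integral>\<^sup>+ x. ennreal (exp (- (\<bar>t\<bar> * R))) * indicator {x. \<bar>x\<bar> \<le> R} x \<partial>\<nu>)"
    by (subst nn_integral_cmult) (auto simp: emeasure_eq_measure ennreal_mult)
  also have "\<dots> \<le> (\<integral>\<^sup>+ x. ennreal (exp (t * x)) \<partial>\<nu>)"
  proof (intro nn_integral_mono)
    fix x
    have "- (\<bar>t\<bar> * R) \<le> t * x" if "\<bar>x\<bar> \<le> R"
    proof -
      have "\<bar>t * x\<bar> \<le> \<bar>t\<bar> * R" using that by (simp add: abs_mult mult_left_mono)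
      then show ?thesis by arith
    qed
    then show "ennreal (exp (- (\<bar>t\<bar> * R))) * indicator {x. \<bar>x\<bar> \<le> R} x \<le> ennreal (exp (t * x))"
      by (auto intro!: ennreal_leI split: split_indicator)
  qed
  finally show ?thesis
    unfolding mgf_def less_eq_ennreal.rep_eq by (simp add: prob_le_1)
qed

text \<open>The tail condition is what Markov's inequality extracts from a bound \<open>K\<close> on
  the integral of u(|x|). For \<open>u\<close> tending to infinity it is uniform tightness.\<close>

definition tail_bounded :: "(real \<Rightarrow> real) \<Rightarrow> real \<Rightarrow> (real \<Rightarrow> ereal) set" where
  "tail_bounded u K = {mgf \<nu> | \<nu>. real_prob \<nu> \<and> compact_supp \<nu> \<and>
     (\<forall>R. measure \<nu> {x. R < \<bar>x\<bar>} * u R \<le> K)}"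

text \<open>A mass of at least 1 - e/4 in a fixed [-R, R] keeps every transform of the family above
  1 - e/2 on a neighbourhood of 0, so no limit can drop to 1 - e at 0.\<close>

lemma tail_bounded_closure_zero:
  assumes u: "filterlim u at_top at_top" and f: "f \<in> AW closure_of tail_bounded u K" and le: "f 0 \<le> 1"
  shows "f 0 = 1"
proof (rule ccontr)
  assume "f 0 \<noteq> 1"
  then have "f 0 < 1" using le by simp
  then obtain c where c: "f 0 < ereal c" "ereal c < 1" using ereal_dense2 by blast
  have fX: "f \<in> XMp" using f by (simp add: in_closure_of)
  define e where "e = 1 - c"
  have e: "e > 0" "f 0 \<le> ereal (1 - e)" using c by (auto simp: e_def one_ereal_def less_imp_le)
  have "0 < 1 - e" using le_less_trans[OF XMp_nonneg[OF fX] c(1)] by (simp add: e_def)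
  then have e1: "e < 1" by simp
  have "eventually (\<lambda>R. 4 * (\<bar>K\<bar> + 1) / e < u R) at_top" using u unfolding filterlim_at_top_dense by blast
  then obtain R where R: "4 * (\<bar>K\<bar> + 1) / e < u R" "R \<ge> 1"
    using eventually_happens'[OF _ eventually_conj[OF _ eventually_ge_at_top[of "1::real"]]] by auto
  have uR: "u R > 0" using R(1) e by (smt (verit) divide_pos_pos)
  \<comment> \<open>With this choice |t| < d gives |t| R <= e/4, and R >= 1 gives d <= e/4, so that
    1 - e + d < (1 - e/4)^2.\<close>
  define d where "d = e / (4 * R)"
  have d: "d > 0" "d * R = e / 4" "d \<le> e / 4" using R e by (auto simp: d_def field_simps)
  have "epi_dist f (0, 1 - e) < d" using e d by (simp add: epi_dist_eq_0_iff[OF fX, THEN iffD2])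
  then have "f \<in> {g \<in> XMp. epi_dist g (0, 1 - e) < d}" using fX by simp
  then obtain g where g: "g \<in> tail_bounded u K" "g \<in> XMp" "epi_dist g (0, 1 - e) < d"
    using f openin_AW_epi_dist_less[of "(0, 1 - e)" d] unfolding in_closure_of
    by (metis (no_types, lifting) mem_Collect_eq)
  obtain t where t: "\<bar>t\<bar> < d" "g t < ereal (1 - e + d)"
    using g(3) unfolding epi_dist_less_iff[of g, OF XMp_zero_finite[OF g(2)]] by auto
  obtain \<nu> where \<nu>: "g = mgf \<nu>" "real_prob \<nu>" "measure \<nu> {x. R < \<bar>x\<bar>} * u R \<le> K"
    using g(1) by (auto simp: tail_bounded_def)
  have "measure \<nu> {x. R < \<bar>x\<bar>} \<le> K / u R" using \<nu>(3) uR by (simp add: field_simps)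
  also have "K / u R \<le> e / 4"
  proof -
    have "4 * (\<bar>K\<bar> + 1) < e * u R" using R(1) e by (simp add: field_simps)
    moreover have "K \<le> \<bar>K\<bar>" by simp
    ultimately have "4 * K \<le> e * u R" by (smt (verit))
    then show ?thesis using uR by (simp add: field_simps)
  qed
  finally have q: "1 - e / 4 \<le> 1 - measure \<nu> {x. R < \<bar>x\<bar>}" by simp
  have "\<bar>t\<bar> * R \<le> d * R" using t R by (intro mult_right_mono) auto
  then have "1 - e / 4 \<le> exp (- (\<bar>t\<bar> * R))" using exp_ge_add_one_self[of "- (\<bar>t\<bar> * R)"] d by simp
  then have "(1 - e / 4) * (1 - e / 4) \<le> exp (- (\<bar>t\<bar> * R)) * (1 - measure \<nu> {x. R < \<bar>x\<bar>})"
    using q e1 by (intro mult_mono) auto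
  moreover have "1 - e + d < (1 - e / 4) * (1 - e / 4)"
  proof -
    have "(1 - e / 4) * (1 - e / 4) = 1 - e / 2 + (e / 4)\<^sup>2" by (simp add: power2_eq_square algebra_simps)
    moreover have "0 \<le> (e / 4)\<^sup>2" by simp
    ultimately show ?thesis using d e by linarith
  qed
  ultimately have "ereal (1 - e + d) \<le> mgf \<nu> t"
    using mgf_ge_tail[OF \<nu>(2), of t R] by (auto intro: order_trans[rotated])
  then show False using t(2) \<nu>(1) by simp
qed

text \<open>The closure is compact in \<open>XMp\<close> and retains the value 1 at 0, so
  \<open>XM_eq_closure\<close> places it inside \<open>XM\<close>.\<close>

lemma compactin_tail_bounded:
  fixes K :: real
  assumes u: "filterlim u at_top at_top"
  defines "C \<equiv> AW closure_of tail_bounded u K"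
  shows "compactin AW_M C" "closedin AW_M C" "tail_bounded u K \<subseteq> C"
proof -
  have sub: "tail_bounded u K \<subseteq> XB" by (auto simp: tail_bounded_def XB_def)
  have "tail_bounded u K \<subseteq> {f \<in> XMp. f 0 \<le> 1}"
    using sub XB_subset_XM XM_subset_XMp XM_zero by fastforce
  then have C1: "C \<subseteq> {f \<in> XMp. f 0 \<le> 1}"
    unfolding C_def by (intro closure_of_minimal closedin_AW_le_one)
  have "f \<in> XM" if "f \<in> C" for f
  proof -
    have "f 0 = 1" using tail_bounded_closure_zero[OF u, of f K] that C1 by (auto simp: C_def)
    moreover have "f \<in> AW closure_of XB" using that closure_of_mono[OF sub] by (auto simp: C_def)
    ultimately show ?thesis using XM_eq_closure by blast
  qed
  then have C2: "C \<subseteq> XM" by blast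
  have C3: "closedin AW C" by (simp add: C_def)
  have "compactin AW C" by (rule closed_compactin[OF compactin_AW_le_one C1 C3])
  then show "compactin AW_M C" using C2 by (simp add: AW_M_def compactin_subtopology)
  show "closedin AW_M C" using C2 C3 by (simp add: AW_M_def closedin_closed_subtopology closedin_subset_topspace)
  show "tail_bounded u K \<subseteq> C"
    unfolding C_def using sub XB_subset_XM XM_subset_XMp by (intro closure_of_subset) auto
qed

subsection \<open>Empirical moment generating functions\<close>

definition emp_mgf :: "nat \<Rightarrow> (nat \<Rightarrow> real) \<Rightarrow> real \<Rightarrow> real" where
  "emp_mgf n x t = (\<Sum>i<n. exp (t * x i)) / real n"

lemma Mn_emp_mgf: "Mn X n \<omega> = (\<lambda>t. ereal (emp_mgf n (\<lambda>i. X i \<omega>) t))"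
  by (simp add: Mn_def emp_mgf_def fun_eq_iff)

lemma emp_mgf_pos: "0 < n \<Longrightarrow> 0 < emp_mgf n x t"
  unfolding emp_mgf_def by (intro divide_pos_pos sum_pos) auto

text \<open>The law is the empirical measure of the first \<open>n\<close> entries, so tail masses
  are relative frequencies.\<close>

lemma emp_mgf_eq_mgf:
  assumes n: "0 < n"
  obtains \<nu> where "real_prob \<nu>" "compact_supp \<nu>" "(\<lambda>t. ereal (emp_mgf n x t)) = mgf \<nu>"
    "\<And>R. measure \<nu> {y. R < \<bar>y\<bar>} = real (card {i. i < n \<and> R < \<bar>x i\<bar>}) / real n"
proof -
  let ?p = "pmf_of_set {..<n}"
  have ne: "{..<n} \<noteq> {}" "finite {..<n}" using n by auto
  define \<nu> where "\<nu> = distr (measure_pmf ?p) borel x"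
  have \<nu>: "real_prob \<nu>" unfolding \<nu>_def real_prob_def
    by (auto intro!: prob_space.prob_space_distr prob_space_measure_pmf)
  have AE: "AE y in \<nu>. y \<in> x ` {..<n}"
    unfolding \<nu>_def by (subst AE_distr_iff) (auto simp: AE_measure_pmf_iff set_pmf_of_set[OF ne] finite_imp_closed)
  have "mgf \<nu> \<in> XB" by (rule XB_I[OF \<nu> _ AE]) (simp add: finite_imp_compact)
  interpret prob_space \<nu> using real_probD(1)[OF \<nu>] .
  have K: "compact (x ` {..<n})" "x ` {..<n} \<in> sets \<nu>" by (auto simp: \<nu>_def finite_imp_compact finite_imp_closed)
  then have "compact_supp \<nu>"
    unfolding compact_supp_def using AE by (intro exI[of _ "x ` {..<n}"]) (simp add: AE_in_set_eq_1 emeasure_eq_measure)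
  moreover have "(\<lambda>t. ereal (emp_mgf n x t)) = mgf \<nu>"
  proof
    fix t
    have "(\<integral>\<^sup>+ y. ennreal (exp (t * y)) \<partial>\<nu>) = (\<Sum>i<n. ennreal (exp (t * x i))) / of_nat n"
      unfolding \<nu>_def by (subst nn_integral_distr) (auto simp: nn_integral_pmf_of_set[OF ne])
    also have "\<dots> = ennreal (emp_mgf n x t)"
      unfolding emp_mgf_def ennreal_of_nat_eq_real_of_nat using n
      by (subst sum_ennreal) (auto intro!: divide_ennreal sum_nonneg)
    finally show "ereal (emp_mgf n x t) = mgf \<nu> t"
      unfolding mgf_def using emp_mgf_pos[OF n, of x t] by simp
  qed
  moreover have "measure \<nu> {y. R < \<bar>y\<bar>} = real (card {i. i < n \<and> R < \<bar>x i\<bar>}) / real n" for R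
  proof -
    have "measure \<nu> {y. R < \<bar>y\<bar>} = measure (measure_pmf ?p) {i. R < \<bar>x i\<bar>}"
      unfolding \<nu>_def by (subst measure_distr) (auto simp: vimage_def)
    also have "\<dots> = real (card ({..<n} \<inter> {i. R < \<bar>x i\<bar>})) / real (card {..<n})"
      by (rule measure_pmf_of_set[OF ne])
    also have "{..<n} \<inter> {i. R < \<bar>x i\<bar>} = {i. i < n \<and> R < \<bar>x i\<bar>}" by auto
    finally show ?thesis by simp
  qed
  ultimately show ?thesis using that \<nu> by blast
qed

lemma emp_mgf_in_XM: "0 < n \<Longrightarrow> (\<lambda>t. ereal (emp_mgf n x t)) \<in> XM"
  by (metis emp_mgf_eq_mgf mgf_in_XM)

text \<open>Markov's inequality for the empirical measure.\<close>

lemma emp_mgf_tail_bounded: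
  assumes n: "0 < n" and u: "\<And>r. 0 \<le> u r" "mono u" and le: "(\<Sum>i<n. u \<bar>x i\<bar>) \<le> real n * K"
  shows "(\<lambda>t. ereal (emp_mgf n x t)) \<in> tail_bounded u K"
proof -
  obtain \<nu> where \<nu>: "real_prob \<nu>" "compact_supp \<nu>" "(\<lambda>t. ereal (emp_mgf n x t)) = mgf \<nu>"
    "\<And>R. measure \<nu> {y. R < \<bar>y\<bar>} = real (card {i. i < n \<and> R < \<bar>x i\<bar>}) / real n"
    using emp_mgf_eq_mgf[OF n] by metis
  have "measure \<nu> {y. R < \<bar>y\<bar>} * u R \<le> K" for R
  proof -
    have "real (card {i. i < n \<and> R < \<bar>x i\<bar>}) * u R = (\<Sum>i\<in>{i. i < n \<and> R < \<bar>x i\<bar>}. u R)" by simp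
    also have "\<dots> \<le> (\<Sum>i\<in>{i. i < n \<and> R < \<bar>x i\<bar>}. u \<bar>x i\<bar>)" by (intro sum_mono monoD[OF u(2)]) auto
    also have "\<dots> \<le> (\<Sum>i<n. u \<bar>x i\<bar>)" by (intro sum_mono2) (auto simp: u)
    finally show ?thesis using le n unfolding \<nu>(4) by (simp add: field_simps)
  qed
  then show ?thesis using \<nu> by (auto simp: tail_bounded_def)
qed

lemma emp_mgf_split:
  assumes "0 < n + m"
  shows "emp_mgf (n + m) x t =
    (real n * emp_mgf n x t + real m * emp_mgf m (\<lambda>i. x (i + n)) t) / real (n + m)"
proof -
  have "(\<Sum>i<n + m. exp (t * x i)) = (\<Sum>i<n. exp (t * x i)) + (\<Sum>i<m. exp (t * x (i + n)))"
    by (induction m) (auto simp: add.commute)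
  then show ?thesis unfolding emp_mgf_def by (cases "n = 0"; cases "m = 0") auto
qed

text \<open>This makes membership of \<open>Mn\<close> in an open set an event: openness in the
  product topology of sequences implies Borel measurability.\<close>

lemma open_emp_mgf_vimage:
  assumes n: "0 < n" and G: "openin AW_M G"
  shows "open {x. (\<lambda>t. ereal (emp_mgf n x t)) \<in> G}"
proof (subst open_subopen, intro ballI)
  fix x assume x: "x \<in> {x. (\<lambda>t. ereal (emp_mgf n x t)) \<in> G}"
  obtain U where U: "openin AW U" "G = U \<inter> XM"
    using G by (auto simp: AW_M_def openin_subtopology)
  have XMp: "(\<lambda>t. ereal (emp_mgf n y t)) \<in> XMp" for y using emp_mgf_in_XM[OF n] XM_subset_XMp by blast
  have coord: "continuous_on UNIV (\<lambda>y::nat \<Rightarrow> real. y i)" for i by (rule continuous_on_product_coordinates)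
  have coord': "continuous_on UNIV (\<lambda>z::(nat \<Rightarrow> real) \<times> real. fst z i)" for i
    using continuous_on_compose2[OF coord continuous_on_fst[OF continuous_on_id]] by auto
  have "limitin AW (\<lambda>y t. ereal (emp_mgf n y t)) (\<lambda>t. ereal (emp_mgf n x t)) (nhds x)"
  proof (rule limitin_AW_I[OF XMp])
    show "((\<lambda>y. epi_dist (\<lambda>t. ereal (emp_mgf n y t)) p) \<longlongrightarrow> epi_dist (\<lambda>t. ereal (emp_mgf n x t)) p) (nhds x)" for p
    proof (rule epi_dist_tendsto)
      fix t c
      show "eventually (\<lambda>y. ereal (emp_mgf n y t) < ereal c) (nhds x)" if "ereal (emp_mgf n x t) < ereal c"
      proof -
        have "open {y. emp_mgf n y t < c}"
          unfolding emp_mgf_def divide_inverse by (intro open_Collect_less continuous_intros coord)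
        then show ?thesis using that by (auto simp: eventually_nhds)
      qed
      show "\<exists>d>0. eventually (\<lambda>y. \<forall>s. \<bar>s - t\<bar> < d \<longrightarrow> ereal c < ereal (emp_mgf n y s)) (nhds x)"
        if "ereal c < ereal (emp_mgf n x t)"
      proof -
        \<comment> \<open>Joint continuity in the sequence and the exponent yields a product
          neighbourhood, hence a lower bound uniform in the exponent.\<close>
        have "open {z. c < emp_mgf n (fst z) (snd z)}"
          unfolding emp_mgf_def divide_inverse by (intro open_Collect_less continuous_intros coord')
        moreover have "(x, t) \<in> {z. c < emp_mgf n (fst z) (snd z)}" using that by simp
        ultimately obtain A B where AB: "open A" "open B" "(x, t) \<in> A \<times> B"
          "A \<times> B \<subseteq> {z. c < emp_mgf n (fst z) (snd z)}" by (rule open_prod_elim)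
        obtain d where d: "d > 0" "\<And>s. dist s t < d \<Longrightarrow> s \<in> B" using AB unfolding open_dist by auto
        have "\<forall>s. \<bar>s - t\<bar> < d \<longrightarrow> ereal c < ereal (emp_mgf n y s)" if "y \<in> A" for y
          using that d(2) AB(4) by (force simp: dist_real_def)
        then have "eventually (\<lambda>y. \<forall>s. \<bar>s - t\<bar> < d \<longrightarrow> ereal c < ereal (emp_mgf n y s)) (nhds x)"
          using AB unfolding eventually_nhds by (intro exI[of _ A]) auto
        then show ?thesis using d by blast
      qed
    qed auto
  qed (use XMp in simp)
  then have "eventually (\<lambda>y. (\<lambda>t. ereal (emp_mgf n y t)) \<in> U) (nhds x)"
    by (rule limitinD) (use U x in auto)
  then show "\<exists>T. open T \<and> x \<in> T \<and> T \<subseteq> {x. (\<lambda>t. ereal (emp_mgf n x t)) \<in> G}"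
    unfolding eventually_nhds using U emp_mgf_in_XM[OF n] by fastforce
qed


subsection \<open>Exponential rates\<close>

lemma eln_mono: "p \<le> q \<Longrightarrow> eln p \<le> eln q"
  by (auto simp: eln_def)

lemma limsup_eln_less_imp:
  assumes "limsup (\<lambda>n. eln (p n) / ereal (real n)) < ereal c"
  shows "eventually (\<lambda>n. p n \<le> exp (real n * c)) sequentially"
proof -
  have "eventually (\<lambda>n. eln (p n) / ereal (real n) < ereal c) sequentially"
    by (rule Limsup_lessD[OF assms])
  with eventually_gt_at_top[of 0] show ?thesis
  proof eventually_elim
    case (elim n)
    show ?case
    proof (cases "0 < p n")
      case True
      then have "ln (p n) / real n < c" using elim by (simp add: eln_def)
      then have "ln (p n) \<le> real n * c" using elim(1) by (simp add: field_simps)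
      then have "exp (ln (p n)) \<le> exp (real n * c)" by simp
      then show ?thesis using True by simp
    next
      case False
      then show ?thesis using exp_gt_zero[of "real n * c"] by linarith
    qed
  qed
qed

lemma limsup_eln_leI:
  assumes K: "eventually (\<lambda>n. p n \<le> K * exp (real n * c)) sequentially"
  shows "limsup (\<lambda>n. eln (p n) / ereal (real n)) \<le> ereal c"
proof -
  \<comment> \<open>Enlarging \<open>K\<close> to at least 1 keeps its logarithm defined; divided by
    \<open>n\<close> it vanishes in the limit.\<close>
  define L where "L = max K 1"
  have L: "0 < L" by (simp add: L_def)
  have "eventually (\<lambda>n. eln (p n) / ereal (real n) \<le> ereal (ln L / real n + c)) sequentially"
    using K eventually_gt_at_top[of 0]
  proof eventually_elim
    case (elim n)
    have "K * exp (real n * c) \<le> L * exp (real n * c)" by (intro mult_right_mono) (auto simp: L_def)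
    then have "eln (p n) \<le> eln (L * exp (real n * c))" using elim by (intro eln_mono) linarith
    also have "\<dots> = ereal (ln L + real n * c)" using L by (simp add: eln_def ln_mult)
    finally have "eln (p n) / ereal (real n) \<le> ereal (ln L + real n * c) / ereal (real n)"
      using elim by (intro ereal_divide_right_mono) auto
    also have "\<dots> = ereal (ln L / real n + c)" using elim by (simp add: field_simps)
    finally show ?case .
  qed
  then have "limsup (\<lambda>n. eln (p n) / ereal (real n)) \<le> limsup (\<lambda>n. ereal (ln L / real n + c))"
    by (rule Limsup_mono)
  also have "(\<lambda>n. ln L / real n + c) \<longlonglongrightarrow> 0 + c"
    by (intro tendsto_add tendsto_const tendsto_divide_0[OF tendsto_const] filterlim_real_at_infinity_sequentially)
  then have "(\<lambda>n. ereal (ln L / real n + c)) \<longlonglongrightarrow> ereal c" by simp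
  then have "limsup (\<lambda>n. ereal (ln L / real n + c)) = ereal c"
    by (rule lim_imp_Limsup[OF sequentially_bot])
  finally show ?thesis .
qed

subsection \<open>Block argument\<close>

text \<open>Each condition is a one-sided bound on a mean, hence preserved when blocks are
  concatenated. The margin \<open>e\<close> is spent later on an incomplete last block.\<close>

definition emp_box :: "(real \<times> real) set \<Rightarrow> (real \<times> real) set \<Rightarrow> real \<Rightarrow> nat \<Rightarrow> (nat \<Rightarrow> real) set" where
  "emp_box F H e n = {x. (\<forall>(t, c)\<in>F. emp_mgf n x t \<le> c - e) \<and> (\<forall>(t, b)\<in>H. b + e \<le> emp_mgf n x t)}"

text \<open>\<open>H\<close> may be uncountable, so measurability is obtained from
  closedness.\<close>

lemma emp_box_measurable: "emp_box F H e n \<in> sets borel"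
proof -
  have coord: "continuous_on UNIV (\<lambda>y::nat \<Rightarrow> real. y i)" for i by (rule continuous_on_product_coordinates)
  have emp: "continuous_on UNIV (\<lambda>y. emp_mgf n y t)" for t
    unfolding emp_mgf_def divide_inverse by (intro continuous_intros coord)
  have "emp_box F H e n = (\<Inter>q\<in>F. {x. emp_mgf n x (fst q) \<le> snd q - e}) \<inter> (\<Inter>q\<in>H. {x. snd q + e \<le> emp_mgf n x (fst q)})"
    by (force simp: emp_box_def)
  also have "closed \<dots>"
    by (intro closed_Int closed_INT ballI closed_Collect_le continuous_intros emp)
  finally show ?thesis by (rule borel_closed)
qed

lemma emp_mgf_cong: "(\<And>i. i < n \<Longrightarrow> x i = y i) \<Longrightarrow> emp_mgf n x = emp_mgf n y"
  by (simp add: emp_mgf_def fun_eq_iff)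

lemma emp_box_cong:
  assumes "\<And>i. i < n \<Longrightarrow> x i = y i" shows "x \<in> emp_box F H e n \<longleftrightarrow> y \<in> emp_box F H e n"
  using emp_mgf_cong[of n x y] assms by (simp add: emp_box_def)

lemma emp_box_add:
  assumes "x \<in> emp_box F H e n" "(\<lambda>i. x (i + n)) \<in> emp_box F H e m" "0 < n + m"
  shows "x \<in> emp_box F H e (n + m)"
proof -
  have up: "(real n * a + real m * b) / real (n + m) \<le> c" if "a \<le> c" "b \<le> c" for a b c
  proof -
    have "real n * a + real m * b \<le> real n * c + real m * c" using that by (intro add_mono mult_left_mono) auto
    moreover have "0 < real (n + m)" using assms(3) unfolding of_nat_0_less_iff .
    ultimately show ?thesis by (simp add: pos_divide_le_eq algebra_simps)
  qed
  have lo: "c \<le> (real n * a + real m * b) / real (n + m)" if "c \<le> a" "c \<le> b" for a b c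
  proof -
    have "real n * c + real m * c \<le> real n * a + real m * b" using that by (intro add_mono mult_left_mono) auto
    moreover have "0 < real (n + m)" using assms(3) unfolding of_nat_0_less_iff .
    ultimately show ?thesis by (simp add: pos_le_divide_eq algebra_simps)
  qed
  show ?thesis using assms(1,2) unfolding emp_box_def emp_mgf_split[OF assms(3)] mem_Collect_eq case_prod_beta
    by (intro conjI ballI up lo) blast+
qed

text \<open>Canonical model of the i.i.d. sequence on the product space \<open>S\<close>, where
  gluing sequences expresses independence of consecutive blocks.\<close>

locale real_sequence_space = sequence_space M for M :: "real measure" +
  assumes sets_M: "sets M = sets borel"
begin

lemma sets_S: "sets S = sets borel"
proof -
  have "sets S = sets (\<Pi>\<^sub>M i\<in>UNIV::nat set. borel :: real measure)"
    by (intro sets_PiM_cong refl sets_M)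
  then show ?thesis by (simp add: sets_PiM_equal_borel)
qed

lemma space_S: "space S = UNIV"
  using sets_eq_imp_space_eq[OF sets_S] by simp

text \<open>Taking the first \<open>n\<close> entries from one sequence and the rest from an
  independent one reproduces the law \<open>S\<close>, and the preimage of the event is a
  rectangle.\<close>

lemma measure_shift:
  assumes A: "A \<in> sets borel" and B: "B \<in> sets borel"
    and dep: "\<And>x y. (\<And>i. i < n \<Longrightarrow> x i = y i) \<Longrightarrow> x \<in> A \<longleftrightarrow> y \<in> A"
  shows "{x \<in> A. (\<lambda>i. x (i + n)) \<in> B} \<in> sets borel"
    "measure S {x \<in> A. (\<lambda>i. x (i + n)) \<in> B} = measure S A * measure S B"
proof -
  have "(\<lambda>x i. x (i + n)) \<in> borel_measurable (borel :: (nat \<Rightarrow> real) measure)"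
    by (intro borel_measurable_continuous_onI continuous_on_coordinatewise_then_product continuous_on_product_coordinates)
  then have "A \<inter> ((\<lambda>x i. x (i + n)) -` B \<inter> space borel) \<in> sets borel"
    using A B by (intro sets.Int measurable_sets) auto
  also have "A \<inter> ((\<lambda>x i. x (i + n)) -` B \<inter> space borel) = {x \<in> A. (\<lambda>i. x (i + n)) \<in> B}" by auto
  finally show E: "{x \<in> A. (\<lambda>i. x (i + n)) \<in> B} \<in> sets borel" .
  have "emeasure S {x \<in> A. (\<lambda>i. x (i + n)) \<in> B} =
      emeasure (distr (S \<Otimes>\<^sub>M S) S (\<lambda>(x, y). comb_seq n x y)) {x \<in> A. (\<lambda>i. x (i + n)) \<in> B}"
    unfolding PiM_comb_seq ..
  also have "\<dots> = emeasure (S \<Otimes>\<^sub>M S) ((\<lambda>(x, y). comb_seq n x y) -` {x \<in> A. (\<lambda>i. x (i + n)) \<in> B} \<inter> space (S \<Otimes>\<^sub>M S))"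
    using E by (intro emeasure_distr measurable_comb_seq) (simp add: sets_S)
  also have "(\<lambda>(x, y). comb_seq n x y) -` {x \<in> A. (\<lambda>i. x (i + n)) \<in> B} \<inter> space (S \<Otimes>\<^sub>M S) = A \<times> B"
  proof -
    have "comb_seq n x y \<in> A \<longleftrightarrow> x \<in> A" for x y by (rule dep) (simp add: comb_seq_less)
    then show ?thesis by (auto simp: comb_seq_add space_pair_measure space_S)
  qed
  also have "emeasure (S \<Otimes>\<^sub>M S) (A \<times> B) = emeasure S A * emeasure S B"
    using A B by (intro P.emeasure_pair_measure_Times) (auto simp: sets_S)
  finally show "measure S {x \<in> A. (\<lambda>i. x (i + n)) \<in> B} = measure S A * measure S B"
    by (simp add: measure_def enn2real_mult)
qed

text \<open>\<open>Suc q\<close> excludes zero blocks: \<open>emp_mgf 0\<close> is constantly 0 and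
  \<open>emp_box F H e 0\<close> may be empty, whereas the zeroth power is 1.\<close>

lemma emp_box_power:
  assumes "0 < m"
  shows "measure S (emp_box F H e m) ^ Suc q \<le> measure S (emp_box F H e (Suc q * m))"
proof (induction q)
  case (Suc q)
  let ?D = "emp_box F H e"
  have "measure S (?D m) ^ Suc (Suc q) = measure S (?D m) ^ Suc q * measure S (?D m)" by simp
  also have "\<dots> \<le> measure S (?D (Suc q * m)) * measure S (?D m)" using Suc by (intro mult_right_mono) auto
  also have "\<dots> = measure S {x \<in> ?D (Suc q * m). (\<lambda>i. x (i + Suc q * m)) \<in> ?D m}"
    by (intro measure_shift(2)[symmetric] emp_box_measurable emp_box_cong)
  also have "\<dots> \<le> measure S (?D (Suc q * m + m))"
    using assms by (intro P.finite_measure_mono) (auto simp: sets_S emp_box_measurable intro: emp_box_add)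
  also have "Suc q * m + m = Suc (Suc q) * m" by simp
  finally show ?case .
qed simp

text \<open>Continuity of the measure. It controls the incomplete last block with a probability
  independent of the sample size.\<close>

lemma bounded_start:
  obtains R where "0 \<le> R" "1 / 2 \<le> measure S {x. \<forall>i<m. \<bar>x i\<bar> \<le> R}" "{x :: nat \<Rightarrow> real. \<forall>i<m. \<bar>x i\<bar> \<le> R} \<in> sets borel"
proof -
  have "closed {x :: nat \<Rightarrow> real. \<forall>i. i < m \<longrightarrow> \<bar>x i\<bar> \<le> R}" for R
  proof -
    have "{x :: nat \<Rightarrow> real. \<forall>i. i < m \<longrightarrow> \<bar>x i\<bar> \<le> R} = (\<Inter>i\<in>{..<m}. {x. \<bar>x i\<bar> \<le> R})" by auto
    then show ?thesis
      by (auto intro!: closed_INT closed_Collect_le continuous_intros continuous_on_product_coordinates)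
  qed
  then have meas: "{x :: nat \<Rightarrow> real. \<forall>i<m. \<bar>x i\<bar> \<le> R} \<in> sets borel" for R by (rule borel_closed)
  let ?A = "\<lambda>k::nat. {x :: nat \<Rightarrow> real. \<forall>i<m. \<bar>x i\<bar> \<le> real k}"
  have "(\<Union>k. ?A k) = UNIV"
  proof -
    have "\<exists>k. x \<in> ?A k" for x
    proof -
      obtain k where k: "(\<Sum>i<m. \<bar>x i\<bar>) \<le> real k" using real_arch_simple by blast
      have "\<bar>x i\<bar> \<le> (\<Sum>i<m. \<bar>x i\<bar>)" if "i < m" for i using that by (intro member_le_sum) auto
      then show ?thesis using k by (auto intro: order_trans)
    qed
    then show ?thesis by blast
  qed
  moreover have "(\<lambda>k. measure S (?A k)) \<longlonglongrightarrow> measure S (\<Union>k. ?A k)"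
    by (intro P.finite_Lim_measure_incseq) (auto simp: incseq_def sets_S meas intro: order_trans)
  ultimately have "(\<lambda>k. measure S (?A k)) \<longlonglongrightarrow> 1" using P.prob_space by (simp add: space_S)
  then have "eventually (\<lambda>k. 1 / 2 < measure S (?A k)) sequentially" by (intro order_tendstoD(1)) auto
  then obtain k where "1 / 2 < measure S (?A k)" using eventually_happens'[OF sequentially_bot] by blast
  then show ?thesis using that[of "real k"] meas by simp
qed

text \<open>Split \<open>n\<close> entries into full blocks of length \<open>m\<close> and fewer
  than \<open>m\<close> others. Full blocks within the tightened bounds and a bounded remainder put
  the sample into \<open>A n\<close> for large \<open>n\<close>; the remainder costs a factor 1/2,
  invisible on the exponential scale.\<close>

lemma emp_box_rate:
  assumes F: "finite F" and H: "\<And>t b. (t, b) \<in> H \<Longrightarrow> b \<le> E" and e: "e > 0" and m: "0 < m"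
    and A: "\<And>n. 0 < n \<Longrightarrow> A n \<in> sets borel"
      "\<And>n x. 0 < n \<Longrightarrow> \<forall>(t, c)\<in>F. emp_mgf n x t < c \<Longrightarrow> \<forall>(t, b)\<in>H. b < emp_mgf n x t \<Longrightarrow> x \<in> A n"
  shows "eln (measure S (emp_box F H e m)) / ereal (real m) \<le> liminf (\<lambda>n. eln (measure S (A n)) / ereal (real n))"
proof -
  let ?D = "emp_box F H e"
  define a where "a = measure S (?D m)"
  show ?thesis
  proof (cases "a > 0")
    case False
    then have "eln a / ereal (real m) = - \<infinity>" using m by (simp add: eln_def)
    then show ?thesis by (simp add: a_def)
  next
    case a: True
    have a1: "ln a \<le> 0" using a by (simp add: a_def)
    obtain R where R: "0 \<le> R" "1 / 2 \<le> measure S {x. \<forall>i<m. \<bar>x i\<bar> \<le> R}"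
      "{x :: nat \<Rightarrow> real. \<forall>i<m. \<bar>x i\<bar> \<le> R} \<in> sets borel"
      using bounded_start[of m] by blast
    let ?W = "{x :: nat \<Rightarrow> real. \<forall>i<m. \<bar>x i\<bar> \<le> R}"
    \<comment> \<open>Finiteness of \<open>F\<close> bounds the exponents, hence the contribution
      exp(T R) of each remaining entry.\<close>
    define T where "T = Max (insert 0 ((\<lambda>q. \<bar>fst q\<bar>) ` F))"
    have T: "\<bar>t\<bar> \<le> T" if "(t, c) \<in> F" for t c
      unfolding T_def using F that by (intro Max_ge) (auto intro!: image_eqI[of _ _ "(t, c)"])
    \<comment> \<open>For n > N the remainder adds less than e n in the upper bounds, and passing
      from \<open>?k\<close> to \<open>n\<close> in the denominator costs less than e n in the lower
      ones.\<close>
    define N where "N = real m * max (exp (T * R)) (\<bar>E\<bar> + e) / e"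
    have "eventually (\<lambda>n. N < real n) sequentially"
      using filterlim_real_sequentially unfolding filterlim_at_top_dense by blast
    then have "eventually (\<lambda>n. ereal (ln a / real m - ln 2 / real n) \<le> eln (measure S (A n)) / ereal (real n)) sequentially"
      using eventually_ge_at_top[of m]
    proof eventually_elim
      case (elim n)
      have n0: "0 < n" using elim m by simp
      \<comment> \<open>One less than the number of full blocks, to match
        \<open>Suc q\<close>.\<close>
      define q where "q = n div m - 1"
      define s where "s = n mod m"
      have "n div m \<ge> 1" using elim m by (simp add: Suc_le_eq div_greater_zero_iff)
      then have n: "n = Suc q * m + s" using m div_mult_mod_eq[of n m] by (simp add: q_def s_def)
      have s: "s < m" using m by (simp add: s_def)
      let ?k = "Suc q * m"
      have k0: "0 < ?k" using m by simp
      have Nn: "real m * exp (T * R) < e * real n" "real m * (\<bar>E\<bar> + e) < e * real n"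
      proof -
        have "real m * max (exp (T * R)) (\<bar>E\<bar> + e) < e * real n"
          using elim(1) e by (simp add: N_def field_simps)
        moreover have "real m * exp (T * R) \<le> real m * max (exp (T * R)) (\<bar>E\<bar> + e)"
          "real m * (\<bar>E\<bar> + e) \<le> real m * max (exp (T * R)) (\<bar>E\<bar> + e)"
          by (intro mult_left_mono; simp)+
        ultimately show "real m * exp (T * R) < e * real n" "real m * (\<bar>E\<bar> + e) < e * real n" by linarith+
      qed
      have sub: "{x \<in> ?D ?k. (\<lambda>i. x (i + ?k)) \<in> ?W} \<subseteq> A n"
      proof
        fix x assume x: "x \<in> {x \<in> ?D ?k. (\<lambda>i. x (i + ?k)) \<in> ?W}"
        have split: "real n * emp_mgf n x t = real ?k * emp_mgf ?k x t + (\<Sum>i<s. exp (t * x (i + ?k)))" for t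
        proof -
          have "real n * emp_mgf n x t = real ?k * emp_mgf ?k x t + real s * emp_mgf s (\<lambda>i. x (i + ?k)) t"
            using emp_mgf_split[of ?k s x t] n0 unfolding n[symmetric] by simp
          also have "real s * emp_mgf s (\<lambda>i. x (i + ?k)) t = (\<Sum>i<s. exp (t * x (i + ?k)))"
            by (cases "s = 0") (simp_all add: emp_mgf_def)
          finally show ?thesis .
        qed
        have kpos: "0 < emp_mgf ?k x t" for t using emp_mgf_pos[OF k0] .
        have kn: "real ?k = real n - real s" using n by simp
        show "x \<in> A n"
        proof (rule A(2)[OF n0])
          show "\<forall>(t, c)\<in>F. emp_mgf n x t < c"
          proof (clarify)
            fix t c assume tc: "(t, c) \<in> F"
            have le: "emp_mgf ?k x t \<le> c - e" using x tc by (auto simp: emp_box_def)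
            have "(\<Sum>i<s. exp (t * x (i + ?k))) \<le> (\<Sum>i<s. exp (T * R))"
            proof (intro sum_mono)
              fix i assume "i \<in> {..<s}"
              then have "\<bar>x (i + ?k)\<bar> \<le> R" using x s by auto
              then have "\<bar>t\<bar> * \<bar>x (i + ?k)\<bar> \<le> T * R" using T[OF tc] by (intro mult_mono) auto
              then have "t * x (i + ?k) \<le> T * R" by (metis abs_le_D1 abs_mult)
              then show "exp (t * x (i + ?k)) \<le> exp (T * R)" by simp
            qed
            also have "\<dots> \<le> real m * exp (T * R)" using s by simp
            also have "\<dots> < e * real n" by (rule Nn(1))
            finally have "(\<Sum>i<s. exp (t * x (i + ?k))) < e * real n" .
            moreover have "real ?k * emp_mgf ?k x t \<le> real n * (c - e)"
              using le kpos[of t] kn by (intro mult_mono) auto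
            ultimately have "real n * emp_mgf n x t < real n * c" unfolding split by (simp add: algebra_simps)
            then show "emp_mgf n x t < c" using n0 by simp
          qed
          show "\<forall>(t, b)\<in>H. b < emp_mgf n x t"
          proof (clarify)
            fix t b assume tb: "(t, b) \<in> H"
            have ge: "b + e \<le> emp_mgf ?k x t" using x tb by (auto simp: emp_box_def)
            \<comment> \<open>For b + e <= 0 positivity of the exponentials suffices; otherwise the
              remainder is dropped as nonnegative.\<close>
            show "b < emp_mgf n x t"
            proof (cases "b + e \<le> 0")
              case True
              then show ?thesis using emp_mgf_pos[OF n0, of x t] e by linarith
            next
              case False
              have "real s * (b + e) \<le> real m * (\<bar>E\<bar> + e)"
                using s False H[OF tb] by (intro mult_mono) auto
              also have "\<dots> < e * real n" by (rule Nn(2))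
              finally have "real n * b < (real n - real s) * (b + e)" by (simp add: algebra_simps)
              also have "\<dots> \<le> real ?k * emp_mgf ?k x t" unfolding kn[symmetric] using ge by (intro mult_left_mono) auto
              also have "\<dots> \<le> real n * emp_mgf n x t" unfolding split by (simp add: sum_nonneg)
              finally show ?thesis using n0 by simp
            qed
          qed
        qed
      qed
      have "a ^ Suc q * (1 / 2) \<le> measure S (?D ?k) * measure S ?W"
        using emp_box_power[OF m, of F H e q] R(2) by (intro mult_mono) (auto simp: a_def)
      also have "\<dots> = measure S {x \<in> ?D ?k. (\<lambda>i. x (i + ?k)) \<in> ?W}"
        by (intro measure_shift(2)[symmetric] emp_box_measurable R(3) emp_box_cong)
      also have "\<dots> \<le> measure S (A n)"
        using sub A(1)[OF n0] by (intro P.finite_measure_mono) (auto simp: sets_S)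
      finally have "eln (a ^ Suc q * (1 / 2)) \<le> eln (measure S (A n))" by (rule eln_mono)
      then have 1: "eln (a ^ Suc q * (1 / 2)) / ereal (real n) \<le> eln (measure S (A n)) / ereal (real n)"
        using n0 by (intro ereal_divide_right_mono) auto
      have 2: "eln (a ^ Suc q * (1 / 2)) / ereal (real n) = ereal ((real (Suc q) * ln a - ln 2) / real n)"
      proof -
        have "ln (a ^ Suc q * (1 / 2)) = real (Suc q) * ln a - ln 2"
          using a by (subst ln_mult) (simp_all add: ln_realpow ln_div del: power_Suc)
        moreover have "0 < a ^ Suc q * (1 / 2)" using a by simp
        ultimately show ?thesis using n0 unfolding eln_def by (simp del: power_Suc)
      qed
      have "ln a / real m - ln 2 / real n \<le> (real (Suc q) * ln a - ln 2) / real n"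
      proof -
        have "real ?k \<le> real n" using n by simp
        \<comment> \<open>\<open>ln a\<close> is nonpositive, so having at most n / m blocks only
          raises the product.\<close>
        then have "real (Suc q) / real n \<le> 1 / real m" using m n0 by (simp add: field_simps)
        then have "(1 / real m) * ln a \<le> (real (Suc q) / real n) * ln a" using a1 by (intro mult_right_mono_neg) auto
        then show ?thesis by (simp add: diff_divide_distrib)
      qed
      then have "ereal (ln a / real m - ln 2 / real n) \<le> eln (a ^ Suc q * (1 / 2)) / ereal (real n)"
        unfolding 2 by simp
      from order_trans[OF this 1] show ?case .
    qed
    then have "liminf (\<lambda>n. ereal (ln a / real m - ln 2 / real n)) \<le> liminf (\<lambda>n. eln (measure S (A n)) / ereal (real n))"
      by (rule Liminf_mono)
    moreover have "(\<lambda>n. ln a / real m - ln 2 / real n) \<longlonglongrightarrow> ln a / real m - 0"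
      by (intro tendsto_diff tendsto_const tendsto_divide_0[OF tendsto_const] filterlim_real_at_infinity_sequentially)
    then have "(\<lambda>n. ereal (ln a / real m - ln 2 / real n)) \<longlonglongrightarrow> ereal (ln a / real m)" by simp
    then have "liminf (\<lambda>n. ereal (ln a / real m - ln 2 / real n)) = ereal (ln a / real m)"
      by (rule lim_imp_Liminf[OF sequentially_bot])
    ultimately show ?thesis using a m by (simp add: eln_def a_def)
  qed
qed

text \<open>The rate of \<open>U\<close> at each single block length \<open>m\<close> is at most the
  liminf for \<open>G\<close>, hence so is the limsup over \<open>m\<close>.\<close>

lemma limsup_le_liminf:
  assumes f: "f \<in> XM" and G: "openin AW_M G" "f \<in> G"
  obtains U where "openin AW_M U" "f \<in> U"
    "limsup (\<lambda>n. eln (measure S {x. (\<lambda>t. ereal (emp_mgf n x t)) \<in> U}) / ereal (real n))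
      \<le> liminf (\<lambda>n. eln (measure S {x. (\<lambda>t. ereal (emp_mgf n x t)) \<in> G}) / ereal (real n))"
proof (rule XM_convex_nbhd[OF f G])
  fix F H :: "(real \<times> real) set" and E e U
  assume U: "finite F" "\<And>t b. (t, b) \<in> H \<Longrightarrow> b \<le> E" "e > 0" "openin AW_M U" "f \<in> U"
    "\<And>g t c. g \<in> U \<Longrightarrow> (t, c) \<in> F \<Longrightarrow> g t \<le> ereal (c - e)"
    "\<And>g t b. g \<in> U \<Longrightarrow> (t, b) \<in> H \<Longrightarrow> ereal (b + e) \<le> g t"
    "\<And>g. g \<in> XM \<Longrightarrow> \<forall>(t, c)\<in>F. g t < ereal c \<Longrightarrow> \<forall>(t, b)\<in>H. ereal b < g t \<Longrightarrow> g \<in> G"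
  let ?L = "liminf (\<lambda>n. eln (measure S {x. (\<lambda>t. ereal (emp_mgf n x t)) \<in> G}) / ereal (real n))"
  have "limsup (\<lambda>n. eln (measure S {x. (\<lambda>t. ereal (emp_mgf n x t)) \<in> U}) / ereal (real n)) \<le> ?L"
  proof (rule Limsup_bounded)
    show "eventually (\<lambda>m. eln (measure S {x. (\<lambda>t. ereal (emp_mgf m x t)) \<in> U}) / ereal (real m) \<le> ?L) sequentially"
      using eventually_gt_at_top[of 0]
    proof eventually_elim
      case (elim m)
      have "{x. (\<lambda>t. ereal (emp_mgf m x t)) \<in> U} \<subseteq> emp_box F H e m"
        using U(6,7) by (fastforce simp: emp_box_def)
      then have "measure S {x. (\<lambda>t. ereal (emp_mgf m x t)) \<in> U} \<le> measure S (emp_box F H e m)"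
        by (intro P.finite_measure_mono) (auto simp: sets_S emp_box_measurable)
      then have "eln (measure S {x. (\<lambda>t. ereal (emp_mgf m x t)) \<in> U}) / ereal (real m)
          \<le> eln (measure S (emp_box F H e m)) / ereal (real m)"
        using elim by (intro ereal_divide_right_mono eln_mono) auto
      also have "\<dots> \<le> ?L"
      proof (rule emp_box_rate[OF U(1) _ U(3) elim])
        fix n :: nat assume n: "0 < n"
        show "{x. (\<lambda>t. ereal (emp_mgf n x t)) \<in> G} \<in> sets borel"
          by (intro borel_open open_emp_mgf_vimage n G)
        fix x assume "\<forall>(t, c)\<in>F. emp_mgf n x t < c" "\<forall>(t, b)\<in>H. b < emp_mgf n x t"
        then show "x \<in> {x. (\<lambda>t. ereal (emp_mgf n x t)) \<in> G}"
          using U(8)[OF emp_mgf_in_XM[OF n, of x]] by simp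
      qed (rule U(2))
      finally show ?case .
    qed
  qed
  then show ?thesis using that U by blast
qed

end


subsection \<open>Exponential tightness\<close>

text \<open>Choose radii r j with tail mass below 2^(-j-1) and let exp(u(y)) be 1 plus the number of
  radii below y: its integral is at most 1 + 1. Thus \<open>u\<close> grows only as fast as the
  tails of the law allow.\<close>

lemma exists_exponential_moment:
  assumes \<mu>: "real_prob \<mu>"
  obtains u :: "real \<Rightarrow> real" where "\<And>r. 0 \<le> u r" "mono u" "filterlim u at_top at_top"
    "(\<integral>\<^sup>+ x. ennreal (exp (u \<bar>x\<bar>)) \<partial>\<mu>) \<le> 2"
proof -
  interpret prob_space \<mu> using real_probD(1)[OF \<mu>] .
  have [measurable_cong]: "sets \<mu> = sets borel" using real_probD(2)[OF \<mu>] .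
  \<comment> \<open>The lower bound \<open>real j\<close> makes the number of radii below any point
    finite.\<close>
  have "\<exists>R. real j \<le> R \<and> prob {x. R < \<bar>x\<bar>} < (1 / 2) ^ Suc j" for j
    using eventually_happens'[OF _ eventually_conj[OF eventually_ge_at_top[of "real j"] real_prob_tight[OF \<mu>, of "(1 / 2) ^ Suc j"]]]
    by auto
  then obtain r where r: "\<And>j. real j \<le> r j" "\<And>j. prob {x. r j < \<bar>x\<bar>} < (1 / 2) ^ Suc j" by metis
  have fin: "finite {j. r j < y}" for y
  proof (rule finite_subset)
    show "{j. r j < y} \<subseteq> {..nat \<lceil>y\<rceil>}"
    proof
      fix j assume "j \<in> {j. r j < y}"
      then have "real j < y" using r(1)[of j] by simp
      then show "j \<in> {..nat \<lceil>y\<rceil>}" by (simp add: le_nat_iff ceiling_def) linarith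
    qed
  qed simp
  define u where "u y = ln (1 + real (card {j. r j < y}))" for y
  have mono: "mono u"
    unfolding u_def by (intro monoI) (auto intro!: card_mono fin)
  have lim: "filterlim u at_top at_top"
    unfolding filterlim_at_top
  proof
    fix Z :: real
    define m where "m = nat \<lceil>exp Z\<rceil>"
    have "eventually (\<lambda>y. \<forall>j\<in>{..<m}. r j < y) at_top"
      by (intro eventually_ball_finite ballI eventually_gt_at_top) simp
    then show "eventually (\<lambda>y. Z \<le> u y) at_top"
    proof eventually_elim
      case (elim y)
      then have "card {..<m} \<le> card {j. r j < y}" by (intro card_mono fin) auto
      then have "exp Z \<le> 1 + real (card {j. r j < y})" unfolding m_def by simp
      then have "ln (exp Z) \<le> u y" unfolding u_def by (intro ln_mono) auto
      then show ?case by simp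
    qed
  qed
  have "(\<integral>\<^sup>+ x. ennreal (exp (u \<bar>x\<bar>)) \<partial>\<mu>) = (\<integral>\<^sup>+ x. 1 + (\<Sum>j. indicator {x. r j < \<bar>x\<bar>} x) \<partial>\<mu>)"
  proof (intro nn_integral_cong)
    fix x
    have "(\<Sum>j. indicator {x. r j < \<bar>x\<bar>} x :: ennreal) = (\<Sum>j\<in>{j. r j < \<bar>x\<bar>}. indicator {x. r j < \<bar>x\<bar>} x)"
      by (intro suminf_finite fin) auto
    also have "\<dots> = (\<Sum>j\<in>{j. r j < \<bar>x\<bar>}. 1)" by (intro sum.cong) auto
    also have "\<dots> = ennreal (real (card {j. r j < \<bar>x\<bar>}))" by (simp add: ennreal_of_nat_eq_real_of_nat)
    finally show "ennreal (exp (u \<bar>x\<bar>)) = 1 + (\<Sum>j. indicator {x. r j < \<bar>x\<bar>} x)"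
      by (simp add: u_def)
  qed
  also have "\<dots> = 1 + (\<Sum>j. emeasure \<mu> {x. r j < \<bar>x\<bar>})"
    by (simp add: nn_integral_add nn_integral_suminf emeasure_space_1)
  also have "(\<Sum>j. emeasure \<mu> {x. r j < \<bar>x\<bar>}) \<le> (\<Sum>j. ennreal ((1 / 2) ^ Suc j))"
    using r(2) by (intro suminf_le) (auto simp: emeasure_eq_measure less_imp_le intro!: ennreal_leI simp del: power_Suc)
  also have "(\<Sum>j. ennreal ((1 / 2) ^ Suc j)) = ennreal 1"
    by (rule suminf_ennreal_eq[OF _ power_half_series]) simp
  finally have "(\<integral>\<^sup>+ x. ennreal (exp (u \<bar>x\<bar>)) \<partial>\<mu>) \<le> 2" by simp
  moreover have "0 \<le> u y" for y by (simp add: u_def)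
  ultimately show ?thesis using that mono lim by blast
qed

lemma real_sequence_space_of_law:
  assumes "real_prob \<mu>" shows "real_sequence_space \<mu>"
proof -
  interpret prob_space \<mu> using real_probD(1)[OF assms] .
  show ?thesis by unfold_locales (rule real_probD(2)[OF assms])
qed

section \<open>The large deviation principle for i.i.d. sequences\<close>

locale iid_real = prob_space P for P :: "'a measure" +
  fixes X :: "nat \<Rightarrow> 'a \<Rightarrow> real" and \<mu> :: "real measure"
  assumes indep: "indep_vars (\<lambda>_. borel) X UNIV" and distr: "\<And>i. distr P borel (X i) = \<mu>"
begin

lemma X_measurable [measurable]: "X i \<in> borel_measurable P"
  using indep by (auto simp: indep_vars_def)

lemma real_prob_law: "real_prob \<mu>"
  unfolding real_prob_def distr[of 0, symmetric] by (auto intro!: prob_space_distr)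

sublocale seq: real_sequence_space \<mu>
  by (rule real_sequence_space_of_law[OF real_prob_law])

text \<open>Independence with a common law means that the sequence has the product law, so
  probabilities move to the canonical space.\<close>

lemma measure_X:
  assumes B: "B \<in> sets borel"
  shows "{\<omega> \<in> space P. (\<lambda>i. X i \<omega>) \<in> B} \<in> events"
    "measure P {\<omega> \<in> space P. (\<lambda>i. X i \<omega>) \<in> B} = measure seq.S B"
proof -
  have meas: "(\<lambda>\<omega> i. X i \<omega>) \<in> P \<rightarrow>\<^sub>M (\<Pi>\<^sub>M i\<in>UNIV. borel)"
    by (intro measurable_PiM_single') (auto simp: space_PiM)
  have "distr P (\<Pi>\<^sub>M i\<in>UNIV. borel) (\<lambda>\<omega>. \<lambda>i\<in>UNIV. X i \<omega>) = (\<Pi>\<^sub>M i\<in>UNIV. distr P borel (X i))"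
    using indep by (subst indep_vars_iff_distr_eq_PiM[symmetric]) auto
  then have S: "distr P (\<Pi>\<^sub>M i\<in>UNIV. borel) (\<lambda>\<omega> i. X i \<omega>) = seq.S" by (simp add: distr restrict_UNIV)
  have B': "B \<in> sets (\<Pi>\<^sub>M i\<in>(UNIV::nat set). (borel :: real measure))" using B by (simp add: sets_PiM_equal_borel)
  have eq: "(\<lambda>\<omega> i. X i \<omega>) -` B \<inter> space P = {\<omega> \<in> space P. (\<lambda>i. X i \<omega>) \<in> B}" by auto
  show "{\<omega> \<in> space P. (\<lambda>i. X i \<omega>) \<in> B} \<in> events"
    using measurable_sets[OF meas B'] unfolding eq .
  show "measure P {\<omega> \<in> space P. (\<lambda>i. X i \<omega>) \<in> B} = measure seq.S B"
    unfolding S[symmetric] using measure_distr[OF meas B'] unfolding eq by simp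
qed

definition pM :: "(real \<Rightarrow> ereal) set \<Rightarrow> nat \<Rightarrow> real" where
  "pM A n = measure P {\<omega> \<in> space P. Mn X n \<omega> \<in> A}"

definition upper_rate :: "(real \<Rightarrow> ereal) set \<Rightarrow> ereal" where
  "upper_rate A = limsup (\<lambda>n. eln (pM A n) / ereal (real n))"

definition lower_rate :: "(real \<Rightarrow> ereal) set \<Rightarrow> ereal" where
  "lower_rate A = liminf (\<lambda>n. eln (pM A n) / ereal (real n))"

lemma Mn_event:
  assumes "openin AW_M G" "0 < n"
  shows "{\<omega> \<in> space P. Mn X n \<omega> \<in> G} \<in> events"
    "pM G n = measure seq.S {x. (\<lambda>t. ereal (emp_mgf n x t)) \<in> G}"
  using measure_X[OF borel_open[OF open_emp_mgf_vimage[OF assms(2,1)]]]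
  by (simp_all add: pM_def Mn_emp_mgf)

lemma Mn_in_XM: "0 < n \<Longrightarrow> Mn X n \<omega> \<in> XM"
  by (simp add: Mn_emp_mgf emp_mgf_in_XM)

lemma upper_rate_le_lower_rate:
  assumes "f \<in> XM" "openin AW_M G" "f \<in> G"
  obtains U where "openin AW_M U" "f \<in> U" "upper_rate U \<le> lower_rate G"
proof (rule seq.limsup_le_liminf[OF assms])
  fix U assume U: "openin AW_M U" "f \<in> U"
    and le: "limsup (\<lambda>n. eln (measure seq.S {x. (\<lambda>t. ereal (emp_mgf n x t)) \<in> U}) / ereal (real n))
      \<le> liminf (\<lambda>n. eln (measure seq.S {x. (\<lambda>t. ereal (emp_mgf n x t)) \<in> G}) / ereal (real n))"
  have ev: "eventually (\<lambda>n. eln (pM V n) / ereal (real n) =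
      eln (measure seq.S {x. (\<lambda>t. ereal (emp_mgf n x t)) \<in> V}) / ereal (real n)) sequentially"
    if "openin AW_M V" for V
    using eventually_gt_at_top[of 0] by eventually_elim (simp add: Mn_event(2)[OF that])
  have "upper_rate U \<le> lower_rate G"
    unfolding upper_rate_def lower_rate_def Limsup_eq[OF ev[OF U(1)]] Liminf_eq[OF ev[OF assms(2)]] by (rule le)
  then show ?thesis using that U by blast
qed

lemma pM_le_one: "pM A n \<le> 1"
  by (simp add: pM_def)

lemma upper_rate_nonpos: "upper_rate A \<le> 0"
  using limsup_eln_leI[of "pM A" 1 0] pM_le_one by (simp add: upper_rate_def zero_ereal_def)

lemma lower_rate_le_upper_rate: "lower_rate A \<le> upper_rate A"
  unfolding lower_rate_def upper_rate_def by (rule Liminf_le_Limsup) simp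

text \<open>Measurability is asked of the cover, through openness, not of \<open>A\<close>. For
  positive \<open>n\<close> the values of \<open>Mn X n\<close> lie in \<open>XM\<close>, whereas
  \<open>Mn X 0\<close> is the zero function.\<close>

lemma pM_sum_le:
  assumes "finite I" "\<And>i. i \<in> I \<Longrightarrow> openin AW_M (G i)" "A \<inter> XM \<subseteq> (\<Union>i\<in>I. G i)" "0 < n"
  shows "pM A n \<le> (\<Sum>i\<in>I. pM (G i) n)"
proof -
  have ev: "(\<lambda>i. {\<omega> \<in> space P. Mn X n \<omega> \<in> G i}) ` I \<subseteq> events"
    using Mn_event(1)[OF assms(2) assms(4)] by auto
  have "pM A n \<le> measure P (\<Union>i\<in>I. {\<omega> \<in> space P. Mn X n \<omega> \<in> G i})"
    unfolding pM_def
    using assms(1,3) ev Mn_in_XM[OF assms(4)] by (intro finite_measure_mono sets.finite_UN) blast+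
  also have "\<dots> \<le> (\<Sum>i\<in>I. pM (G i) n)"
    unfolding pM_def using assms(1) ev by (intro finite_measure_subadditive_finite) auto
  finally show ?thesis .
qed

text \<open>By Markov's inequality the mean of u(|X i|) exceeds K with probability at most exp(- n
  K) 2^n; otherwise the empirical transform lies in \<open>tail_bounded u K\<close>.\<close>

lemma exponential_tightness:
  obtains C where "compactin AW_M C" "closedin AW_M C" "upper_rate (XM - C) \<le> - ereal a"
proof -
  obtain u :: "real \<Rightarrow> real" where u: "\<And>r. 0 \<le> u r" "mono u" "filterlim u at_top at_top"
    "(\<integral>\<^sup>+ x. ennreal (exp (u \<bar>x\<bar>)) \<partial>\<mu>) \<le> 2"
    using exists_exponential_moment[OF real_prob_law] by blast
  have [measurable]: "u \<in> borel_measurable borel" by (rule borel_measurable_mono[OF u(2)])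
  \<comment> \<open>One more than \<open>a\<close>, to pay for the factor 2 <= exp 1 per
    variable.\<close>
  define K where "K = a + 1"
  define C where "C = AW closure_of tail_bounded u K"
  note C = compactin_tail_bounded[OF u(3), of K, folded C_def]
  have "pM (XM - C) n \<le> 1 * exp (real n * - a)" if n: "0 < n" for n
  proof -
    let ?V = "\<lambda>\<omega>. \<Prod>i<n. ennreal (exp (u \<bar>X i \<omega>\<bar>))"
    have "openin AW_M (XM - C)" using C(2) openin_diff[OF openin_topspace, of AW_M C] by simp
    from Mn_event(1)[OF this n] have meas: "{\<omega> \<in> space P. Mn X n \<omega> \<in> XM - C} \<in> events" .
    have "(\<integral>\<^sup>+ \<omega>. ?V \<omega> \<partial>P) = (\<Prod>i<n. \<integral>\<^sup>+ \<omega>. ennreal (exp (u \<bar>X i \<omega>\<bar>)) \<partial>P)"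
    proof (intro indep_vars_nn_integral)
      have "indep_vars (\<lambda>_. borel) X {..<n}" by (rule indep_vars_subset[OF indep]) auto
      then show "indep_vars (\<lambda>_. borel) (\<lambda>i \<omega>. ennreal (exp (u \<bar>X i \<omega>\<bar>))) {..<n}"
        by (rule indep_vars_compose2) measurable
    qed auto
    also have "\<dots> \<le> (\<Prod>i<n. 2)"
    proof (intro prod_mono_ennreal)
      fix i
      have "(\<integral>\<^sup>+ \<omega>. ennreal (exp (u \<bar>X i \<omega>\<bar>)) \<partial>P) = (\<integral>\<^sup>+ x. ennreal (exp (u \<bar>x\<bar>)) \<partial>distr P borel (X i))"
        by (subst nn_integral_distr) auto
      then show "(\<integral>\<^sup>+ \<omega>. ennreal (exp (u \<bar>X i \<omega>\<bar>)) \<partial>P) \<le> 2" using u(4) by (simp add: distr)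
    qed
    finally have prod: "(\<integral>\<^sup>+ \<omega>. ?V \<omega> \<partial>P) \<le> 2 ^ n" by simp
    have "emeasure P {\<omega> \<in> space P. Mn X n \<omega> \<in> XM - C} =
        (\<integral>\<^sup>+ \<omega>. indicator {\<omega> \<in> space P. Mn X n \<omega> \<in> XM - C} \<omega> \<partial>P)" using meas by simp
    also have "\<dots> \<le> (\<integral>\<^sup>+ \<omega>. ennreal (exp (- (real n * K))) * ?V \<omega> \<partial>P)"
    proof (intro nn_integral_mono)
      fix \<omega>
      have V: "?V \<omega> = ennreal (exp (\<Sum>i<n. u \<bar>X i \<omega>\<bar>))" by (simp add: prod_ennreal exp_sum)
      show "indicator {\<omega> \<in> space P. Mn X n \<omega> \<in> XM - C} \<omega> \<le> ennreal (exp (- (real n * K))) * ?V \<omega>"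
      proof (cases "Mn X n \<omega> \<in> XM - C")
        case True
        then have "Mn X n \<omega> \<notin> tail_bounded u K" using C(3) by blast
        then have "\<not> (\<Sum>i<n. u \<bar>X i \<omega>\<bar>) \<le> real n * K"
          using emp_mgf_tail_bounded[OF n u(1,2), of "\<lambda>i. X i \<omega>" K] by (auto simp: Mn_emp_mgf)
        then have "1 \<le> exp (- (real n * K)) * exp (\<Sum>i<n. u \<bar>X i \<omega>\<bar>)" by (simp add: exp_add[symmetric])
        then have "ennreal 1 \<le> ennreal (exp (- (real n * K)) * exp (\<Sum>i<n. u \<bar>X i \<omega>\<bar>))" by (rule ennreal_leI)
        then show ?thesis unfolding V by (simp add: ennreal_mult split: split_indicator)
      qed simp
    qed
    also have "\<dots> = ennreal (exp (- (real n * K))) * (\<integral>\<^sup>+ \<omega>. ?V \<omega> \<partial>P)"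
      by (rule nn_integral_cmult) measurable
    also have "\<dots> \<le> ennreal (exp (- (real n * K))) * 2 ^ n" by (intro mult_left_mono prod) simp
    also have "\<dots> = ennreal (exp (- (real n * K)) * 2 ^ n)" by (simp add: ennreal_mult ennreal_power[symmetric])
    finally have "pM (XM - C) n \<le> exp (- (real n * K)) * 2 ^ n"
      unfolding pM_def by (simp add: emeasure_eq_measure)
    also have "\<dots> \<le> exp (- (real n * K)) * exp 1 ^ n"
    proof -
      have "(2::real) \<le> exp 1" using exp_ge_add_one_self[of 1] by simp
      then show ?thesis by (intro mult_left_mono power_mono) auto
    qed
    also have "\<dots> = exp (real n * - a)"
      by (simp add: K_def exp_of_nat_mult[symmetric] exp_add[symmetric] algebra_simps)
    finally show ?thesis by simp
  qed
  then have "eventually (\<lambda>n. pM (XM - C) n \<le> 1 * exp (real n * - a)) sequentially"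
    by (rule eventually_mono[OF eventually_gt_at_top[of 0]])
  from limsup_eln_leI[OF this] have "upper_rate (XM - C) \<le> - ereal a" by (simp add: upper_rate_def)
  then show ?thesis using that C by blast
qed

lemma I_limsup_eq: "I_limsup P X f = - (INF G \<in> {G. openin AW_M G \<and> f \<in> G}. upper_rate G)"
  and I_liminf_eq: "I_liminf P X f = - (INF G \<in> {G. openin AW_M G \<and> f \<in> G}. lower_rate G)"
  by (simp_all add: I_limsup_def I_liminf_def upper_rate_def lower_rate_def pM_def)

lemma I_limsup_ge: "openin AW_M G \<Longrightarrow> f \<in> G \<Longrightarrow> - upper_rate G \<le> I_limsup P X f"
  unfolding I_limsup_eq by (simp add: INF_lower)

lemma I_limsup_gtE:
  assumes "- I_limsup P X f < c"
  obtains G where "openin AW_M G" "f \<in> G" "upper_rate G < c"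
  using assms unfolding I_limsup_eq by (auto simp: INF_less_iff)

lemma I_limsup_eq_I_liminf:
  assumes f: "f \<in> XM" shows "I_limsup P X f = I_liminf P X f"
proof -
  have "(INF G \<in> {G. openin AW_M G \<and> f \<in> G}. upper_rate G) = (INF G \<in> {G. openin AW_M G \<and> f \<in> G}. lower_rate G)"
  proof (rule antisym)
    show "(INF G \<in> {G. openin AW_M G \<and> f \<in> G}. upper_rate G) \<le> (INF G \<in> {G. openin AW_M G \<and> f \<in> G}. lower_rate G)"
    proof (rule INF_greatest)
      fix G assume "G \<in> {G. openin AW_M G \<and> f \<in> G}"
      then have G: "openin AW_M G" "f \<in> G" by auto
      show "(INF G \<in> {G. openin AW_M G \<and> f \<in> G}. upper_rate G) \<le> lower_rate G"
        by (rule upper_rate_le_lower_rate[OF f G]) (auto intro: INF_lower2)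
    qed
    show "(INF G \<in> {G. openin AW_M G \<and> f \<in> G}. lower_rate G) \<le> (INF G \<in> {G. openin AW_M G \<and> f \<in> G}. upper_rate G)"
      by (intro INF_mono) (auto intro: lower_rate_le_upper_rate)
  qed
  then show ?thesis by (simp add: I_limsup_eq I_liminf_eq)
qed

text \<open>An open set witnessing a large value at \<open>f\<close> witnesses it at each of its
  points, which is lower semicontinuity.\<close>

lemma closedin_I_limsup_le: "closedin AW_M {f \<in> topspace AW_M. I_limsup P X f \<le> c}"
proof -
  have "openin AW_M (topspace AW_M - {f \<in> topspace AW_M. I_limsup P X f \<le> c})"
  proof (subst openin_subopen, intro ballI)
    fix f assume "f \<in> topspace AW_M - {f \<in> topspace AW_M. I_limsup P X f \<le> c}"
    then have f: "f \<in> XM" "c < I_limsup P X f" by auto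
    then have "- I_limsup P X f < - c" by simp
    then obtain G where G: "openin AW_M G" "f \<in> G" "upper_rate G < - c" by (rule I_limsup_gtE)
    have "\<not> I_limsup P X g \<le> c" if "g \<in> G" for g
    proof -
      have "c < - upper_rate G" using G(3) by (simp add: ereal_less_uminus_reorder)
      also have "\<dots> \<le> I_limsup P X g" by (rule I_limsup_ge[OF G(1) that])
      finally show ?thesis by simp
    qed
    then show "\<exists>T. openin AW_M T \<and> f \<in> T \<and> T \<subseteq> topspace AW_M - {f \<in> topspace AW_M. I_limsup P X f \<le> c}"
      using G openin_subset[OF G(1)] by (intro exI[of _ G]) auto
  qed
  then show ?thesis by (simp add: closedin_def)
qed

lemma good_rate_function_I_limsup: "good_rate_function AW_M (I_limsup P X)"
  unfolding good_rate_function_def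
proof (intro conjI ballI allI)
  fix f assume "f \<in> topspace AW_M"
  have "0 \<le> - upper_rate (topspace AW_M)" using upper_rate_nonpos[of "topspace AW_M"] by simp
  also have "\<dots> \<le> I_limsup P X f" by (rule I_limsup_ge[OF openin_topspace]) fact
  finally show "0 \<le> I_limsup P X f" .
next
  fix c :: real
  show cl: "closedin AW_M {f \<in> topspace AW_M. I_limsup P X f \<le> ereal c}" by (rule closedin_I_limsup_le)
  show "compactin AW_M {f \<in> topspace AW_M. I_limsup P X f \<le> ereal c}"
  proof (rule exponential_tightness[of "c + 1"])
    fix C assume C: "compactin AW_M C" "closedin AW_M C" "upper_rate (XM - C) \<le> - ereal (c + 1)"
    have op: "openin AW_M (XM - C)" using C(2) openin_diff[OF openin_topspace, of AW_M C] by simp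
    \<comment> \<open>Points outside \<open>C\<close> have the neighbourhood \<open>XM - C\<close>,
      whose rate forces a value of at least c + 1.\<close>
    have "{f \<in> topspace AW_M. I_limsup P X f \<le> ereal c} \<subseteq> C"
    proof (rule ccontr)
      assume "\<not> {f \<in> topspace AW_M. I_limsup P X f \<le> ereal c} \<subseteq> C"
      then obtain f where f: "f \<in> XM - C" "I_limsup P X f \<le> ereal c" by auto
      have "ereal (c + 1) \<le> - upper_rate (XM - C)"         using ereal_minus_le_minus[of "- ereal (c + 1)" "upper_rate (XM - C)"] C(3) by (simp add: add.commute)
      also have "\<dots> \<le> I_limsup P X f" by (rule I_limsup_ge[OF op f(1)])
      also have "\<dots> \<le> ereal c" by (rule f(2))
      finally show False by simp
    qed
    then show ?thesis by (rule closed_compactin[OF C(1) _ cl])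
  qed
qed

text \<open>The compact part of \<open>F\<close> is covered by finitely many open sets of rate below
  c, the rest is left to exponential tightness, and a finite sum decays like its largest
  term.\<close>

lemma LDP_upper:
  assumes F: "closedin AW_M F"
  shows "upper_rate F \<le> - (INF f\<in>F. I_limsup P X f)"
proof (rule dense_ge)
  fix c' assume c': "- (INF f\<in>F. I_limsup P X f) < c'"
  then obtain c where c: "- (INF f\<in>F. I_limsup P X f) < ereal c" "ereal c < c'" using ereal_dense2 by blast
  have FX: "F \<subseteq> XM" using closedin_subset[OF F] by simp
  have "upper_rate F \<le> ereal c"
  proof (rule exponential_tightness[of "- c + 1"])
    fix C assume C: "compactin AW_M C" "closedin AW_M C" "upper_rate (XM - C) \<le> - ereal (- c + 1)"
    have op: "openin AW_M (XM - C)" using C(2) openin_diff[OF openin_topspace, of AW_M C] by simp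
    have "\<exists>G. openin AW_M G \<and> f \<in> G \<and> upper_rate G < ereal c" if f: "f \<in> F" for f
    proof -
      have "- I_limsup P X f \<le> - (INF f\<in>F. I_limsup P X f)" using f by (simp add: INF_lower)
      then have "- I_limsup P X f < ereal c" using c(1) by (rule le_less_trans)
      then show ?thesis by (rule I_limsup_gtE) blast
    qed
    then obtain G where G: "\<And>f. f \<in> F \<Longrightarrow> openin AW_M (G f)" "\<And>f. f \<in> F \<Longrightarrow> f \<in> G f"
      "\<And>f. f \<in> F \<Longrightarrow> upper_rate (G f) < ereal c" by metis
    have "compactin AW_M (F \<inter> C)" by (rule closed_Int_compactin[OF F C(1)])
    moreover have "F \<inter> C \<subseteq> \<Union> (G ` F)" using G(2) by blast
    ultimately obtain \<F> where \<F>: "finite \<F>" "\<F> \<subseteq> G ` F" "F \<inter> C \<subseteq> \<Union> \<F>"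
      using G(1) unfolding compactin_def by (metis (no_types, lifting) image_iff)
    define \<G> where "\<G> = insert (XM - C) \<F>"
    have fin: "finite \<G>" using \<F>(1) by (simp add: \<G>_def)
    have opG: "openin AW_M V" if "V \<in> \<G>" for V using that op G(1) \<F>(2) by (auto simp: \<G>_def)
    have rate: "upper_rate V < ereal c" if "V \<in> \<G>" for V
    proof -
      \<comment> \<open>The bound obtained for \<open>XM - C\<close> is c - 1.\<close>
      have "upper_rate (XM - C) < ereal c" by (rule le_less_trans[OF C(3)]) simp
      then show ?thesis using that G(3) \<F>(2) by (auto simp: \<G>_def)
    qed
    have "eventually (\<lambda>n. \<forall>V\<in>\<G>. pM V n \<le> exp (real n * c)) sequentially"
      using fin rate unfolding upper_rate_def by (intro eventually_ball_finite ballI limsup_eln_less_imp) auto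
    with eventually_gt_at_top[of 0]
    have "eventually (\<lambda>n. pM F n \<le> real (card \<G>) * exp (real n * c)) sequentially"
    proof eventually_elim
      case (elim n)
      have "pM F n \<le> (\<Sum>V\<in>\<G>. pM V n)"
        using \<F>(3) by (intro pM_sum_le fin opG elim(1)) (auto simp: \<G>_def)
      also have "\<dots> \<le> (\<Sum>V\<in>\<G>. exp (real n * c))" using elim(2) by (intro sum_mono) auto
      finally show ?case by simp
    qed
    then show "upper_rate F \<le> ereal c" unfolding upper_rate_def by (rule limsup_eln_leI)
  qed
  then show "upper_rate F \<le> c'" using c(2) by (auto intro: order_trans)
qed

text \<open>In the liminf form of the rate function, \<open>G\<close> itself is one of the
  neighbourhoods over which the infimum is taken.\<close>

lemma LDP_lower:
  assumes G: "openin AW_M G"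
  shows "- (INF f\<in>G. I_limsup P X f) \<le> lower_rate G"
proof -
  have "- lower_rate G \<le> I_limsup P X f" if f: "f \<in> G" for f
  proof -
    have "f \<in> XM" using openin_subset[OF G] f by auto
    then show ?thesis
      unfolding I_limsup_eq_I_liminf[OF \<open>f \<in> XM\<close>] I_liminf_eq using G f by (simp add: INF_lower)
  qed
  then have "- lower_rate G \<le> (INF f\<in>G. I_limsup P X f)" by (rule INF_greatest)
  then show ?thesis by (metis ereal_uminus_le_reorder)
qed

lemma LDP_Mn: "LDP P AW_M (Mn X) (I_limsup P X)"
  using LDP_upper LDP_lower by (simp add: LDP_def upper_rate_def lower_rate_def pM_def)

end

theorem mainTheorem9:
  fixes P :: "'a measure" and X :: "nat \<Rightarrow> 'a \<Rightarrow> real" and \<mu> :: "real measure"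
  assumes "prob_space P"
    and "prob_space.indep_vars P (\<lambda>_. borel) X UNIV"
    and "\<And>i. distr P borel (X i) = \<mu>"
  shows "XM = (AW closure_of XB) \<inter> {f. f 0 = 1}
     \<and> (\<forall>f \<in> XM. I_limsup P X f = I_liminf P X f)
     \<and> good_rate_function AW_M (I_limsup P X)
     \<and> LDP P AW_M (Mn X) (I_limsup P X)"
proof -
  interpret iid_real P X \<mu>
    using assms by (simp add: iid_real_def iid_real_axioms_def)
  show ?thesis
    using XM_eq_closure I_limsup_eq_I_liminf good_rate_function_I_limsup LDP_Mn by blast
qed

end
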